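(* Let $\mathcal{D}$ be the Steiner system $S(3,6,42)$ on the point set $\{1,\dots,42\}$ defined below. Suppose $\mathcal{E}$ is a Steiner system $S(4,7,43)$ on the point set $\{1,\dots,42\}\cup\{\infty\}$ whose derived design at $\infty$ equals $\mathcal{D}$. Then the stabilizer $\mathrm{Aut}(\mathcal{E})_\infty$ of $\infty$ in the full automorphism group of $\mathcal{E}$ is trivial.
   Context: A Steiner system $S(t,k,v)$ is a pair $(X,\mathcal{B})$ with $|X|=v$ and $\mathcal{B}$ a family of $k$-subsets of $X$ (blocks) such that every $t$-subset of $X$ lies in exactly one block. For a point $P$, the derived design $\mathrm{der}_P\mathcal{E}$ has point set $X\setminus\{P\}$ and blocks $\{B\setminus\{P\} : B\in\mathcal{B},\ P\in B\}$. The full automorphism group $\mathrm{Aut}(\mathcal{E})$ is the group of permutations of the point set mapping the block set onto itself. The design $\mathcal{D}$: let $G=\langle\alpha,\beta\rangle\le S_{42}$ where $\alpha=(1,2,4)(3,9,7)(5,6,8)(10,11,13)(12,18,16)(14,15,17)(19,38,34)(20,39,36)(21,37,35)(22,42,32)(23,40,31)(24,41,33)(28,30,29)$ and $\beta=(1,10)(2,11)(3,12)(4,16)(5,17)(6,18)(7,13)(8,14)(9,15)(19,23)(20,24)(21,22)(25,35)(26,36)(27,34)(28,33)(29,31)(30,32)(38,39)(41,42)$ (a group of order $432$ isomorphic to $\mathrm{AGL}(2,3)$). The block set of $\mathcal{D}$ is the union of the $G$-orbits of the $6$-subsets $\{1,2,3,10,11,12\}$, $\{1,2,4,20,36,39\}$,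 $\{1,2,13,17,31,34\}$, $\{1,10,19,22,25,30\}$, $\{1,11,20,21,29,34\}$, $\{19,20,21,22,23,24\}$, $\{19,22,31,36,38,42\}$; this is an $S(3,6,42)$ design. *)

theory Defs
  imports "HOL-Algebra.Generated_Groups" "HOL-Algebra.Group_Action" "HOL-Algebra.Sym_Groups"
begin

type_synonym 'a incidence = "'a set \<times> 'a set set"

abbreviation points :: "'a incidence \<Rightarrow> 'a set"
  where "points \<equiv> fst"

abbreviation blocks :: "'a incidence \<Rightarrow> 'a set set"
  where "blocks \<equiv> snd"

definition steiner_system :: "nat \<Rightarrow> nat \<Rightarrow> nat \<Rightarrow> 'a incidence \<Rightarrow> bool"
  where "steiner_system t k v E \<longleftrightarrow>
    finite (points E) \<and> card (points E) = v \<and>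
    (\<forall>B \<in> blocks E. B \<subseteq> points E \<and> card B = k) \<and>
    (\<forall>T. T \<subseteq> points E \<and> card T = t \<longrightarrow> (\<exists>!B. B \<in> blocks E \<and> T \<subseteq> B))"

definition derived_design :: "'a \<Rightarrow> 'a incidence \<Rightarrow> 'a incidence"
  where "derived_design P E =
    (points E - {P}, {B - {P} | B. B \<in> blocks E \<and> P \<in> B})"

text \<open>Following the library's permutation groups, a permutation of the point set is a bijection
  of the ambient type that fixes every element outside the point set.\<close>

definition aut_group :: "'a incidence \<Rightarrow> ('a \<Rightarrow> 'a) monoid"
  where "aut_group E =
    \<lparr> carrier = {p. p permutes points E \<and> (\<lambda>B. p ` B) ` blocks E = blocks E},
      monoid.mult = (\<circ>), one = id \<rparr>"

definition perm_of_cycles :: "nat list list \<Rightarrow> nat \<Rightarrow> nat"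
  where "perm_of_cycles css = foldr (\<lambda>cs p. cycle_of_list cs \<circ> p) css id"

definition perm_alpha :: "nat \<Rightarrow> nat"
  where "perm_alpha = perm_of_cycles
    [[1, 2, 4], [3, 9, 7], [5, 6, 8], [10, 11, 13], [12, 18, 16], [14, 15, 17],
     [19, 38, 34], [20, 39, 36], [21, 37, 35], [22, 42, 32], [23, 40, 31], [24, 41, 33],
     [28, 30, 29]]"

definition perm_beta :: "nat \<Rightarrow> nat"
  where "perm_beta = perm_of_cycles
    [[1, 10], [2, 11], [3, 12], [4, 16], [5, 17], [6, 18], [7, 13], [8, 14], [9, 15],
     [19, 23], [20, 24], [21, 22], [25, 35], [26, 36], [27, 34], [28, 33], [29, 31], [30, 32],
     [38, 39], [41, 42]]"

lemma perm_of_cycles_in_sym_group: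
  assumes "\<forall>cs \<in> set css. set cs \<subseteq> {1..n}"
  shows "perm_of_cycles css \<in> carrier (sym_group n)"
proof -
  have "perm_of_cycles css permutes {1..n}"
    using assms
  proof (induction css)
    case Nil
    then show ?case unfolding perm_of_cycles_def by (simp add: permutes_def)
  next
    case (Cons cs css)
    then have "cycle_of_list cs permutes {1..n}"
      by (meson cycle_permutes permutes_subset list.set_intros(1))
    moreover have "perm_of_cycles css permutes {1..n}"
      using Cons by simp
    ultimately have "cycle_of_list cs \<circ> perm_of_cycles css permutes {1..n}"
      by (rule permutes_compose[rotated])
    moreover have "perm_of_cycles (cs # css) = cycle_of_list cs \<circ> perm_of_cycles css"
      unfolding perm_of_cycles_def by simp
    ultimately show ?case by metis
  qed
  then show ?thesis by (simp add: sym_group_def)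
qed

text \<open>\<^const>\<open>subgroup_generated\<close> discards generators outside the carrier; the next two lemmas
  show that nothing is discarded in the definition of \<open>group_G\<close>.\<close>

lemma perm_alpha_in_sym_group: "perm_alpha \<in> carrier (sym_group 42)"
  unfolding perm_alpha_def by (rule perm_of_cycles_in_sym_group) simp

lemma perm_beta_in_sym_group: "perm_beta \<in> carrier (sym_group 42)"
  unfolding perm_beta_def by (rule perm_of_cycles_in_sym_group) simp

definition group_G :: "(nat \<Rightarrow> nat) monoid"
  where "group_G = subgroup_generated (sym_group 42) {perm_alpha, perm_beta}"

definition base_blocks :: "nat set set"
  where "base_blocks =
    {{1, 2, 3, 10, 11, 12}, {1, 2, 4, 20, 36, 39}, {1, 2, 13, 17, 31, 34},
     {1, 10, 19, 22, 25, 30}, {1, 11, 20, 21, 29, 34}, {19, 20, 21, 22, 23, 24},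
     {19, 22, 31, 36, 38, 42}}"

definition design_D :: "nat incidence"
  where "design_D = ({1..42}, (\<Union>S \<in> base_blocks. orbit group_G (\<lambda>g B. g ` B) S))"

end

(*
  An automorphism of E fixing infinity acts on D.  The number of blocks of D that meet three
  blocks through a given pair of points in two points each separates the pairs inside {1..18}
  of the form {x, x + 9} from all pairs through a point of {19..42}; hence every automorphism of D
  preserves {1..18}.  As an automorphism fixing 1 and 19 turns out to be trivial and G is transitive
  on {1..18} x {19..42}, Aut(D) = G acts regularly on these pairs.

  A nontrivial element of G has a power that is conjugate in G to one of five elements of order 2
  or 3, so it suffices to exclude these as automorphisms of some E.  A block of E missing infinity
  meets every block of D in at most three points.  This leaves few invariant blocks through an
  invariant 4-set, and in each of the five cases the invariant 4-sets cannot all be covered: by a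
  short argument on the blocks through a 3-cycle for order 3, by a finite search for involutions.
*)
theory Submission
  imports Defs
begin

text \<open>Modulo the relation x ~ x + 9 the points 1, ..., 18 form the affine plane over GF(3),
  read row by row as 1 2 3 / 4 5 6 / 7 8 9, and G acts on it as AGL(2,3). In this picture
  \<open>perm_beta\<close> is a reflection, \<open>involution2\<close> the point reflection in 1,
  \<open>translation3\<close> a translation, \<open>transvection3\<close> a transvection with axis 1
  2 3, and \<open>perm_alpha\<close> a transvection followed by a translation, without fixed point.
  These are the five classes of elements of prime order in AGL(2,3). Its element orders 1, 2, 3, 4,
  6, 8 are the reason why exponents up to 4 suffice in the certificates. Conjugating an automorphism
  of E by an element h of G gives an automorphism of h(E), which is another extension of the same D.
  Hence the property to be excluded is to be an automorphism of some extension
  (\<open>occurs\<close>), not of the given one. The obstacle is the amount of finite checking. It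
  is met by tables of witnesses, mostly positions in the list of the 574 blocks, so that each check
  looks at named blocks instead of searching for them.\<close>

text \<open>Otherwise the simplifier rewrites the literal 1 in the tables below to a successor term.\<close>

declare One_nat_def [simp del]

section \<open>The generators and the block list\<close>

lemma perm_alpha_simps [simp]:
    "perm_alpha 1 = 2" "perm_alpha 2 = 4" "perm_alpha 3 = 9" "perm_alpha 4 = 1"
    "perm_alpha 5 = 6" "perm_alpha 6 = 8" "perm_alpha 7 = 3" "perm_alpha 8 = 5"
    "perm_alpha 9 = 7" "perm_alpha 10 = 11" "perm_alpha 11 = 13" "perm_alpha 12 = 18"
    "perm_alpha 13 = 10" "perm_alpha 14 = 15" "perm_alpha 15 = 17" "perm_alpha 16 = 12"
    "perm_alpha 17 = 14" "perm_alpha 18 = 16" "perm_alpha 19 = 38" "perm_alpha 20 = 39"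
    "perm_alpha 21 = 37" "perm_alpha 22 = 42" "perm_alpha 23 = 40" "perm_alpha 24 = 41"
    "perm_alpha 25 = 25" "perm_alpha 26 = 26" "perm_alpha 27 = 27" "perm_alpha 28 = 30"
    "perm_alpha 29 = 28" "perm_alpha 30 = 29" "perm_alpha 31 = 23" "perm_alpha 32 = 22"
    "perm_alpha 33 = 24" "perm_alpha 34 = 19" "perm_alpha 35 = 21" "perm_alpha 36 = 20"
    "perm_alpha 37 = 35" "perm_alpha 38 = 34" "perm_alpha 39 = 36" "perm_alpha 40 = 31"
    "perm_alpha 41 = 33" "perm_alpha 42 = 32"
  by (simp_all add: perm_alpha_def perm_of_cycles_def transpose_def)

lemma perm_beta_simps [simp]:
    "perm_beta 1 = 10" "perm_beta 2 = 11" "perm_beta 3 = 12" "perm_beta 4 = 16"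
    "perm_beta 5 = 17" "perm_beta 6 = 18" "perm_beta 7 = 13" "perm_beta 8 = 14"
    "perm_beta 9 = 15" "perm_beta 10 = 1" "perm_beta 11 = 2" "perm_beta 12 = 3"
    "perm_beta 13 = 7" "perm_beta 14 = 8" "perm_beta 15 = 9" "perm_beta 16 = 4"
    "perm_beta 17 = 5" "perm_beta 18 = 6" "perm_beta 19 = 23" "perm_beta 20 = 24"
    "perm_beta 21 = 22" "perm_beta 22 = 21" "perm_beta 23 = 19" "perm_beta 24 = 20"
    "perm_beta 25 = 35" "perm_beta 26 = 36" "perm_beta 27 = 34" "perm_beta 28 = 33"
    "perm_beta 29 = 31" "perm_beta 30 = 32" "perm_beta 31 = 29" "perm_beta 32 = 30"
    "perm_beta 33 = 28" "perm_beta 34 = 27" "perm_beta 35 = 25" "perm_beta 36 = 26"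
    "perm_beta 37 = 37" "perm_beta 38 = 39" "perm_beta 39 = 38" "perm_beta 40 = 40"
    "perm_beta 41 = 42" "perm_beta 42 = 41"
  by (simp_all add: perm_beta_def perm_of_cycles_def transpose_def)

lemma permutes_alpha: "perm_alpha permutes {1..42}"
  using perm_alpha_in_sym_group by (simp add: sym_group_carrier)

lemma permutes_beta: "perm_beta permutes {1..42}"
  using perm_beta_in_sym_group by (simp add: sym_group_carrier)

text \<open>There are 574 = C(42,3) / C(6,3) blocks. Each is written as an increasing list, so that
  equality of blocks becomes equality of lists.\<close>

definition block_list :: "nat list list"
  where "block_list =
  [[1,2,3,10,11,12], [1,2,4,20,36,39], [1,2,13,17,31,34], [1,10,19,22,25,30],
   [1,11,20,21,29,34], [19,20,21,22,23,24], [19,22,31,36,38,42], [2,4,9,11,13,18],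
   [10,11,16,24,26,38], [5,7,10,11,27,29], [2,4,10,14,19,23], [1,10,21,23,32,35],
   [2,11,25,29,38,42], [2,10,22,24,27,31], [2,13,19,28,37,39], [37,38,39,40,41,42],
   [21,23,26,29,39,41], [20,23,32,34,38,42], [2,6,7,11,15,16], [1,4,7,10,13,16],
   [11,12,13,26,34,41], [3,6,11,13,27,28], [1,8,11,16,19,23], [1,4,11,15,38,40],
   [2,11,21,22,37,40], [2,11,31,35,39,41], [4,13,25,28,32,34], [4,11,23,27,41,42],
   [7,11,23,33,37,38], [4,10,30,35,36,38], [31,32,33,34,35,36], [26,28,33,36,37,40],
   [19,24,27,30,39,41], [19,22,32,34,39,40], [3,4,8,12,13,17], [2,3,7,27,36,42],
   [10,13,18,19,26,33], [2,7,12,18,33,34], [8,9,10,13,27,30], [2,5,12,13,38,40],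
   [2,9,10,16,39,40], [4,13,31,35,37,42], [4,13,21,23,33,36], [7,16,27,30,33,35],
   [2,16,19,34,41,42], [1,13,27,32,33,40], [3,13,24,34,35,40], [1,16,25,26,32,39],
   [25,26,27,28,29,30], [20,24,26,30,31,35], [27,29,33,36,38,41], [21,23,27,30,38,40],
   [3,5,7,12,14,16], [1,5,9,10,14,18], [3,4,9,20,27,32], [1,6,7,23,28,36],
   [3,4,16,18,19,24], [1,7,14,15,32,34], [3,7,11,17,39,40], [4,6,10,18,31,34],
   [4,7,11,12,31,36], [7,16,25,29,37,41], [7,16,19,22,26,28], [1,10,20,24,37,40],
   [3,12,21,24,27,29], [4,12,19,32,33,38], [7,10,28,30,34,40], [7,12,20,25,27,40],
   [9,10,19,21,31,41], [2,12,22,25,26,36], [20,24,25,29,32,36], [26,28,31,34,39,42],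
   [20,24,27,28,33,34], [27,29,31,34,37,40], [3,6,9,12,15,18], [1,6,8,10,15,17],
   [12,15,16,24,30,34], [1,7,9,22,27,39], [2,3,8,20,30,40], [4,6,12,16,20,23],
   [1,9,12,16,38,41], [2,3,15,17,19,22], [3,9,13,14,31,36], [1,6,16,18,27,29],
   [2,3,13,16,26,29], [1,3,13,18,20,23], [3,12,25,28,33,35], [3,12,26,30,38,42],
   [3,12,20,22,31,34], [9,18,27,28,37,41], [3,16,23,28,30,39], [1,18,22,24,34,38],
   [3,11,19,29,30,31], [3,18,25,27,31,39], [1,15,22,23,29,42], [3,11,21,26,35,36],
   [4,18,20,25,26,42], [20,22,25,28,39,41], [19,23,26,30,32,36], [19,23,27,28,31,35],
   [7,8,9,16,17,18], [2,5,8,11,14,17], [12,17,18,19,29,41], [10,13,15,21,34,38],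
   [11,12,14,24,32,40], [4,5,9,29,31,39], [1,8,12,18,39,40], [3,4,10,15,39,42],
   [5,9,11,12,21,23], [4,9,14,17,38,42], [7,8,12,15,26,29], [7,9,10,15,20,23],
   [2,8,12,16,27,28], [4,9,10,12,26,28], [6,7,10,12,19,24], [9,18,21,24,25,30],
   [3,12,32,36,39,41], [9,18,26,29,32,34], [9,18,19,23,39,42], [6,15,33,34,37,42],
   [9,12,29,30,36,40], [6,10,20,21,27,39], [2,12,23,29,31,32], [9,13,23,28,29,38],
   [6,12,29,34,35,38], [9,16,23,25,27,36], [2,17,28,32,40,42], [9,13,20,21,26,37],
   [6,16,24,35,36,41], [21,24,33,35,38,42], [25,30,33,36,39,42], [20,22,26,29,38,40],
   [19,23,25,29,33,34], [4,5,6,13,14,15], [3,5,6,23,31,42], [14,16,18,28,33,38],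
   [10,11,17,19,34,37], [13,15,18,22,31,41], [15,16,17,29,31,38], [3,6,10,14,38,40],
   [2,5,16,18,31,36], [1,9,11,17,32,36], [6,7,13,18,37,40], [5,8,15,16,39,41],
   [3,5,17,18,26,28], [1,9,13,15,19,24], [3,4,11,14,33,34], [4,5,12,18,27,30],
   [1,3,15,16,33,36], [1,7,11,18,26,30], [3,8,11,18,38,41], [6,15,20,22,32,35],
   [9,18,20,22,33,36], [6,15,27,30,31,36], [6,15,19,23,38,41], [7,16,32,36,38,40],
   [8,17,19,24,32,35], [3,15,26,31,32,40], [7,18,20,28,29,31], [8,11,27,36,37,39],
   [4,18,22,23,28,40], [7,15,19,31,33,39], [8,18,19,21,28,34], [4,15,19,26,34,35],
   [5,11,30,33,40,41], [4,14,22,30,31,32], [7,15,22,24,36,37], [7,10,26,35,37,39],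
   [8,12,20,21,33,41], [21,24,32,34,37,41], [26,28,32,35,38,41], [21,24,31,36,39,40],
   [19,24,25,28,38,40], [6,8,9,23,32,40], [4,6,8,28,33,39], [1,2,5,23,27,37],
   [11,13,14,19,35,38], [6,7,9,21,29,42], [10,16,17,23,33,42], [12,14,17,23,28,34],
   [8,9,11,15,31,34], [4,6,11,17,26,29], [2,5,10,15,26,30], [2,7,13,14,20,22],
   [3,8,10,16,31,35], [5,6,12,17,33,36], [6,9,14,16,26,30], [2,7,10,17,38,41],
   [3,6,16,17,32,34], [2,9,12,17,20,24], [2,6,10,13,32,36], [2,6,12,14,39,42],
   [5,9,13,16,33,34], [8,17,21,22,39,42], [6,15,21,24,26,28], [7,16,20,24,39,42],
   [8,17,20,23,27,29], [8,17,33,34,38,40], [4,13,26,30,39,40], [5,14,20,23,25,30],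
   [5,14,21,22,38,41], [9,17,22,23,26,31], [6,13,24,29,31,33], [2,14,26,34,37,38],
   [5,13,20,27,35,36], [6,16,19,21,33,40], [1,16,30,31,40,42], [3,17,23,24,36,38],
   [6,14,22,23,27,33], [5,16,19,30,37,38], [1,17,19,21,26,38], [8,16,21,29,30,32],
   [3,17,20,35,41,42], [1,13,25,36,37,38], [3,14,22,24,28,42], [5,18,24,33,37,39],
   [20,22,27,30,37,42], [19,22,33,35,37,41], [21,22,26,30,33,34], [20,23,31,36,37,41],
   [20,23,33,35,39,40], [25,30,31,34,38,41], [14,15,18,19,30,40], [5,7,8,22,31,40],
   [1,5,8,24,30,36], [2,4,6,27,35,40], [2,7,8,23,25,39], [3,7,8,28,32,37],
   [1,4,5,19,28,41], [3,5,8,19,27,33], [2,9,14,15,27,29], [5,7,13,17,19,23],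
   [1,8,13,14,26,28], [7,8,11,13,21,24], [1,4,12,14,25,29], [6,8,14,18,20,24],
   [4,8,15,18,32,36], [1,5,11,13,39,42], [8,9,12,14,19,22], [3,5,11,15,20,24],
   [4,7,14,18,39,41], [4,8,10,11,20,22], [4,7,15,17,27,28], [5,14,32,36,37,42],
   [8,17,26,30,37,41], [4,13,20,24,38,41], [5,14,19,24,31,34], [5,14,27,28,39,40],
   [1,10,26,29,31,36], [6,15,25,29,39,40], [5,15,19,21,29,36], [7,14,23,26,40,42],
   [8,10,23,24,28,41], [7,17,24,25,26,34], [8,12,24,31,37,38], [4,10,29,32,40,41],
   [5,12,19,20,26,39], [9,14,20,34,40,41], [8,15,24,27,40,42], [4,17,23,32,37,39],
   [5,10,22,23,36,39], [5,12,22,28,29,37], [5,12,24,25,41,42], [9,14,21,32,33,39],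
   [2,10,20,25,34,35], [9,15,30,32,41,42], [6,17,20,28,37,38], [27,29,32,35,39,42],
   [21,23,25,28,37,42], [21,22,27,28,32,36], [19,24,26,29,37,42], [13,14,17,21,29,40],
   [10,14,17,20,26,32], [2,5,6,20,29,41], [11,16,18,25,34,40], [1,4,8,21,27,31],
   [3,4,5,25,36,40], [12,13,14,30,33,37], [3,5,9,22,30,35], [1,2,6,30,33,38],
   [5,6,9,24,27,38], [7,8,10,14,33,36], [3,5,10,13,37,41], [1,2,15,18,25,28],
   [1,5,16,17,20,22], [3,8,14,15,21,23], [5,7,15,18,38,42], [6,9,13,17,39,41],
   [6,8,13,16,38,42], [1,2,14,16,21,24], [1,3,14,17,27,30], [5,14,26,29,33,35],
   [1,10,33,34,39,41], [2,11,20,23,26,28], [9,18,31,35,38,40], [8,17,25,28,31,36],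
   [8,13,19,36,40,41], [1,14,19,20,33,42], [3,14,19,25,26,41], [3,14,20,29,37,39],
   [5,18,23,34,35,41], [1,11,22,28,31,33], [6,18,26,36,38,39], [5,17,27,31,32,41],
   [1,14,22,35,36,40], [6,11,20,36,40,42], [3,17,21,31,33,37], [6,18,28,30,35,42],
   [6,18,25,32,33,41], [8,15,22,28,30,38], [1,11,24,25,27,35], [4,11,19,21,25,39],
   [7,17,22,29,32,33], [8,14,30,34,35,39], [25,30,32,35,37,40], [10,14,15,28,31,37],
   [11,14,15,22,26,39], [11,17,18,24,31,42], [12,13,16,19,25,31], [10,14,16,22,29,34],
   [12,16,17,26,35,40], [1,6,9,20,25,31], [10,15,18,24,29,35], [12,15,17,21,25,32],
   [10,11,18,28,32,39], [2,4,8,24,29,34], [15,17,18,20,34,39], [6,7,8,27,34,41],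
   [1,7,12,17,37,42], [6,9,10,11,33,35], [2,4,16,17,25,30], [4,5,10,17,21,24],
   [5,9,15,17,37,40], [5,8,10,12,32,34], [2,4,12,15,37,41], [1,10,27,28,38,42],
   [2,11,19,24,33,36], [7,16,21,23,31,34], [5,10,20,31,33,38], [2,15,24,32,38,39],
   [8,12,23,35,36,42], [9,15,25,26,33,38], [9,15,28,35,36,39], [6,17,19,25,27,42],
   [2,10,21,28,29,33], [2,13,23,24,30,42], [8,16,20,26,34,36], [5,17,29,30,34,42],
   [8,10,21,25,26,40], [2,15,20,21,31,42], [2,18,24,26,40,41], [8,13,20,31,32,39],
   [9,14,23,24,35,37], [8,16,22,24,25,33], [2,13,21,25,27,41], [2,16,22,23,35,38],
   [5,13,21,28,30,31], [8,14,25,27,32,38], [21,22,25,29,31,35], [1,8,9,29,33,37],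
   [11,15,17,23,30,35], [2,8,9,21,36,38], [13,15,17,26,36,42], [13,14,16,23,32,41],
   [3,4,7,23,29,35], [10,12,18,23,25,38], [11,12,15,19,28,42], [12,14,18,21,26,31],
   [11,16,17,21,28,41], [14,17,18,22,25,37], [11,13,16,22,30,36], [11,14,16,20,27,31],
   [14,16,17,19,36,39], [13,14,18,27,34,42], [2,3,14,18,32,35], [4,5,11,16,32,35],
   [1,6,11,14,37,41], [6,7,14,17,31,35], [5,6,11,18,19,22], [3,9,11,16,37,42],
   [1,4,17,18,33,35], [2,11,27,30,32,34], [4,13,19,22,27,29], [3,12,19,23,37,40],
   [1,17,24,28,29,39], [6,11,23,24,34,39], [9,11,20,30,38,39], [4,17,22,34,36,41],
   [5,18,20,21,32,40], [7,17,20,21,30,36], [4,11,24,28,30,37], [7,11,19,20,32,41],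
   [4,14,24,26,27,36], [6,14,19,28,29,32], [5,11,25,26,31,37], [9,11,22,24,29,41],
   [4,16,26,31,33,41], [7,14,24,29,30,38], [8,15,19,20,25,37], [7,15,21,35,40,41],
   [4,14,20,21,28,35], [7,11,22,34,35,42], [4,10,25,27,33,37], [4,12,21,34,40,42],
   [6,10,23,29,30,37], [5,15,22,25,27,34], [2,5,7,24,28,35], [2,5,9,19,25,32],
   [4,5,7,20,34,37], [5,7,9,26,36,41], [4,7,8,19,30,42], [10,12,15,22,33,40],
   [1,3,9,21,28,40], [1,3,6,19,35,39], [2,3,9,23,33,41], [13,17,18,30,32,38],
   [3,6,8,22,29,36], [15,16,18,23,26,37], [2,4,5,22,33,42], [5,6,8,21,35,37],
   [14,15,16,25,35,42], [2,4,7,21,26,32], [10,12,13,20,29,42], [12,13,15,23,27,39],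
   [4,5,8,23,26,38], [12,14,15,20,36,38], [10,15,16,19,27,32], [6,8,11,12,25,30],
   [4,9,15,16,21,22], [1,6,12,13,21,22], [2,8,10,18,37,42], [2,8,13,15,33,35],
   [5,8,13,18,25,29], [2,6,17,18,21,23], [7,9,12,13,32,35], [5,6,10,16,25,28],
   [2,14,28,30,36,41], [2,18,19,20,27,38], [7,13,29,34,36,39], [5,16,21,26,27,42],
   [6,17,22,24,30,40], [6,16,22,31,37,39], [5,13,22,24,26,32], [2,16,20,32,33,37],
   [1,13,29,30,35,41], [3,13,22,33,38,39], [1,15,20,26,27,41], [8,18,23,30,31,33],
   [2,17,29,35,36,37], [6,13,23,25,26,35], [7,13,28,33,41,42], [4,16,28,29,36,42],
   [1,12,23,24,26,33], [3,15,28,29,34,41], [5,17,25,35,38,39], [9,13,22,25,40,42],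
   [1,15,21,30,37,39], [3,13,19,21,32,42], [1,16,28,34,35,37], [3,16,22,27,40,41],
   [1,18,19,31,32,37], [8,11,28,29,35,40], [9,17,21,27,34,35], [11,13,17,20,25,33],
   [3,4,6,21,30,41], [4,6,7,22,25,38], [13,16,17,24,27,37], [3,6,7,20,26,33],
   [1,3,5,29,32,38], [2,7,9,30,31,37], [4,7,9,24,33,40], [5,6,7,30,32,39],
   [5,8,9,20,28,42], [4,6,9,19,36,37], [1,4,6,24,32,42], [4,8,9,25,35,41],
   [1,3,4,22,26,37], [1,3,7,24,31,41], [3,7,9,19,34,38], [10,17,18,27,36,40],
   [1,5,6,26,34,40], [3,8,9,24,26,39], [1,4,9,23,30,34], [11,12,17,22,27,38],
   [3,7,10,18,21,22], [7,9,11,14,25,28], [4,8,14,16,37,40], [3,7,13,15,25,30],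
   [8,11,26,32,33,42], [4,15,20,29,30,33], [4,16,27,34,38,39], [7,13,26,27,31,38],
   [3,10,19,20,28,36], [6,12,26,27,32,37], [8,14,29,31,41,42], [4,18,21,29,37,38],
   [6,10,22,26,41,42], [4,12,22,24,35,39], [7,10,25,31,32,42], [7,12,21,28,38,39],
   [9,10,24,34,36,42], [2,17,26,27,33,39], [5,16,23,24,29,40], [7,18,19,25,35,36],
   [3,10,24,30,32,33], [1,12,20,28,30,32], [9,12,27,31,33,42], [9,17,19,28,30,33],
   [6,14,21,25,34,36], [9,10,22,32,37,38], [7,12,22,23,30,41], [2,12,19,21,30,35],
   [2,14,25,31,33,40], [7,14,19,21,27,37], [10,13,14,24,25,39], [12,16,18,22,32,42],
   [13,16,18,21,35,39], [1,3,8,25,34,42], [10,12,14,27,35,41], [12,13,18,24,28,36],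
   [10,12,17,30,31,39], [2,6,9,22,28,34], [11,13,15,29,32,37], [13,15,16,20,28,40],
   [14,15,17,24,33,41], [1,7,8,20,35,38], [10,16,18,20,30,41], [1,2,8,22,32,41],
   [1,5,7,21,25,33], [10,12,16,21,36,37], [1,2,9,26,35,42], [2,6,8,19,26,31],
   [1,2,7,19,29,40], [2,3,5,21,34,39], [1,5,12,15,31,35], [3,9,10,17,25,29],
   [9,16,24,28,31,32], [1,12,19,27,34,36], [3,10,23,26,27,34], [3,18,30,34,36,37],
   [8,18,22,26,27,35], [5,15,23,28,32,33], [1,18,21,36,41,42], [3,16,20,21,25,38],
   [3,11,22,23,25,32], [5,11,28,34,36,38], [4,17,19,20,31,40], [6,12,28,31,40,41],
   [2,18,22,29,30,39], [7,18,23,24,27,32], [3,18,29,33,40,42], [4,15,23,24,25,31],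
   [8,13,22,23,34,37], [3,15,27,35,37,38], [10,11,15,25,36,41], [11,15,18,21,27,33],
   [11,14,18,23,29,36], [10,13,17,22,28,35], [11,12,16,29,33,39], [10,11,14,21,30,42],
   [2,3,6,24,25,37], [11,12,18,20,35,37], [10,11,13,23,31,40], [2,3,4,28,31,38],
   [9,11,19,26,27,40], [9,16,19,20,29,35], [9,12,25,34,37,39], [6,13,19,20,30,34],
   [1,14,23,31,38,39], [6,11,21,31,32,38], [1,17,23,25,40,41], [5,10,19,35,40,42],
   [2,15,23,34,36,40], [8,10,19,29,38,39]]"

lemma length_block_list: "length block_list = 574"
  by (simp add: block_list_def)

lemma upt_Cons_num: "m < n \<Longrightarrow> [m..<n] = m # [m + 1..<n]" for m n :: nat
  by (metis Suc_eq_plus1 upt_conv_Cons)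

lemma upt_574: "[0..<574] =
  [0, 1, 2, 3, 4, 5, 6, 7, 8, 9, 10, 11, 12, 13, 14, 15, 16, 17, 18, 19, 20, 21, 22, 23, 24,
   25, 26, 27, 28, 29, 30, 31, 32, 33, 34, 35, 36, 37, 38, 39, 40, 41, 42, 43, 44, 45, 46, 47, 48,
   49, 50, 51, 52, 53, 54, 55, 56, 57, 58, 59, 60, 61, 62, 63, 64, 65, 66, 67, 68, 69, 70, 71, 72,
   73, 74, 75, 76, 77, 78, 79, 80, 81, 82, 83, 84, 85, 86, 87, 88, 89, 90, 91, 92, 93, 94, 95, 96,
   97, 98, 99, 100, 101, 102, 103, 104, 105, 106, 107, 108, 109, 110, 111, 112, 113, 114, 115, 116,
   117, 118, 119, 120, 121, 122, 123, 124, 125, 126, 127, 128, 129, 130, 131, 132, 133, 134, 135,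
   136, 137, 138, 139, 140, 141, 142, 143, 144, 145, 146, 147, 148, 149, 150, 151, 152, 153, 154,
   155, 156, 157, 158, 159, 160, 161, 162, 163, 164, 165, 166, 167, 168, 169, 170, 171, 172, 173,
   174, 175, 176, 177, 178, 179, 180, 181, 182, 183, 184, 185, 186, 187, 188, 189, 190, 191, 192,
   193, 194, 195, 196, 197, 198, 199, 200, 201, 202, 203, 204, 205, 206, 207, 208, 209, 210, 211,
   212, 213, 214, 215, 216, 217, 218, 219, 220, 221, 222, 223, 224, 225, 226, 227, 228, 229, 230,
   231, 232, 233, 234, 235, 236, 237, 238, 239, 240, 241, 242, 243, 244, 245, 246, 247, 248, 249,
   250, 251, 252, 253, 254, 255, 256, 257, 258, 259, 260, 261, 262, 263, 264, 265, 266, 267, 268,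
   269, 270, 271, 272, 273, 274, 275, 276, 277, 278, 279, 280, 281, 282, 283, 284, 285, 286, 287,
   288, 289, 290, 291, 292, 293, 294, 295, 296, 297, 298, 299, 300, 301, 302, 303, 304, 305, 306,
   307, 308, 309, 310, 311, 312, 313, 314, 315, 316, 317, 318, 319, 320, 321, 322, 323, 324, 325,
   326, 327, 328, 329, 330, 331, 332, 333, 334, 335, 336, 337, 338, 339, 340, 341, 342, 343, 344,
   345, 346, 347, 348, 349, 350, 351, 352, 353, 354, 355, 356, 357, 358, 359, 360, 361, 362, 363,
   364, 365, 366, 367, 368, 369, 370, 371, 372, 373, 374, 375, 376, 377, 378, 379, 380, 381, 382,
   383, 384, 385, 386, 387, 388, 389, 390, 391, 392, 393, 394, 395, 396, 397, 398, 399, 400, 401,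
   402, 403, 404, 405, 406, 407, 408, 409, 410, 411, 412, 413, 414, 415, 416, 417, 418, 419, 420,
   421, 422, 423, 424, 425, 426, 427, 428, 429, 430, 431, 432, 433, 434, 435, 436, 437, 438, 439,
   440, 441, 442, 443, 444, 445, 446, 447, 448, 449, 450, 451, 452, 453, 454, 455, 456, 457, 458,
   459, 460, 461, 462, 463, 464, 465, 466, 467, 468, 469, 470, 471, 472, 473, 474, 475, 476, 477,
   478, 479, 480, 481, 482, 483, 484, 485, 486, 487, 488, 489, 490, 491, 492, 493, 494, 495, 496,
   497, 498, 499, 500, 501, 502, 503, 504, 505, 506, 507, 508, 509, 510, 511, 512, 513, 514, 515,
   516, 517, 518, 519, 520, 521, 522, 523, 524, 525, 526, 527, 528, 529, 530, 531, 532, 533, 534,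
   535, 536, 537, 538, 539, 540, 541, 542, 543, 544, 545, 546, 547, 548, 549, 550, 551, 552, 553,
   554, 555, 556, 557, 558, 559, 560, 561, 562, 563, 564, 565, 566, 567, 568, 569, 570, 571, 572,
   573]"
  by (simp add: upt_Cons_num)

text \<open>Reading the identity \<open>map ((!) block_list) [0..<574] = block_list\<close> entry by
  entry gives 574 rewrite rules, which make the access to a block one step instead of a walk along
  the list.\<close>

lemmas block_list_nth [simp] =
  trans[OF map_nth[of block_list, unfolded length_block_list upt_574] block_list_def,
    simplified list.map list.inject simp_thms]

text \<open>Sorting brings the image into the normal form of \<open>block_list\<close>, so it is
  compared with a single named entry. The bound on n guarantees that this entry exists.\<close>

definition maps_to_index :: "(nat \<Rightarrow> nat) \<Rightarrow> nat list \<Rightarrow> nat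
  \<Rightarrow> bool"
  where "maps_to_index p B n \<longleftrightarrow> n < 574 \<and> sort (map p B) = block_list ! n"

text \<open>Closure of the list under a generator is witnessed pointwise: the table gives for every
  block the position of its image.\<close>

lemma alpha_index: "list_all2 (maps_to_index perm_alpha) block_list
  [7, 1, 10, 12, 14, 15, 17, 19, 20, 21, 23, 24, 26, 27, 29, 30, 31, 33, 34, 0, 36, 38, 39,
   2, 41, 42, 3, 45, 46, 4, 5, 49, 50, 6, 53, 54, 8, 56, 9, 59, 60, 11, 63, 64, 65, 13, 68, 69, 48,
   16, 72, 73, 74, 18, 77, 78, 80, 81, 82, 22, 85, 86, 87, 25, 89, 91, 92, 93, 28, 96, 97, 98, 32,
   99, 100, 101, 102, 35, 105, 106, 37, 109, 111, 112, 113, 40, 115, 117, 118, 43, 120, 44, 123,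
   125, 126, 127, 47, 130, 131, 51, 52, 133, 135, 136, 137, 55, 140, 141, 142, 57, 144, 58, 147,
   149, 150, 61, 152, 62, 155, 156, 158, 159, 160, 66, 162, 67, 165, 167, 168, 169, 70, 71, 172,
   75, 173, 76, 176, 178, 179, 180, 79, 183, 184, 185, 186, 187, 145, 83, 189, 84, 192, 193, 195,
   196, 197, 88, 200, 201, 90, 204, 206, 207, 209, 210, 202, 94, 212, 95, 215, 217, 218, 219, 221,
   223, 224, 225, 103, 227, 104, 222, 231, 232, 181, 107, 108, 235, 110, 146, 238, 240, 241, 236,
   114, 243, 244, 116, 247, 246, 248, 249, 119, 251, 252, 163, 121, 254, 122, 257, 258, 124, 203,
   261, 263, 264, 265, 128, 267, 129, 270, 220, 171, 132, 138, 134, 273, 275, 276, 278, 279, 280,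
   242, 139, 182, 282, 283, 143, 284, 190, 286, 287, 148, 237, 290, 151, 291, 292, 154, 153, 293,
   295, 266, 157, 164, 298, 300, 301, 302, 161, 303, 304, 305, 307, 308, 166, 311, 312, 313, 269,
   314, 216, 170, 315, 316, 174, 318, 175, 321, 322, 177, 325, 327, 239, 329, 330, 191, 332, 188,
   281, 333, 334, 230, 194, 336, 198, 337, 199, 338, 339, 341, 342, 205, 345, 346, 208, 349, 351,
   352, 211, 353, 347, 354, 213, 214, 250, 358, 360, 362, 363, 365, 366, 367, 226, 368, 369, 370,
   228, 372, 229, 374, 233, 234, 376, 377, 378, 380, 381, 245, 383, 385, 387, 388, 253, 389, 357,
   390, 255, 256, 393, 394, 259, 396, 260, 399, 262, 402, 403, 404, 405, 268, 406, 271, 408, 272,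
   411, 412, 274, 415, 417, 277, 420, 422, 423, 425, 426, 428, 429, 431, 285, 288, 434, 289, 382,
   335, 294, 436, 296, 438, 297, 441, 299, 444, 445, 446, 309, 449, 450, 452, 453, 454, 306, 456,
   457, 310, 460, 461, 343, 464, 465, 413, 467, 468, 317, 469, 361, 470, 319, 472, 320, 474, 419,
   323, 476, 324, 479, 480, 326, 483, 432, 328, 430, 375, 331, 435, 486, 484, 427, 489, 490, 492,
   493, 494, 340, 496, 497, 344, 500, 501, 502, 400, 348, 504, 505, 350, 507, 508, 498, 448, 509,
   511, 506, 355, 356, 513, 514, 359, 517, 518, 481, 521, 364, 477, 416, 471, 525, 527, 528, 530,
   414, 478, 371, 531, 409, 532, 373, 379, 487, 534, 535, 442, 384, 537, 538, 386, 540, 541, 458,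
   488, 542, 544, 539, 391, 392, 547, 543, 395, 548, 549, 397, 398, 401, 550, 495, 551, 553, 554,
   515, 529, 407, 555, 526, 556, 410, 557, 520, 524, 533, 558, 418, 560, 561, 421, 424, 563, 473,
   433, 485, 510, 437, 564, 565, 439, 440, 443, 566, 455, 567, 568, 447, 451, 459, 536, 570, 571,
   462, 463, 466, 523, 559, 519, 522, 475, 516, 562, 482, 491, 499, 503, 573, 572, 552, 512, 569,
   546, 545]"
  by (simp only: block_list_def list_all2_Cons list_all2_Nil) (simp add: maps_to_index_def)

lemma beta_index: "list_all2 (maps_to_index perm_beta) block_list
  [0, 8, 9, 11, 13, 5, 16, 18, 1, 2, 22, 3, 25, 4, 28, 15, 6, 32, 7, 19, 35, 37, 10, 40, 24,
   12, 43, 44, 14, 47, 48, 31, 17, 51, 52, 20, 55, 21, 57, 58, 23, 61, 62, 26, 27, 66, 67, 29, 30,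
   70, 71, 33, 34, 75, 76, 36, 79, 38, 39, 83, 84, 41, 42, 63, 88, 90, 45, 46, 94, 95, 49, 50, 72,
   73, 74, 53, 54, 103, 104, 56, 107, 108, 110, 59, 60, 114, 86, 116, 64, 119, 65, 121, 122, 124,
   68, 69, 128, 129, 98, 132, 133, 101, 134, 77, 78, 138, 139, 80, 81, 143, 82, 145, 146, 148, 85,
   151, 87, 153, 154, 89, 157, 91, 92, 161, 93, 163, 164, 166, 96, 97, 170, 171, 99, 100, 102, 174,
   175, 177, 105, 106, 181, 182, 142, 109, 185, 111, 112, 188, 113, 190, 191, 115, 194, 117, 118,
   198, 199, 120, 202, 203, 205, 123, 208, 125, 126, 211, 127, 213, 214, 216, 130, 131, 220, 222,
   135, 136, 226, 137, 228, 229, 230, 140, 141, 233, 234, 144, 236, 237, 147, 239, 149, 150, 242,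
   200, 152, 245, 246, 247, 155, 156, 193, 250, 158, 159, 253, 160, 255, 256, 162, 259, 260, 165,
   262, 167, 168, 266, 169, 268, 269, 270, 172, 267, 173, 271, 272, 274, 176, 277, 178, 179, 180,
   231, 281, 183, 184, 235, 186, 187, 285, 189, 288, 289, 192, 244, 243, 195, 196, 197, 248, 294,
   201, 296, 297, 204, 299, 206, 207, 258, 257, 209, 210, 306, 212, 309, 310, 265, 215, 221, 217,
   218, 219, 223, 224, 317, 225, 319, 320, 227, 323, 324, 326, 232, 328, 329, 331, 238, 287, 286,
   240, 241, 333, 295, 335, 336, 249, 291, 251, 252, 340, 254, 343, 344, 302, 347, 348, 350, 261,
   308, 307, 263, 264, 355, 356, 357, 314, 359, 361, 273, 364, 275, 276, 322, 321, 278, 279, 371,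
   280, 373, 282, 283, 375, 284, 332, 290, 379, 292, 293, 382, 384, 386, 298, 342, 341, 300, 301,
   391, 392, 303, 304, 395, 305, 397, 398, 400, 401, 311, 312, 313, 358, 315, 407, 316, 409, 410,
   318, 413, 414, 416, 418, 419, 421, 325, 424, 327, 427, 330, 430, 432, 433, 334, 435, 381, 337,
   383, 338, 437, 339, 439, 440, 442, 443, 345, 346, 447, 448, 349, 451, 351, 352, 455, 353, 354,
   458, 459, 460, 462, 463, 360, 466, 362, 363, 412, 411, 365, 366, 471, 367, 473, 368, 369, 475,
   370, 477, 478, 372, 481, 482, 374, 428, 484, 376, 485, 377, 378, 487, 380, 488, 385, 491, 387,
   388, 495, 389, 390, 498, 499, 500, 393, 394, 503, 450, 396, 492, 506, 454, 399, 509, 510, 402,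
   403, 404, 512, 405, 406, 515, 516, 408, 519, 520, 522, 523, 415, 524, 417, 526, 420, 529, 422,
   423, 480, 479, 425, 426, 533, 429, 431, 486, 434, 436, 536, 490, 438, 452, 539, 494, 441, 542,
   543, 444, 445, 446, 545, 546, 449, 505, 504, 453, 541, 540, 456, 457, 544, 461, 552, 525, 464,
   465, 518, 517, 467, 468, 555, 469, 470, 472, 514, 474, 559, 557, 476, 554, 556, 562, 483, 535,
   534, 489, 538, 537, 493, 508, 507, 496, 497, 511, 501, 502, 550, 569, 567, 547, 565, 513, 566,
   530, 521, 531, 528, 563, 527, 561, 560, 532, 558, 572, 551, 553, 549, 573, 548, 571, 570, 564,
   568]"
  by (simp only: block_list_def list_all2_Cons list_all2_Nil) (simp add: maps_to_index_def)

text \<open>The last case is the inverse of \<open>perm_alpha\<close>, an element of order 3, and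
  \<open>perm_beta\<close> is its own inverse. Words over the letters 0, 1, 2 are therefore closed
  under inversion.\<close>

definition generator :: "nat \<Rightarrow> nat \<Rightarrow> nat"
  where "generator k = (if k = 0 then perm_beta else if k = 1 then perm_alpha
    else perm_alpha \<circ> perm_alpha)"

text \<open>After the seven base blocks, the list is ordered so that every block is the image under a
  generator of an earlier one; the two lists below give generator and position.\<close>

fun spanned_from :: "nat \<Rightarrow> nat list \<Rightarrow> nat list \<Rightarrow> bool" where
  "spanned_from n (k # ks) (m # ms) \<longleftrightarrow>
     m < n \<and> maps_to_index (generator k) (block_list ! m) n \<and> spanned_from (n + 1) ks ms"
| "spanned_from n _ _ \<longleftrightarrow> n = 574"

lemma spanned_block_list: "spanned_from 7
  [1, 0, 0, 1, 0, 1, 0, 1, 1, 0, 1, 0, 1, 1, 1, 0, 1, 1, 0, 1, 1, 0, 1, 1, 1, 0, 1, 1, 0, 1,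
   0, 1, 1, 0, 1, 1, 0, 0, 1, 1, 0, 0, 1, 1, 0, 0, 1, 1, 0, 1, 0, 0, 1, 1, 0, 0, 1, 1, 1, 0, 0, 1,
   1, 0, 0, 1, 1, 1, 0, 0, 1, 1, 0, 1, 1, 1, 0, 0, 1, 1, 1, 0, 1, 0, 1, 1, 1, 0, 0, 1, 1, 1, 1, 1,
   1, 1, 0, 0, 1, 1, 0, 0, 1, 0, 1, 1, 1, 0, 1, 0, 1, 1, 0, 1, 0, 0, 1, 0, 1, 1, 1, 0, 0, 1, 1, 0,
   0, 0, 1, 1, 1, 0, 0, 1, 1, 1, 0, 1, 0, 0, 1, 0, 1, 1, 0, 1, 0, 0, 1, 1, 0, 1, 1, 1, 0, 1, 0, 0,
   1, 0, 1, 1, 1, 0, 0, 1, 1, 0, 0, 1, 0, 1, 1, 1, 0, 0, 1, 1, 1, 1, 1, 0, 1, 0, 0, 1, 1, 0, 1, 1,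
   1, 0, 0, 1, 1, 0, 0, 1, 0, 1, 1, 0, 1, 1, 0, 1, 0, 0, 1, 0, 1, 1, 1, 0, 1, 0, 1, 1, 1, 0, 1, 0,
   0, 0, 1, 1, 0, 0, 1, 0, 0, 1, 0, 1, 1, 0, 1, 1, 0, 0, 1, 1, 1, 0, 1, 1, 0, 1, 0, 0, 1, 1, 0, 0,
   1, 0, 1, 1, 1, 0, 1, 0, 0, 1, 0, 0, 1, 0, 1, 1, 0, 1, 1, 1, 0, 1, 1, 1, 0, 1, 1, 0, 0, 1, 1, 1,
   1, 0, 1, 0, 0, 1, 0, 1, 1, 1, 1, 1, 1, 0, 1, 1, 0, 0, 1, 1, 1, 1, 1, 1, 0, 1, 0, 0, 1, 1, 0, 0,
   1, 0, 1, 0, 1, 1, 0, 1, 1, 1, 0, 1, 1, 1, 1, 0, 1, 1, 0, 0, 1, 1, 0, 0, 1, 0, 1, 1, 1, 1, 0, 0,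
   0, 1, 0, 1, 0, 1, 1, 0, 1, 1, 1, 1, 1, 1, 0, 1, 0, 1, 0, 1, 1, 1, 0, 1, 1, 0, 1, 0, 1, 0, 1, 1,
   1, 1, 0, 0, 1, 1, 0, 1, 0, 0, 1, 0, 0, 1, 1, 1, 1, 1, 0, 1, 0, 0, 1, 1, 0, 0, 1, 0, 1, 0, 0, 1,
   0, 1, 1, 0, 1, 1, 0, 1, 1, 0, 1, 0, 0, 1, 0, 1, 0, 1, 0, 0, 1, 0, 0, 1, 1, 1, 0, 0, 1, 1, 0, 1,
   1, 1, 0, 1, 1, 0, 0, 1, 1, 0, 0, 1, 1, 0, 1, 1, 1, 1, 0, 1, 0, 1, 0, 1, 0, 0, 1, 1, 0, 0, 1, 0,
   0, 1, 0, 0, 1, 1, 0, 1, 1, 1, 0, 1, 1, 0, 0, 1, 1, 1, 0, 1, 1, 0, 1, 1, 0, 0, 1, 0, 1, 1, 0, 0,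
   1, 1, 0, 0, 1, 0, 0, 0, 1, 0, 1, 1, 0, 1, 1, 1, 0, 1, 1, 0, 1, 1, 0, 1, 1, 0, 0, 1, 0, 0, 1, 1,
   1, 1, 1, 0, 1, 1, 1, 1, 1, 1, 0, 1, 1, 0, 1, 1, 1, 1, 1, 1, 0, 1, 1, 0, 1]
  [0, 1, 2, 2, 3, 3, 4, 4, 5, 6, 6, 7, 7, 8, 9, 10, 10, 11, 12, 12, 13, 14, 14, 15, 16, 17,
   17, 18, 20, 20, 21, 21, 22, 23, 24, 25, 26, 27, 27, 28, 29, 30, 31, 32, 33, 34, 34, 35, 36, 37,
   38, 39, 39, 40, 41, 42, 42, 43, 44, 45, 46, 46, 47, 49, 50, 50, 51, 52, 53, 54, 54, 55, 56, 56,
   57, 58, 59, 60, 60, 61, 62, 64, 64, 65, 65, 66, 67, 68, 69, 69, 70, 71, 73, 74, 75, 76, 77, 78,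
   78, 79, 80, 81, 81, 82, 82, 83, 84, 85, 86, 87, 87, 88, 89, 90, 91, 92, 92, 93, 93, 94, 95, 96,
   97, 97, 98, 99, 100, 102, 102, 103, 104, 105, 106, 106, 107, 108, 109, 110, 111, 112, 112, 113,
   113, 114, 115, 116, 117, 118, 118, 119, 120, 120, 121, 122, 123, 124, 125, 126, 126, 127, 127,
   128, 129, 130, 131, 132, 134, 135, 136, 136, 137, 137, 138, 139, 140, 141, 141, 142, 143, 144,
   145, 147, 148, 149, 150, 150, 151, 152, 152, 153, 154, 155, 156, 156, 157, 158, 159, 159, 160,
   160, 161, 162, 162, 163, 165, 166, 167, 168, 168, 169, 169, 170, 171, 172, 172, 173, 173, 174,
   175, 176, 177, 178, 179, 180, 180, 181, 183, 184, 185, 186, 187, 188, 189, 189, 190, 192, 193,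
   194, 195, 196, 196, 198, 199, 201, 201, 202, 204, 205, 206, 207, 207, 208, 209, 210, 211, 212,
   212, 213, 214, 215, 216, 217, 218, 218, 223, 224, 224, 225, 225, 226, 227, 227, 228, 229, 232,
   233, 234, 236, 238, 238, 239, 240, 241, 242, 244, 245, 248, 249, 249, 251, 252, 253, 254, 254,
   255, 256, 258, 259, 260, 261, 261, 262, 263, 264, 264, 265, 266, 268, 271, 272, 273, 274, 275,
   276, 276, 277, 278, 279, 279, 280, 280, 282, 282, 283, 284, 285, 288, 289, 292, 292, 294, 296,
   297, 298, 298, 299, 300, 301, 301, 302, 303, 304, 304, 305, 305, 306, 308, 310, 311, 312, 313,
   314, 315, 315, 316, 316, 317, 318, 318, 319, 320, 322, 323, 324, 325, 326, 327, 328, 330, 331,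
   332, 333, 334, 334, 335, 337, 337, 338, 338, 339, 339, 340, 342, 344, 345, 346, 347, 348, 349,
   350, 351, 352, 352, 353, 354, 354, 355, 356, 357, 359, 360, 361, 362, 363, 363, 364, 365, 366,
   366, 367, 367, 368, 369, 369, 370, 370, 371, 372, 372, 373, 374, 374, 375, 376, 376, 377, 378,
   379, 380, 384, 385, 386, 387, 388, 388, 389, 390, 390, 391, 392, 393, 394, 394, 395, 396, 396,
   397, 398, 399, 400, 401, 402, 403, 403, 404, 405, 406, 406, 407, 408, 409, 410, 412, 414, 415,
   416, 417, 418, 420, 421, 422, 423, 423, 424, 425, 426, 426, 429, 431, 433, 434, 436, 436, 437,
   438, 438, 439, 440, 441, 442, 443, 444, 445, 445, 446, 447, 449, 450, 451, 453, 453, 454, 456,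
   457, 458, 461, 462, 463, 464, 465, 465, 466, 467, 468, 468, 469, 470, 472, 473, 474, 474, 475,
   476, 476, 480, 482, 483, 486, 487, 489, 490, 491, 493, 493, 494, 496, 497, 498, 501, 502, 502,
   505, 506, 510, 512, 513, 513, 514, 518, 520, 522, 526, 527, 528, 529, 532, 532, 538, 539, 543,
   545, 546, 548, 551, 552, 564, 567]"
  by (simp add: maps_to_index_def generator_def)

section \<open>Automorphisms of the design\<close>

abbreviation D :: "nat set set"
  where "D \<equiv> blocks design_D"

lemma maps_to_index_image: "maps_to_index p B n \<Longrightarrow> p ` set B = set (block_list ! n)"
  unfolding maps_to_index_def by (metis set_map set_sort)

lemma index_closed:
  assumes "list_all2 (maps_to_index p) block_list ns" and "B \<in> set ` set block_list"
  shows "p ` B \<in> set ` set block_list"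
proof -
  obtain m where m: "m < length block_list" "B = set (block_list ! m)"
    using assms(2) by (auto simp: in_set_conv_nth)
  then have "maps_to_index p (block_list ! m) (ns ! m)"
    using assms(1) list_all2_nthD by blast
  then show ?thesis
    using m maps_to_index_image[of p "block_list ! m" "ns ! m"] length_block_list
    by (simp add: maps_to_index_def)
qed

lemmas alpha_closed = index_closed[OF alpha_index]
lemmas beta_closed = index_closed[OF beta_index]

lemma carrier_group_G: "carrier group_G = generate (sym_group 42) {perm_alpha, perm_beta}"
  using perm_alpha_in_sym_group perm_beta_in_sym_group
  by (simp add: group_G_def carrier_subgroup_generated Int_absorb1)

lemma group_G_closed:
  assumes "g \<in> carrier group_G" and "B \<in> set ` set block_list"
  shows "g ` B \<in> set ` set block_list"
proof -
  define F where "F = set ` set block_list"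
  have ab: "h ` C \<in> F" if "h \<in> {perm_alpha, perm_beta}" "C \<in> F" for h C
    using that alpha_closed beta_closed unfolding F_def by blast
  have "g \<in> generate (sym_group 42) {perm_alpha, perm_beta}"
    using assms(1) by (simp add: carrier_group_G)
  then have "\<forall>C \<in> F. g ` C \<in> F"
  proof (induction rule: generate.induct)
    case one
    then show ?case by (simp add: sym_group_one)
  next
    case (incl h)
    then show ?case using ab by blast
  next
    case (inv h)
    have h: "h \<in> carrier (sym_group 42)" "h permutes {1..42}"
      using inv perm_alpha_in_sym_group perm_beta_in_sym_group permutes_alpha permutes_beta by blast+
    \<comment> \<open>Inverse generators need no table of their own: an injective map of a finite
      family into itself is onto, so its inverse preserves the family too.\<close>
    have "(`) h ` F \<subseteq> F" using ab inv by blast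
    moreover have "inj_on ((`) h) F"
      by (rule inj_onI) (use permutes_inj[OF h(2)] inj_image_eq_iff in blast)
    moreover have "finite F" unfolding F_def by blast
    ultimately have F: "(`) h ` F = F"
      by (rule endo_inj_surj[rotated])
    have "inv' h ` C \<in> F" if C: "C \<in> F" for C
    proof -
      obtain C' where C': "C' \<in> F" "C = h ` C'" using F C by blast
      have "inv' h ` h ` C' = C'"
        by (rule image_inv_f_f[OF permutes_inj[OF h(2)]])
      then show ?thesis using C' by argo
    qed
    then show ?case using sym_group_inv_equality[OF h(1)] by simp
  next
    case (eng g h)
    then show ?case by (simp only: sym_group_mult image_comp[symmetric]) blast
  qed
  then show ?thesis using assms(2) unfolding F_def by blast
qed

lemma D_iff: "B \<in> D \<longleftrightarrow> (\<exists>S \<in> base_blocks. \<exists>g \<in>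
  carrier group_G. B = g ` S)"
  by (auto simp: design_D_def orbit_def)

lemma group_G_mult:
  assumes "g \<in> {perm_alpha, perm_beta}" and "B \<in> D"
  shows "g ` B \<in> D"
proof -
  obtain S h where S: "S \<in> base_blocks" and h: "h \<in> carrier group_G" "B = h ` S"
    using assms(2)[unfolded D_iff] by blast
  have "g \<circ> h \<in> carrier group_G"
    using generate.eng[OF generate.incl[OF assms(1)], of h "sym_group 42"] h(1)
    by (simp add: carrier_group_G sym_group_mult)
  moreover have "g ` B = (g \<circ> h) ` S" using h by (simp only: image_comp)
  ultimately show ?thesis using S unfolding D_iff by blast
qed

lemma generator_in_D:
  assumes "B \<in> D"
  shows "generator k ` B \<in> D"
proof -
  have "perm_alpha ` B \<in> D" "perm_beta ` B \<in> D"
    using group_G_mult assms by blast+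
  moreover have "(perm_alpha \<circ> perm_alpha) ` B \<in> D"
    unfolding image_comp[symmetric] using group_G_mult assms by blast
  ultimately show ?thesis unfolding generator_def by presburger
qed

lemma base_blocks_eq: "base_blocks = (\<lambda>m. set (block_list ! m)) ` {0, 1, 2, 3, 4, 5, 6}"
  by (simp add: base_blocks_def)

lemma base_in_D:
  assumes "S \<in> base_blocks"
  shows "S \<in> D"
proof -
  have "id \<in> carrier group_G"
    using generate.one[of "sym_group 42"] by (simp add: carrier_group_G sym_group_one)
  then show ?thesis using assms unfolding D_iff by (metis image_id id_apply)
qed

text \<open>Induction along the list: the block at position n is a generator image of an earlier
  one, and D is closed under the generators.\<close>

lemma spanned_from_in_D:
  assumes "spanned_from n ks ms" and "\<And>m. m < n \<Longrightarrow> set (block_list ! m) \<in> D"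
    and "m < 574"
  shows "set (block_list ! m) \<in> D"
  using assms
proof (induction n ks ms rule: spanned_from.induct)
  case (1 n k ks l ms)
  have "generator k ` set (block_list ! l) = set (block_list ! n)"
    using 1 maps_to_index_image by simp
  moreover have "generator k ` set (block_list ! l) \<in> D"
    by (rule generator_in_D) (use 1 in auto)
  ultimately have "set (block_list ! n) \<in> D" by argo
  then have step: "set (block_list ! i) \<in> D" if "i < n + 1" for i
    by (metis 1(3) Suc_eq_plus1 less_Suc_eq that)
  have "spanned_from (n + 1) ks ms" using 1(2) unfolding spanned_from.simps by argo
  then show ?case by (rule 1(1)) (use step 1(4) in metis)+
qed auto

lemma base_in_block_list: "S \<in> base_blocks \<Longrightarrow> S \<in> set ` set block_list"
proof -
  assume "S \<in> base_blocks"
  then obtain m where "S = set (block_list ! m)" "m \<in> {0, 1, 2, 3, 4, 5, 6}"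
    unfolding base_blocks_eq by blast
  then have "S = set (block_list ! m)" "m < length block_list"
    unfolding length_block_list by fastforce+
  then show ?thesis by (metis image_eqI nth_mem)
qed

text \<open>The list contains the base blocks and is closed under G, which gives one inclusion.
  Every entry is reached from a base block by generators, which gives the other.\<close>

lemma D_eq: "D = set ` set block_list"
proof
  show "D \<subseteq> set ` set block_list"
  proof
    fix B assume "B \<in> D"
    then obtain S g where S: "S \<in> base_blocks" and g: "g \<in> carrier group_G" and B: "B = g ` S"
      unfolding D_iff by (elim bexE)
    show "B \<in> set ` set block_list"
      unfolding B by (rule group_G_closed[OF g base_in_block_list[OF S]])
  qed
  have base: "set (block_list ! m) \<in> D" if "m < 7" for m
  proof -
    have "m \<in> {0, 1, 2, 3, 4, 5, 6}" using that by auto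
    then show ?thesis using base_in_D unfolding base_blocks_eq by blast
  qed
  have "set (block_list ! m) \<in> D" if "m < 574" for m
    by (rule spanned_from_in_D[OF spanned_block_list _ that]) (rule base)
  then show "set ` set block_list \<subseteq> D"
    by (metis image_subsetI in_set_conv_nth length_block_list)
qed

lemma block_list_sorted:
  "list_all (\<lambda>B. sorted_wrt (<) B \<and> list_all (\<lambda>x. 1 \<le> x \<and> x \<le> 42)
    B \<and> length B = 6) block_list"
  by (simp only: block_list_def list.pred_inject simp_thms) simp

section \<open>The automorphism group of D and words in the generators\<close>

definition aut_D :: "(nat \<Rightarrow> nat) \<Rightarrow> bool"
  where "aut_D p \<longleftrightarrow> p permutes {1..42} \<and> (`) p ` D = D"

lemma D_subset:
  assumes "B \<in> D"
  shows "B \<subseteq> {1..42}"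
proof -
  obtain C where "B = set C" "C \<in> set block_list" using assms unfolding D_eq by blast
  then have "list_all (\<lambda>x. 1 \<le> x \<and> x \<le> 42) C"
    using block_list_sorted unfolding list_all_iff[of _ block_list] by blast
  then show ?thesis using \<open>B = set C\<close> by (auto simp: list_all_iff)
qed

lemma finite_D: "finite D"
  unfolding D_eq by blast

lemma aut_DI:
  assumes "p permutes {1..42}" and "\<And>B. B \<in> D \<Longrightarrow> p ` B \<in> D"
  shows "aut_D p"
proof -
  have "inj_on ((`) p) D"
    by (rule inj_onI) (use permutes_inj[OF assms(1)] inj_image_eq_iff in blast)
  then show ?thesis
    using assms endo_inj_surj[OF finite_D, of "(`) p"] unfolding aut_D_def by blast
qed

lemma aut_D_permutes: "aut_D p \<Longrightarrow> p permutes {1..42}"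
  by (simp add: aut_D_def)

lemma aut_D_image_iff:
  assumes "aut_D p"
  shows "p ` B \<in> D \<longleftrightarrow> B \<in> D"
proof -
  have eq: "(`) p ` D = D" using assms unfolding aut_D_def by (elim conjE)
  have "inj ((`) p)" using permutes_inj[OF aut_D_permutes[OF assms]] by (simp add: inj_image_eq_iff
    inj_def)
  then show ?thesis using inj_image_mem_iff[of "(`) p" B D] unfolding eq by argo
qed

lemma aut_D_comp:
  assumes "aut_D p" and "aut_D q"
  shows "aut_D (p \<circ> q)"
proof (rule aut_DI)
  show "p \<circ> q permutes {1..42}"
    using assms aut_D_permutes permutes_compose by blast
  fix B assume "B \<in> D"
  then have "p ` q ` B \<in> D" using aut_D_image_iff assms by presburger
  then show "(p \<circ> q) ` B \<in> D" unfolding image_comp .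
qed

lemma aut_D_inv:
  assumes "aut_D p"
  shows "aut_D (inv' p)"
proof (rule aut_DI)
  show "inv' p permutes {1..42}" using aut_D_permutes[OF assms] by (rule permutes_inv)
  fix B assume "B \<in> D"
  moreover have "p ` inv' p ` B = B"
    using permutes_surj[OF aut_D_permutes[OF assms]] by (rule image_f_inv_f)
  ultimately show "inv' p ` B \<in> D" using aut_D_image_iff[OF assms] by metis
qed

lemma aut_D_generator: "aut_D (generator k)"
proof (rule aut_DI[OF _ generator_in_D])
  show "generator k permutes {1..42}"
    unfolding generator_def using permutes_alpha permutes_beta permutes_compose by auto
qed

text \<open>Letters act from left to right, so that evaluation at a point consumes the list from its
  head.\<close>

primrec word :: "nat list \<Rightarrow> nat \<Rightarrow> nat" where
  "word [] = id"
| "word (k # w) = word w \<circ> generator k"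

lemma word_simps [simp]:
  "word [] x = x"
  "word (0 # w) x = word w (perm_beta x)"
  "word (1 # w) x = word w (perm_alpha x)"
  "word (2 # w) x = word w (perm_alpha (perm_alpha x))"
  by (simp_all add: generator_def)

declare word.simps [simp del]

lemma word_append: "word (v @ w) = word w \<circ> word v"
  by (induction v) (simp_all add: word.simps comp_assoc)

lemma aut_D_word: "aut_D (word w)"
proof (induction w)
  case Nil
  show ?case unfolding word.simps by (rule aut_DI[OF permutes_id]) simp
next
  case (Cons k w)
  then show ?case unfolding word.simps using aut_D_comp aut_D_generator by blast
qed

section \<open>An invariant of pairs of points\<close>

definition covered :: "nat \<Rightarrow> nat \<Rightarrow> nat set \<Rightarrow> bool"
  where "covered a b C \<longleftrightarrow> a \<notin> C \<and> b \<notin> C \<and>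
    (\<forall>x \<in> C. \<exists>y \<in> C. x \<noteq> y \<and> (\<exists>K \<in> D. {a, b, x, y}
      \<subseteq> K))"

text \<open>In a Steiner system the blocks counted are those meeting three blocks through
  \<open>a\<close> and \<open>b\<close> in two points each.\<close>

definition pair_count :: "nat \<Rightarrow> nat \<Rightarrow> nat"
  where "pair_count a b = card {C \<in> D. covered a b C}"

lemma covered_image:
  assumes "aut_D p" and "covered a b C"
  shows "covered (p a) (p b) (p ` C)"
proof -
  have inj: "p x = p y \<longleftrightarrow> x = y" for x y
    using permutes_inj[OF aut_D_permutes[OF assms(1)]] by (rule inj_eq)
  have "\<exists>y' \<in> p ` C. p x \<noteq> y' \<and> (\<exists>K \<in> D. {p a, p b, p x, y'}
    \<subseteq> K)" if "x \<in> C" for x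
  proof -
    obtain y K where "y \<in> C" "x \<noteq> y" "K \<in> D" "{a, b, x, y} \<subseteq> K"
      using assms(2) \<open>x \<in> C\<close> unfolding covered_def by blast
    moreover have "p ` K \<in> D" using aut_D_image_iff[OF assms(1)] \<open>K \<in> D\<close> by blast
    ultimately show ?thesis using inj by (intro bexI[of _ "p y"] conjI bexI[of _ "p ` K"]) auto
  qed
  then show ?thesis using assms(2) inj unfolding covered_def by auto
qed

text \<open>Taking images injects the family counted at (a, b) into the one counted at the image
  pair; the inverse automorphism gives the other inequality.\<close>

lemma pair_count_aut:
  assumes "aut_D p"
  shows "pair_count (p a) (p b) = pair_count a b"
proof -
  have le: "pair_count a b \<le> pair_count (q a) (q b)" if q: "aut_D q" for a b q
    unfolding pair_count_def
  proof (rule card_inj_on_le)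
    show "inj_on ((`) q) {C \<in> D. covered a b C}"
      by (rule inj_onI) (use permutes_inj[OF aut_D_permutes[OF q]] inj_image_eq_iff in blast)
    show "(`) q ` {C \<in> D. covered a b C} \<subseteq> {C \<in> D. covered (q a) (q b) C}"
      using covered_image[OF q] aut_D_image_iff[OF q] by blast
    show "finite {C \<in> D. covered (q a) (q b) C}" using finite_D by simp
  qed
  have "inv' p (p x) = x" for x
    using permutes_inverses[OF aut_D_permutes[OF assms]] by simp
  then show ?thesis
    using le[OF assms, of a b] le[OF aut_D_inv[OF assms], of "p a" "p b"] by simp
qed

text \<open>If \<open>Ks\<close> lists the blocks through a and b, every further point lies on
  exactly one of them. The position of that block serves as a colour of the point, with
  \<open>length Ks\<close> as the value for a point on no listed block.\<close>

definition class_index :: "nat list list \<Rightarrow> nat \<Rightarrow> nat"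
  where "class_index Ks x = length (takeWhile (\<lambda>K. x \<notin> set K) Ks)"

definition is_star :: "nat \<Rightarrow> nat \<Rightarrow> nat list list \<Rightarrow> bool"
  where "is_star a b Ks \<longleftrightarrow> {K \<in> D. a \<in> K \<and> b \<in> K} = set ` set Ks"

text \<open>The positions \<open>ns\<close> show that the listed blocks belong to D, and one pass
  over all blocks shows that none is missing. The nested conditionals confine the membership test in
  \<open>Ks\<close> to the blocks that contain both points.\<close>

lemma is_starI:
  assumes "Ks = map ((!) block_list) ns"
    and "list_all (\<lambda>B. if a \<in> set B then (if b \<in> set B then B \<in> set Ks else
      True) else True) block_list"
    and "list_all (\<lambda>n. n < 574) ns" and "list_all (\<lambda>K. a \<in> set K \<and> b \<in>
      set K) Ks"
  shows "is_star a b Ks"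
proof -
  have "set Ks \<subseteq> set block_list"
    using assms(1,3) length_block_list by (auto simp: list_all_iff)
  then show ?thesis
    using assms(2,4) unfolding is_star_def D_eq list_all_iff by (auto split: if_splits)
qed

text \<open>Two points lie on 40 / 4 = 10 blocks. A point of the n-th block gets colour n only if no
  earlier block contains it, so the condition expresses that the blocks are disjoint away from a and
  b.\<close>

definition star_classes :: "nat \<Rightarrow> nat \<Rightarrow> nat list list \<Rightarrow> bool"
  where "star_classes a b Ks \<longleftrightarrow> list_all2 (\<lambda>K n. \<forall>x \<in> set K.
    x = a \<or> x = b \<or> class_index Ks x = n)
    Ks [0, 1, 2, 3, 4, 5, 6, 7, 8, 9]"

definition points_list :: "nat list" where
  "points_list = [1, 2, 3, 4, 5, 6, 7, 8, 9, 10, 11, 12, 13, 14, 15, 16, 17, 18, 19, 20, 21, 22, 23, 24,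
   25, 26, 27, 28, 29, 30, 31, 32, 33, 34, 35, 36, 37, 38, 39, 40, 41, 42]"

lemma points_list_upt: "points_list = [1..<43]"
  unfolding points_list_def by (simp add: upt_Cons_num)

lemma set_points_list: "set points_list = {1..42}"
  unfolding points_list_upt set_upt by auto

text \<open>This turns the search for a block in \<open>covered\<close> into a comparison of two
  colours, which can be tabulated.\<close>

lemma collinear_iff:
  assumes st: "is_star a b Ks" and cl: "star_classes a b Ks"
    and cov: "list_all (\<lambda>x. class_index Ks x < 10) points_list"
    and x: "x \<in> {1..42} - {a, b}" and y: "y \<in> {1..42} - {a, b}"
  shows "(\<exists>K \<in> D. {a, b, x, y} \<subseteq> K) \<longleftrightarrow> class_index Ks x =
    class_index Ks y"
proof -
  have len: "length Ks = 10"
    using list_all2_lengthD[OF cl[unfolded star_classes_def]] by simp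
  have ind: "class_index Ks z = n" if "n < 10" "z \<in> set (Ks ! n)" "z \<noteq> a" "z \<noteq> b"
    for n z
  proof -
    have n: "n < length Ks" using len that(1) by argo
    have "n = 0 \<or> n = 1 \<or> n = 2 \<or> n = 3 \<or> n = 4 \<or> n = 5 \<or> n = 6 \<or> n = 7
      \<or> n = 8 \<or> n = 9"
      using that(1) by arith
    then have "[0, 1, 2, 3, 4, 5, 6, 7, 8, 9] ! n = n"
      by (elim disjE) simp_all
    then show ?thesis
      using list_all2_nthD[OF cl[unfolded star_classes_def] n] that by metis
  qed
  have mem: "z \<in> set (Ks ! class_index Ks z)" "Ks ! class_index Ks z \<in> set Ks"
    if "z \<in> {1..42}" for z
  proof -
    have "class_index Ks z < length Ks"
      using cov that len set_points_list by (simp add: list_all_iff)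
    then show "z \<in> set (Ks ! class_index Ks z)" "Ks ! class_index Ks z \<in> set Ks"
      using nth_length_takeWhile[of "\<lambda>K. z \<notin> set K" Ks] by (simp_all add:
        class_index_def)
  qed
  have eq: "{K \<in> D. a \<in> K \<and> b \<in> K} = set ` set Ks" using st by (simp add: is_star_def)
  show ?thesis
  proof
    assume "\<exists>K \<in> D. {a, b, x, y} \<subseteq> K"
    then obtain K' where "K' \<in> {K \<in> D. a \<in> K \<and> b \<in> K}" "x \<in> K'" "y \<in>
      K'" by blast
    then obtain K where K: "K \<in> set Ks" "x \<in> set K" "y \<in> set K" unfolding eq by blast
    then obtain n where n: "n < 10" "K = Ks ! n" by (metis in_set_conv_nth len)
    then show "class_index Ks x = class_index Ks y" using ind[of n] K x y by auto
  next
    assume same: "class_index Ks x = class_index Ks y"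
    have "set (Ks ! class_index Ks x) \<in> {K \<in> D. a \<in> K \<and> b \<in> K}"
      unfolding eq using mem(2) x by blast
    then show "\<exists>K \<in> D. {a, b, x, y} \<subseteq> K" using mem(1)[of x] mem(1)[of y] x y
      same by auto
  qed
qed

definition covered_list :: "(nat \<Rightarrow> nat) \<Rightarrow> nat \<Rightarrow> nat
  \<Rightarrow> nat list \<Rightarrow> bool"
  where "covered_list f a b C \<longleftrightarrow> a \<notin> set C \<and> b \<notin> set C \<and>
    list_all (\<lambda>x. list_ex (\<lambda>y. f x = f y \<and> x \<noteq> y) C) C"

lemma inj_set_block_list: "inj_on set (set block_list)"
proof -
  have "sorted C \<and> distinct C" if "C \<in> set block_list" for C
    using block_list_sorted that unfolding list_all_iff[of _ block_list] strict_sorted_iff by blast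
  then show ?thesis
    unfolding inj_on_def using sorted_distinct_set_unique by blast
qed

text \<open>\<open>Cs\<close> is the proposed list of all counted blocks: its members are tested,
  and one pass over \<open>block_list\<close> shows that nothing is missing. Increasing lists are
  determined by their sets, so counting lists counts blocks.\<close>

lemma pair_count_eval:
  assumes st: "is_star a b Ks" "star_classes a b Ks"
      "list_all (\<lambda>x. class_index Ks x < 10) points_list"
    and Cs: "Cs = map ((!) block_list) ns" "list_all (\<lambda>n. n < 574) ns"
      "list_all (covered_list (class_index Ks) a b) Cs"
    and all: "list_all (\<lambda>B. if covered_list (class_index Ks) a b B then B \<in> set Cs else
      True) block_list"
  shows "pair_count a b = length (remdups Cs)"
proof -
  have sub: "set Cs \<subseteq> set block_list"
    using Cs(1,2) length_block_list by (auto simp: list_all_iff)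
  have "covered a b (set C) \<longleftrightarrow> C \<in> set Cs" if C: "C \<in> set block_list" for C
  proof -
    have "covered a b (set C) \<longleftrightarrow> covered_list (class_index Ks) a b C"
    proof (cases "a \<in> set C \<or> b \<in> set C")
      case False
      have "set C \<in> D" unfolding D_eq using C by blast
      then have "set C \<subseteq> {1..42} - {a, b}" using D_subset False by blast
      then have "(\<exists>K \<in> D. {a, b, x, y} \<subseteq> K) \<longleftrightarrow> class_index
        Ks x = class_index Ks y"
        if "x \<in> set C" "y \<in> set C" for x y
        using collinear_iff[OF st] that by blast
      then show ?thesis
        using False unfolding covered_def covered_list_def list_all_iff list_ex_iff by metis
    qed (auto simp: covered_def covered_list_def)
    then show ?thesis using Cs(3) all C unfolding list_all_iff by metis
  qed
  then have "{C \<in> D. covered a b C} = set ` set Cs"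
    unfolding D_eq using sub by blast
  then show ?thesis
    unfolding pair_count_def
    by (metis card_image length_remdups_card_conv inj_on_subset[OF inj_set_block_list sub])
qed

section \<open>The stars of seven pairs of points, and the pair counts at five of them\<close>

definition star_1_10 :: "nat list list" where
  "star_1_10 = map ((!) block_list) [0,3,11,19,53,63,75,248,292,335]"

lemma star_1_10_eq: "star_1_10 =
   [[1,2,3,10,11,12], [1,10,19,22,25,30], [1,10,21,23,32,35], [1,4,7,10,13,16],
    [1,5,9,10,14,18], [1,10,20,24,37,40], [1,6,8,10,15,17], [1,10,26,29,31,36],
    [1,10,33,34,39,41], [1,10,27,28,38,42]]"
  by (simp add: star_1_10_def)

lemma is_star_1_10: "is_star 1 10 star_1_10"
proof (rule is_starI[OF star_1_10_def])
  show "list_all (\<lambda>B. if 1 \<in> set B then (if 10 \<in> set B then B \<in> set star_1_10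
    else True) else True)
    block_list"
    by (simp only: block_list_def list.pred_inject simp_thms) (simp add: star_1_10_eq)
qed (simp_all add: star_1_10_eq)

definition star_1_19 :: "nat list list" where
  "star_1_19 = map ((!) block_list) [3,22,145,210,228,297,413,460,532,537]"

lemma star_1_19_eq: "star_1_19 =
   [[1,10,19,22,25,30], [1,8,11,16,19,23], [1,9,13,15,19,24], [1,17,19,21,26,38],
    [1,4,5,19,28,41], [1,14,19,20,33,42], [1,3,6,19,35,39], [1,18,19,31,32,37],
    [1,2,7,19,29,40], [1,12,19,27,34,36]]"
  by (simp add: star_1_19_def)

lemma is_star_1_19: "is_star 1 19 star_1_19"
proof (rule is_starI[OF star_1_19_def])
  show "list_all (\<lambda>B. if 1 \<in> set B then (if 19 \<in> set B then B \<in> set star_1_19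
    else True) else True)
    block_list"
    by (simp only: block_list_def list.pred_inject simp_thms) (simp add: star_1_19_eq)
qed (simp_all add: star_1_19_eq)

definition star_19_20 :: "nat list list" where
  "star_19_20 = map ((!) block_list) [5,256,297,391,398,437,492,546,565,567]"

lemma star_19_20_eq: "star_19_20 =
   [[19,20,21,22,23,24], [5,12,19,20,26,39], [1,14,19,20,33,42], [7,11,19,20,32,41],
    [8,15,19,20,25,37], [2,18,19,20,27,38], [3,10,19,20,28,36], [4,17,19,20,31,40],
    [9,16,19,20,29,35], [6,13,19,20,30,34]]"
  by (simp add: star_19_20_def)

lemma is_star_19_20: "is_star 19 20 star_19_20"
proof (rule is_starI[OF star_19_20_def])
  show "list_all (\<lambda>B. if 19 \<in> set B then (if 20 \<in> set B then B \<in> set star_19_20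
    else True) else True)
    block_list"
    by (simp only: block_list_def list.pred_inject simp_thms) (simp add: star_19_20_eq)
qed (simp_all add: star_19_20_eq)

definition star_19_22 :: "nat list list" where
  "star_19_22 = map ((!) block_list) [3,5,6,33,62,81,217,238,378,382]"

lemma star_19_22_eq: "star_19_22 =
   [[1,10,19,22,25,30], [19,20,21,22,23,24], [19,22,31,36,38,42], [19,22,32,34,39,40],
    [7,16,19,22,26,28], [2,3,15,17,19,22], [19,22,33,35,37,41], [8,9,12,14,19,22],
    [5,6,11,18,19,22], [4,13,19,22,27,29]]"
  by (simp add: star_19_22_def)

lemma is_star_19_22: "is_star 19 22 star_19_22"
proof (rule is_starI[OF star_19_22_def])
  show "list_all (\<lambda>B. if 19 \<in> set B then (if 22 \<in> set B then B \<in> set star_19_22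
    else True) else True)
    block_list"
    by (simp only: block_list_def list.pred_inject simp_thms) (simp add: star_19_22_eq)
qed (simp_all add: star_19_22_eq)

definition star_19_25 :: "nat list list" where
  "star_19_25 = map ((!) block_list) [3,132,172,298,311,318,343,398,407,503]"

lemma star_19_25_eq: "star_19_25 =
   [[1,10,19,22,25,30], [19,23,25,29,33,34], [19,24,25,28,38,40], [3,14,19,25,26,41],
    [4,11,19,21,25,39], [12,13,16,19,25,31], [6,17,19,25,27,42], [8,15,19,20,25,37],
    [2,5,9,19,25,32], [7,18,19,25,35,36]]"
  by (simp add: star_19_25_def)

lemma is_star_19_25: "is_star 19 25 star_19_25"
proof (rule is_starI[OF star_19_25_def])
  show "list_all (\<lambda>B. if 19 \<in> set B then (if 25 \<in> set B then B \<in> set star_19_25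
    else True) else True)
    block_list"
    by (simp only: block_list_def list.pred_inject simp_thms) (simp add: star_19_25_eq)
qed (simp_all add: star_19_25_eq)

text \<open>This star and that of 1 and 20 provide invariants that separate the points once 1, 10,
  19 and then 20 are known to be fixed.\<close>

definition star_10_19 :: "nat list list" where
  "star_10_19 = map ((!) block_list) [3,10,36,68,114,136,426,492,571,573]"

lemma star_10_19_eq: "star_10_19 =
   [[1,10,19,22,25,30], [2,4,10,14,19,23], [10,13,18,19,26,33], [9,10,19,21,31,41],
    [6,7,10,12,19,24], [10,11,17,19,34,37], [10,15,16,19,27,32], [3,10,19,20,28,36],
    [5,10,19,35,40,42], [8,10,19,29,38,39]]"
  by (simp add: star_10_19_def)

lemma is_star_10_19: "is_star 10 19 star_10_19"
proof (rule is_starI[OF star_10_19_def])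
  show "list_all (\<lambda>B. if 10 \<in> set B then (if 19 \<in> set B then B \<in> set star_10_19
    else True) else True)
    block_list"
    by (simp only: block_list_def list.pred_inject simp_thms) (simp add: star_10_19_eq)
qed (simp_all add: star_10_19_eq)

definition star_1_20 :: "nat list list" where
  "star_1_20 = map ((!) block_list) [1,4,63,85,284,297,321,446,505,525]"

lemma star_1_20_eq: "star_1_20 =
   [[1,2,4,20,36,39], [1,11,20,21,29,34], [1,10,20,24,37,40], [1,3,13,18,20,23],
    [1,5,16,17,20,22], [1,14,19,20,33,42], [1,6,9,20,25,31], [1,15,20,26,27,41],
    [1,12,20,28,30,32], [1,7,8,20,35,38]]"
  by (simp add: star_1_20_def)

lemma is_star_1_20: "is_star 1 20 star_1_20"
proof (rule is_starI[OF star_1_20_def])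
  show "list_all (\<lambda>B. if 1 \<in> set B then (if 20 \<in> set B then B \<in> set star_1_20
    else True) else True)
    block_list"
    by (simp only: block_list_def list.pred_inject simp_thms) (simp add: star_1_20_eq)
qed (simp_all add: star_1_20_eq)

text \<open>The colours are computed once for all points, so that the passes over all blocks compare
  numbers instead of searching the star again.\<close>

lemma class_index_1_10: "map (class_index star_1_10) points_list =
   [0, 0, 0, 3, 4, 6, 3, 6, 4, 0, 0, 0, 3, 4, 6, 3, 6, 4, 1, 5, 2, 1, 2, 5, 1, 7, 9, 9, 7, 1,
   7, 2, 8, 8, 2, 7, 5, 9, 8, 5, 8, 9]"
  by (simp add: class_index_def points_list_def star_1_10_eq)

lemmas class_index_1_10_simps =
  class_index_1_10[unfolded points_list_def, simplified list.map list.inject simp_thms]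

definition covering_1_10 :: "nat list list" where
  "covering_1_10 = map ((!) block_list)
   [5, 6, 7, 15, 16, 18, 30, 34, 48, 50, 52, 60, 69, 71, 72, 74, 81, 84, 92, 95, 98, 100,
   101, 108, 122, 133, 169, 172, 192, 215, 216, 220, 235, 240, 242, 257, 258, 263, 266, 288, 300,
   309, 314, 332, 343, 352, 358, 374, 388, 396, 398, 427, 438, 440, 450, 451, 490, 491, 511, 544]"

text \<open>The value 60 is attained by no pair through 19, which makes it the marker of {1..18} in
  \<open>small_iff\<close>.\<close>

lemma pair_count_1_10: "pair_count 1 10 = 60"
proof -
  have "pair_count 1 10 = length (remdups covering_1_10)"
  proof (rule pair_count_eval[OF is_star_1_10 _ _ covering_1_10_def])
    show "star_classes 1 10 star_1_10"
      unfolding star_classes_def by (subst (2) star_1_10_eq) (simp add: class_index_1_10_simps)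
    show "list_all (\<lambda>B. if covered_list (class_index star_1_10) 1 10 B then B \<in> set
      covering_1_10 else True)
      block_list"
      by (simp only: block_list_def list.pred_inject simp_thms)
        (simp add: covered_list_def class_index_1_10_simps covering_1_10_def)
  qed (simp_all add: points_list_def covered_list_def class_index_1_10_simps covering_1_10_def)
  then show ?thesis by (simp add: covering_1_10_def)
qed

lemma class_index_1_19: "map (class_index star_1_19) points_list =
   [0, 8, 6, 4, 4, 6, 8, 1, 2, 0, 1, 9, 2, 5, 2, 1, 3, 7, 0, 5, 3, 0, 1, 2, 0, 3, 9, 4, 8, 0,
   7, 7, 5, 9, 6, 9, 7, 3, 6, 8, 4, 5]"
  by (simp add: class_index_def points_list_def star_1_19_eq)

lemmas class_index_1_19_simps =
  class_index_1_19[unfolded points_list_def, simplified list.map list.inject simp_thms]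

definition covering_1_19 :: "nat list list" where
  "covering_1_19 = map ((!) block_list)
   [73, 368, 424]"

lemma pair_count_1_19: "pair_count 1 19 = 3"
proof -
  have "pair_count 1 19 = length (remdups covering_1_19)"
  proof (rule pair_count_eval[OF is_star_1_19 _ _ covering_1_19_def])
    show "star_classes 1 19 star_1_19"
      unfolding star_classes_def by (subst (2) star_1_19_eq) (simp add: class_index_1_19_simps)
    show "list_all (\<lambda>B. if covered_list (class_index star_1_19) 1 19 B then B \<in> set
      covering_1_19 else True)
      block_list"
      by (simp only: block_list_def list.pred_inject simp_thms)
        (simp add: covered_list_def class_index_1_19_simps covering_1_19_def)
  qed (simp_all add: points_list_def covered_list_def class_index_1_19_simps covering_1_19_def)
  then show ?thesis by (simp add: covering_1_19_def)
qed

lemma class_index_19_20: "map (class_index star_19_20) points_list =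
   [2, 5, 6, 7, 1, 9, 3, 4, 8, 6, 3, 1, 9, 2, 4, 8, 7, 5, 0, 0, 0, 0, 0, 0, 4, 1, 5, 6, 8, 9,
   7, 3, 2, 9, 8, 6, 4, 5, 1, 7, 3, 2]"
  by (simp add: class_index_def points_list_def star_19_20_eq)

lemmas class_index_19_20_simps =
  class_index_19_20[unfolded points_list_def, simplified list.map list.inject simp_thms]

definition covering_19_20 :: "nat list list" where
  "covering_19_20 = map ((!) block_list)
   [20, 61, 105, 116, 119, 198, 214, 227, 260, 279, 291, 294, 295, 320, 335, 355, 359, 373,
   381, 395, 420, 440, 452, 471, 479, 549, 551, 552, 554, 563]"

lemma pair_count_19_20: "pair_count 19 20 = 30"
proof -
  have "pair_count 19 20 = length (remdups covering_19_20)"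
  proof (rule pair_count_eval[OF is_star_19_20 _ _ covering_19_20_def])
    show "star_classes 19 20 star_19_20"
      unfolding star_classes_def by (subst (2) star_19_20_eq) (simp add: class_index_19_20_simps)
    show "list_all (\<lambda>B. if covered_list (class_index star_19_20) 19 20 B then B \<in> set
      covering_19_20 else True)
      block_list"
      by (simp only: block_list_def list.pred_inject simp_thms)
        (simp add: covered_list_def class_index_19_20_simps covering_19_20_def)
  qed (simp_all add: points_list_def covered_list_def class_index_19_20_simps covering_19_20_def)
  then show ?thesis by (simp add: covering_19_20_def)
qed

lemma class_index_19_22: "map (class_index star_19_22) points_list =
   [0, 5, 5, 9, 8, 8, 4, 7, 7, 0, 8, 7, 9, 7, 5, 4, 5, 8, 0, 1, 1, 0, 1, 1, 0, 4, 9, 4, 9, 0,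
   2, 3, 6, 3, 6, 2, 6, 2, 3, 3, 6, 2]"
  by (simp add: class_index_def points_list_def star_19_22_eq)

lemmas class_index_19_22_simps =
  class_index_19_22[unfolded points_list_def, simplified list.map list.inject simp_thms]

definition covering_19_22 :: "nat list list" where
  "covering_19_22 = map ((!) block_list)
   [15, 17, 18, 19, 30, 34, 38, 41, 47, 48, 50, 53, 66, 71, 74, 84, 101, 108, 129, 144, 149,
   155, 168, 169, 171, 189, 207, 219, 220, 230, 234, 235, 239, 242, 285, 292, 314, 349, 352, 385,
   388, 402, 427, 433, 435, 444, 451, 491]"

lemma pair_count_19_22: "pair_count 19 22 = 48"
proof -
  have "pair_count 19 22 = length (remdups covering_19_22)"
  proof (rule pair_count_eval[OF is_star_19_22 _ _ covering_19_22_def])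
    show "star_classes 19 22 star_19_22"
      unfolding star_classes_def by (subst (2) star_19_22_eq) (simp add: class_index_19_22_simps)
    show "list_all (\<lambda>B. if covered_list (class_index star_19_22) 19 22 B then B \<in> set
      covering_19_22 else True)
      block_list"
      by (simp only: block_list_def list.pred_inject simp_thms)
        (simp add: covered_list_def class_index_19_22_simps covering_19_22_def)
  qed (simp_all add: points_list_def covered_list_def class_index_19_22_simps covering_19_22_def)
  then show ?thesis by (simp add: covering_19_22_def)
qed

lemma class_index_19_25: "map (class_index star_19_25) points_list =
   [0, 8, 3, 4, 8, 6, 9, 7, 8, 0, 4, 5, 5, 3, 7, 5, 6, 9, 0, 7, 4, 0, 1, 2, 0, 3, 6, 2, 1, 0,
   5, 8, 1, 1, 9, 9, 7, 2, 4, 2, 3, 6]"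
  by (simp add: class_index_def points_list_def star_19_25_eq)

lemmas class_index_19_25_simps =
  class_index_19_25[unfolded points_list_def, simplified list.map list.inject simp_thms]

definition covering_19_25 :: "nat list list" where
  "covering_19_25 = map ((!) block_list)
   [16, 39, 60, 63, 75, 95, 119, 122, 126, 140, 146, 192, 196, 216, 240, 241, 254, 258, 266,
   280, 290, 309, 335, 374, 406, 409, 414, 434, 440, 456, 496, 516, 519, 523, 536, 558]"

lemma pair_count_19_25: "pair_count 19 25 = 36"
proof -
  have "pair_count 19 25 = length (remdups covering_19_25)"
  proof (rule pair_count_eval[OF is_star_19_25 _ _ covering_19_25_def])
    show "star_classes 19 25 star_19_25"
      unfolding star_classes_def by (subst (2) star_19_25_eq) (simp add: class_index_19_25_simps)
    show "list_all (\<lambda>B. if covered_list (class_index star_19_25) 19 25 B then B \<in> set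
      covering_19_25 else True)
      block_list"
      by (simp only: block_list_def list.pred_inject simp_thms)
        (simp add: covered_list_def class_index_19_25_simps covering_19_25_def)
  qed (simp_all add: points_list_def covered_list_def class_index_19_25_simps covering_19_25_def)
  then show ?thesis by (simp add: covering_19_25_def)
qed

section \<open>The automorphism group acts regularly\<close>

definition inv_word :: "nat list \<Rightarrow> nat list"
  where "inv_word w = map (\<lambda>k. if k = 0 then 0 else if k = 1 then 2 else 1) (rev w)"

text \<open>This is the conjugate h w^k h^(-1) of a power, in a form that can be evaluated at single
  points. That \<open>inv_word\<close> gives the inverse element is established in
  \<open>word_inv_word\<close>.\<close>

definition conj_power :: "nat list \<Rightarrow> nat \<Rightarrow> nat list \<Rightarrow> nat
  \<Rightarrow> nat"
  where "conj_power w k h x = word h ((word w ^^ k) (word (inv_word h) x))"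

lemma funpow_eval [simp]:
  "(f ^^ 1) x = f x" "(f ^^ 2) x = f (f x)" "(f ^^ 3) x = f (f (f x))"
  "(f ^^ 4) x = f (f (f (f x)))"
  for f :: "'a \<Rightarrow> 'a"
  by (simp_all add: numeral_eq_Suc One_nat_def)

text \<open>Values at 1 and 19 of one element of order 2 or 3 from each of the five conjugacy classes
  excluded below.\<close>

definition target_values :: "(nat \<times> nat) list"
  where "target_values = [(2, 38), (10, 23), (1, 22), (2, 20), (1, 26)]"

definition certified :: "nat list \<times> nat \<times> nat list \<Rightarrow> bool"
  where "certified c \<longleftrightarrow> (case c of (w, k, h) \<Rightarrow>
    (conj_power w k h 1, conj_power w k h 19) \<in> set target_values)"

text \<open>For each nontrivial element of the group a word for it, an exponent, and a word conjugating
  that power into one of the five chosen elements.\<close>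

definition certificates :: "(nat list \<times> nat \<times> nat list) list"
  where "certificates =
  [([0,1,0,2,0,1,0,2], 1, [1]), ([1,0,2,0,1,0,2,0], 2, [1]),
   ([0,1,0,2,0,1,0,2,0,1,0,2], 1, []), ([0,1,0,2], 3, []),
   ([1,0,2,0], 3, []), ([0,2,0,1,0,2,0,2,0,2,0], 2, []),
   ([2,0,1,0,2,0,1,0], 1, []), ([2,0,2,0,1,0,1,0,2,0,2,0,1], 3, []),
   ([1,0,2,0,2,0,1,0,2,0,1,0], 2, [0,1,0,2]), ([1,0,1,0,1,0,2,0,2,0,2,0], 3, []),
   ([0,1,0,1,0,1,0,2,0,1,0], 2, []), ([1,0,1,0,2,0,2,0,2,0,1,0,1], 3, []),
   ([0,2,0,1,0,2,0,1], 2, []), ([2,0,1,0,2,0,2,0,2], 2, []),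
   ([1,0,1,0,1,0,2,0,1], 2, []), ([0,1,0,1,0,1,0,2,0,2,0,2], 2, []),
   ([0,1,0,2,0,2,0,1,0,2,0,1], 2, [1,0,2]), ([2,0,1,0,1,0,2,0,2,0,1,0,1], 3, []),
   ([2,0,1,0,2,0,1,0,1,0,2,0], 1, [1,0,2]), ([2,0,2,0,1,0,2,0,1,0,1,0,1], 2, []),
   ([0,2,0,1,0,2,0,1,0,1,0,2], 1, [0,1,0,2]), ([2,0,2,0,2,0,1,0,2,0,1,0,1], 2, []),
   ([2,0,1,0,2,0,2,0,2,0,1,0,2], 3, []), ([1,0,1,0,1,0,2,0,2], 1, [1,0,1,0]),
   ([0,1,0,2,0,2,0,1,0,2,0,2], 1, []), ([0,1,0,1,0,1,0,2,0,2,0], 1, [0,1,0,1,0]),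
   ([0,2,0,1,0,2,0,2], 3, [0,1,0,1]), ([1,0,1,0,2,0,2,0,2,0,1,0,2], 1, [2,0,1]),
   ([2,0,1,0,2,0,2,0], 3, [1,0,1]), ([0,2,0,1,0,2,0,2,0,2,0,1], 3, [0,1]),
   ([2,0,1,0,2,0,1,0,1], 2, [0,1]), ([2,0,2,0,1,0,1,0,2,0,2,0,2], 1, [1,0,2,0,2]),
   ([1,0,1,0,1,0,2,0,2,0,2,0,1], 2, [1,0,1,0,1]), ([0,1,0,1,0,1,0,2,0,1,0,1], 2, [2,0,2,0,2,0]),
   ([1,0,2,0,2,0,1,0,2,0,1,0,1], 4, []), ([0,2,0,1,0,2,0,1,0,1,0], 2, [1]),
   ([2,0,1,0,2,0,2,0,2,0,1,0], 3, [1]), ([2,0,2,0,2,0,1,0,2,0,1,0,2], 2, [1,0,1,0,2]),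
   ([1,0,1,0,1,0,2,0,1,0,1,0], 1, [2,0,1,0,2,0]), ([2,0,1,0,1,0,2,0,2,0,1,0,2], 2, [2,0,1,0,1]),
   ([2,0,2,0,1,0,2,0,1,0,1,0,2], 2, []), ([1,0,2,0,1,0,2,0,1], 4, [0,2,0,2]),
   ([1], 1, []), ([0,1,0,2,0,1,0], 2, [1,0,1]),
   ([0,1,0], 1, [0]), ([1,0,2,0,1], 2, [0,1,0,1]),
   ([0,1,0,2,0,1,0,2,0,1,0], 4, [2,0,2]), ([1,0,1,0,1,0,2,0,1,0,2,0,1], 2, [0,1,0,2,0,2,0]),
   ([1,0,2,0,2,0,2,0,1,0,1,0,2], 2, [1,0,2,0,2,0]), ([0,1,0,1,0,2,0,1,0,1,0,2], 2, []),
   ([0,2,0,2,0,1,0,1,0,2,0], 2, [2,0,1,0,2]), ([2,0,2,0,1,0,1,0,2], 3, [2,0,1,0,1]),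
   ([0,2,0,1,0,2,0,1,0,2,0,1], 1, [2]), ([1,0,2,0,1,0,2,0,1,0,1,0,1], 1, [1,0,1,0,2]),
   ([1,0,1,0,1], 2, [2]), ([0,1,0,2,0,2,0,1], 2, [1]),
   ([0,2,0,1], 4, []), ([1,0,2,0,1,0,1,0,1], 2, [1,0,1]),
   ([0,1,0,2,0,1,0,2,0,2,0,1], 1, [1,0,1,0,2,0,2,0]), ([1,0,1,0,1,0,2,0,2,0,1,0,1], 2, [1,0,2,0,2]),
   ([1,0,2,0,2,0,1,0], 2, [0,1]), ([0,1,0,1,0,1,0], 2, [0,2]),
   ([2,0,1,0], 2, []), ([0,2,0,1,0,2,0,2,0,1,0,1], 1, [0,1,0,1,0,2,0,2,0]),
   ([0,1,0,2,0,1,0,1,0,1,0], 2, [0,1,0,1]), ([0,2,0,2,0,1,0,2,0,1,0,2], 4, [2]),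
   ([2,0,2,0,2,0,1,0,2,0,2,0], 2, [1,0,1,0,2,0]), ([0,2,0,1,0,1,0,2,0,2,0,2], 2, [1,0,1,0,1]),
   ([0,2,0,2,0,2,0,1,0,2,0,2], 1, [1,0,1,0,1,0]), ([2,0,1,0,1,0,2,0,2,0,2,0], 2, [2,0,1,0,1]),
   ([2,0,2,0,1,0,2,0,1,0,2,0], 4, [0,2]), ([1,0,1,0,1,0,2,0,1,0,1,0,1], 2, [1]),
   ([2,0,2,0,1,0,2,0,1,0,1,0], 1, [2,0,1,0,2]), ([2,0,1,0,1,0,2,0,2,0,1,0], 2, [2,0,2,0,2]),
   ([2,0,1,0,2,0,2,0,2,0,1,0,1], 1, [0,1]), ([0,2,0,1,0,2,0,1,0,1,0,1], 2, [1]),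
   ([2,0,2,0,2,0,1,0,2,0,1,0], 4, [1]), ([0,2,0,2,0,1,0,1,0,1,0], 1, [0,2,0,2,0]),
   ([2,0,1,0,2,0,1,0,2], 2, [0,2,0,2]), ([2,0,2,0,1,0,1,0,2,0,2,0], 2, [0,1,0,1]),
   ([0,1,0,1,0,1,0,2,0,1,0,2], 3, [1,0,1]), ([1,0,2,0,2,0,1,0,2,0,1,0,2], 2, [2]),
   ([1,0,1,0,2,0,1,0,1,0,1,0], 2, [1,0,1,0,1,0]), ([0,1,0,1], 2, [1,0,1,0,1]),
   ([0,1,0,2,0,1,0,2,0,1,0,1], 2, [0,2]), ([1,0,2,0,2], 2, [1,0]),
   ([2], 2, []), ([1,0,2,0,1,0,2,0,2], 2, [2,0,1]),
   ([0,1,0,2,0,1,0,1], 2, [1,0,2,0,2]), ([0,1,0,1,0,1,0,2,0,2,0,1], 2, [2,0,1,0,1]),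
   ([1,0,1,0,1,0,2,0], 3, [2,0,1]), ([0,1,0,2,0,2,0,1,0,2,0], 2, [0,1,0,2,0]),
   ([1,0,1,0,2,0,2,0,2,0,1,0], 3, [2]), ([2,0,1,0,2,0,2,0,1], 2, [2,0,1,0]),
   ([0,2,0,1,0,2,0], 2, [1,0,1]), ([1,0,1,0,2,0,2,0,1,0,1,0,1], 1, [0,1,0,2,0,2,0]),
   ([0,2,0,1,0,1,0,2,0,1,0,1], 2, [0,2]), ([0,2,0,2,0,1,0], 2, [0,2,0]),
   ([0,2,0,2,0,2,0,1,0,1,0,1], 3, [2,0,1]), ([0,1,0,2,0,2,0,2,0,1,0], 1, [1,0,1]),
   ([1,0,1,0,2,0,1,0], 3, [0,1,0,1]), ([0,1,0,1,0,2,0,1,0,2,0], 2, [2,0,1]),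
   ([2,0,2,0,2,0,1,0,1], 2, [2,0,2,0]), ([1,0,2,0,2,0,2,0,1,0,2,0], 2, [2]),
   ([2,0,1,0,1,0,2,0,1], 1, [2,0,1,0]), ([2,0,2,0,1,0,2,0], 3, [2,0,1,0,1]),
   ([0,1,0,1,0,2,0,2,0,1,0,1], 2, [0,1,0,1]), ([0,1,0,2,0,2,0,1,0,1,0,2], 1, [2,0,1,0,2,0,2,0]),
   ([1,0,2,0,1,0,1,0,2,0,2,0,1], 2, [2,0,1,0,1]), ([0,2,0,2,0,2,0,1], 2, [1,0,2]),
   ([1,0,1,0,2,0,2,0,1], 3, [0,1]), ([0,2,0,2,0,1,0,2,0,2,0], 2, [0,2]),
   ([0,2,0,1,0,1,0,2], 2, [0,1]), ([1,0,2,0,2,0,1,0,1,0,1,0], 2, [1]),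
   ([2,0,2,0,2], 3, [1]), ([0,1,0,2,0,1,0,1,0,2,0,2], 1, [2,0,2]),
   ([2,0,1,0,1,0,1,0], 3, [1,0,1]), ([2,0,2,0,1,0,2,0,2,0,2,0], 1, [2,0,2,0,2,0]),
   ([0,1,0,1,0,2,0,2], 2, [2]), ([1,0,1,0,2,0,2,0,2], 2, [1,0,1,0]),
   ([0,2,0,1,0,1,0], 1, [0,2,0]), ([0,2,0,2,0,1,0,2,0,2,0,1], 1, [2]),
   ([1,0,2,0,1,0,1,0,2,0,2,0,2], 3, [2]), ([0,1,0,2,0,2,0,1,0,1,0], 3, [1,0,1,0,1]),
   ([0,2,0,2,0,2,0,2], 1, [2,0,1,0,1]), ([0,1,0,1,0,2,0,1,0,2,0,1], 2, [0,1,0,2]),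
   ([2,0,2,0,2,0,1,0,2], 2, [1,0,1]), ([1,0,2,0,2,0,2,0,1,0,2,0,1], 1, [2,0,1,0,1,0]),
   ([2,0,2,0,1,0,2,0,1], 2, [0,1]), ([0,1,0,1,0,2,0,2,0,1,0,2], 2, [0,2,0,2]),
   ([2,0,1,0,1,0,2,0,2], 3, [0,1]), ([1,0,2,0,2,0,2,0], 2, [2,0,2]),
   ([0,1,0,1,0,2,0], 1, [0,1,0]), ([2,0,2,0,1,0,2,0,2,0,2,0,1], 2, [2]),
   ([2,0,2,0], 2, [1,0,1,0,1]), ([1,0,2,0,1,0,2,0,2,0,2,0], 3, [1,0,1]),
   ([0,1,0,2,0,1,0,1,0,2,0], 1, [0,1,0,2,0]), ([0,2,0,2,0,1,0,1], 2, [2,0,1]),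
   ([2,0,1,0,2,0,1,0,2,0,2,0], 4, [0,1,0,2]), ([0,2,0,1,0,1,0,2,0,1,0,2], 2, [0,1,0,1,0,2,0,2,0]),
   ([0,1,0,2,0,2,0,2,0,1,0,1], 3, [1]), ([1,0,1,0,2,0,1,0,1], 1, [2]),
   ([0,2,0,2,0,2,0,1,0,1,0,2], 2, [1]), ([1,0,1,0,2,0,2,0,1,0,2,0,1], 1, [1]),
   ([0,2,0,1,0,1,0,2,0,2,0,1], 1, [2,0,2,0,2]), ([0,2,0,2,0,1,0,2,0,1,0,1], 2, [2,0,1,0,2]),
   ([1,0,1,0,2,0,1,0,2,0,1,0,1], 1, [1]), ([0,2,0,2,0,2,0,1,0,2,0,1], 2, [1]),
   ([2,0,1,0,2,0,1,0,1,0,1,0], 3, [1]), ([1,0,2,0,1,0,2,0,1,0,1,0], 2, [2]),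
   ([1,0,1,0], 2, [2,0,1,0,1]), ([0,1,0,2,0,2,0], 2, [0,1,0]),
   ([0,1,0,2,0,1,0,2,0,2,0], 2, [2,0,1]), ([0,2,0], 2, [0]),
   ([1,0,2,0,1,0,1,0], 3, [1,0,1,0,1]), ([2,0,2,0,1,0,1,0,1], 1, [2,0,2,0]),
   ([0,2,0,2,0,1,0,1,0,2,0,2], 2, [1,0,1]), ([0,2,0,1,0,2,0,1,0,2,0], 2, [2,0,2]),
   ([1,0,1,0,1,0,2,0,1,0,2,0], 3, [0,1,0,1]), ([0,1,0,1,0,2,0,1,0,1,0,1], 1, [1,0,1,0,2,0]),
   ([1,0,2,0,2,0,2,0,1,0,1,0,1], 2, [2]), ([0,2,0,1,0,2,0,2,0,1,0], 2, [0,2,0,1,0]),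
   ([2,0,1,0,2], 2, [0,1,0,1]), ([0,1,0,1,0,2,0,2,0,2,0,1], 3, [2]),
   ([1,0,1,0,1,0,2,0,2,0,1,0], 2, [1,0,1,0,1]), ([0,1,0,1,0,1,0,2], 3, [2,0,1]),
   ([1,0,2,0,2,0,1,0,2], 2, [1,0,2,0]), ([2,0,2,0,1], 2, [2,0]),
   ([0,1,0,2,0,1,0,1,0,2,0,1], 2, [2]), ([1,0,2,0,1,0,2,0,2,0,2,0,1], 1, [1,0,2,0,2,0]),
   ([0,1,0,1,0,2,0,1], 3, [1,0,1]), ([1,0,2,0,2,0,2,0,1], 1, [0,1,0,1]),
   ([2,0,2,0,2,0,1,0,1,0,1,0], 3, [2,0,1]), ([0,1,0,1,0,2,0,1,0,2,0,2], 2, [2,0,1,0,2,0,2,0]),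
   ([2,0,2,0,2,0,1,0], 2, [0,1,0,2]), ([1,0,2,0,2,0,2,0,1,0,2,0,2], 2, [1,0,1,0,1]),
   ([0,1,0,1,0,2,0,2,0,1,0], 3, [1]), ([2,0,1,0,1,0,2,0], 2, [1]),
   ([2,0,2,0,1,0,2,0,2], 2, [2]), ([0,1,0,2,0,2,0,2,0,1,0,2], 3, [2]),
   ([0,2,0,2,0,2,0,1,0,1,0], 2, [0,2,0,2,0]), ([1,0,1,0,2,0,1,0,2], 2, [2,0,1]),
   ([1,0,1,0,2,0,2,0,1,0,1,0], 2, [1,0,1]), ([0,2,0,2,0,1,0,2], 2, [1,0,1,0,2]),
   ([0,2,0,1,0,1,0,2,0,1,0], 1, [0,2,0,1,0]), ([0,2,0,2,0,1,0,2,0,2,0,2], 2, [2,0,1,0,2,0]),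
   ([1,0,1,0,2,0,2,0], 2, [2]), ([0,2,0,1,0,1,0,1], 3, [0,1,0,1]),
   ([0,1,0,2,0,2,0,1,0,1,0,1], 2, [0,1]), ([0,2,0,2,0,2,0], 3, [0,1]),
   ([1,0,2,0,1,0,1,0,2,0,2,0], 1, [0,2,0,2]), ([2,0,1,0,1], 1, [2,0]),
   ([0,1,0,1,0,2,0,2,0,2,0], 2, [0,1,0,1,0]), ([0,2,0,1,0,2,0,2,0,1,0,2], 1, [0,2]),
   ([1,0,2,0,2,0,1,0,1], 2, [2,0,1,0,2]), ([1,0,1,0,1,0,2,0,2,0,1,0,2], 3, [2]),
   ([0,1,0,1,0,1,0,1], 1, [1,0,1,0,1]), ([1,0,2,0,1,0,2,0,1,0,1,0,2], 2, [2]),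
   ([1,0,1,0,2], 1, [1,0]), ([0,1,0,2,0,2,0,2], 3, [2,0,1]),
   ([1,0,2,0,1,0,1,0,2], 1, [1,0,2,0]), ([0,1,0,2,0,1,0,2,0,2,0,2], 3, [0,1,0,1]),
   ([0,2,0,2], 2, [2,0,1,0,1]), ([0,2,0,2,0,2,0,1,0,2,0], 2, [0,1,0,1]),
   ([1,0,1,0,2,0,1,0,2,0,1,0], 2, [1,0,2]), ([2,0,1,0,1,0,2,0,2,0,2,0,1], 2, [2,0,1,0,1,0]),
   ([1,0,1,0,2,0,2,0,1,0,2,0], 2, [2,0,2]), ([0,2,0,2,0,1,0,2,0,1,0], 2, [1]),
   ([0,2,0,1,0,1,0,2,0,2,0], 3, [1]), ([0,1,0,1,0,2,0,1,0,1,0], 1, [0,2]),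
   ([2,0,2,0,2,0,1,0,1,0,2,0], 2, [0,1]), ([1,0,2,0,2,0,2,0,1,0,1,0], 3, [0,1]),
   ([2,0,2,0,1,0,1,0], 2, [2,0,1]), ([0,2,0,1,0,2,0,1,0,2,0,2], 4, [1,0,2]),
   ([0,2,0,2,0,1,0,1,0,2,0,1], 2, [1,0,1,0,2,0,2,0]), ([0,1,0,2,0], 1, [0,1]),
   ([1,0,2], 1, [1]), ([1,0,2,0,1,0,2,0,1,0,2], 1, [1,0,2,0,1]),
   ([1,0,2,0,1,0,2], 1, [1,0,2]), ([0], 1, []),
   ([0,1,0,2,0,1,0,2,0], 1, [0,1,0,2]), ([0,1,0,1,0,1,0,2,0,2,0,2,0], 1, [0,1,0,1,0,1]),
   ([0,1,0,2,0,2,0,1,0,2,0,1,0], 4, []), ([1,0,1,0,1,0,2,0,1,0], 4, []),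
   ([2,0,1,0,2,0,2,0,2,0], 4, []), ([0,2,0,2,0,1,0,1,0,2,0,2,0,1], 4, []),
   ([0,2,0,1,0,2,0,1,0], 1, [0,2,0,1]), ([1,0,1,0,1,0,2,0,2,0,2], 1, [1,0,1,0,1]),
   ([0,1,0,1,0,1,0,2,0,1], 4, []), ([1,0,2,0,2,0,1,0,2,0,1], 4, []),
   ([0,1,0,1,0,2,0,2,0,2,0,1,0,1], 4, []), ([0,2,0,1,0,2,0,2,0,2], 4, []),
   ([2,0,1,0,2,0,1], 1, [2,0,1]), ([0,2,0,1,0,2,0,2,0,2,0,1,0,2], 4, []),
   ([0,2,0,2,0,2,0,1,0,2,0,1,0,1], 1, [0,1,0,2,0,2,0,1]), ([2,0,1,0,2,0,1,0,1,0,2], 4, []),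
   ([0,2,0,1,0,2,0,1,0,1,0,2,0], 4, []), ([0,2,0,1,0,1,0,2,0,2,0,1,0,1], 4, []),
   ([0,2,0,2,0,1,0,2,0,1,0,1,0,1], 1, [1,0,2,0,2,0,1]), ([0,1,0,1,0,2,0,2,0,2,0,1,0,2], 1,
     [2,0,2,0,1,0,1]),
   ([2,0,1,0,2,0,2], 4, [1]), ([0,2,0,1,0,2,0,2,0], 2, [1]),
   ([0,1,0,1,0,1,0,2,0,2], 2, [2]), ([1,0,1,0,1,0,2,0,2,0], 2, [0,2]),
   ([1,0,2,0,2,0,1,0,2,0,2], 3, []), ([0,1,0,1,0,1,0,2,0,2,0,2,0,1], 4, [0,1]),
   ([0,1,0,2,0,2,0,1,0,2,0,1,0,1], 1, [1,0,2,0,2,0,2]), ([1,0,1,0,1,0,2,0,1,0,1], 4, [0,1]),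
   ([0,2,0,2,0,1,0,1,0,2,0,2,0,2], 4, []), ([0,2,0,1,0,2,0,1,0,1], 4, [2,0,1,0,1]),
   ([2,0,1,0,2,0,2,0,2,0,1], 4, [1,0,1]), ([0,1,0,1,0,1,0,2,0,1,0,1,0], 4, [1]),
   ([0,2,0,2,0,1,0,2,0,1,0,1,0,2], 1, [2,0,2,0,2,0,1]), ([0,2,0,1,0,1,0,2,0,2,0,1,0,2], 4, [1]),
   ([0,2,0,2,0,2,0,1,0,2,0,1,0,2], 4, []), ([0,2,0,1,0,2,0,2,0,2,0,1,0], 4, [0,1,0,1]),
   ([2,0,1,0,2,0,1,0,1,0], 4, [1,0,1,0,1]), ([1,0,2,0,1,0,2,0,1,0], 4, [0,1,0,1]),
   ([0,1,0,2,0,1], 4, [2]), ([1,0], 4, [2,0,1,0,1]),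
   ([0,1], 4, [1,0,1,0,1]), ([0,1,0,2,0,1,0,2,0,1], 4, [1,0,1]),
   ([1,0,2,0,1,0], 4, [0,2]), ([2,0,2,0,1,0,1,0,2,0], 4, [1]),
   ([2,0,1,0,2,0,1,0,2,0,1], 1, [2,0,1,0,2]), ([0,2,0,2,0,1,0,1,0,2], 2, [1]),
   ([1,0,1,0,2,0,1,0,1,0,2], 2, []), ([0,1,0,2,0,2,0,2,0,1,0,1,0,2], 4, [2]),
   ([0,1,0,1,0,1,0,2,0,1,0,2,0,1], 4, [0,2]), ([1,0,2,0,1,0,2,0,2,0,1], 4, [1]),
   ([0,1,0,2,0,1,0,1,0,1], 4, [1]), ([2,0,1], 1, [2]),
   ([0,1,0,1,0,1], 4, [1,0,1,0,1]), ([0,1,0,2,0,1,0,2,0,1,0,1,0,1], 2, []),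
   ([1,0,2,0,2,0,1], 4, [0,1,0,1]), ([1,0,2,0,1,0,1,0,1,0], 4, [0,1]),
   ([2,0,1,0,2,0,2,0,1,0,1], 4, [0,1]), ([0,2,0,1,0], 1, [0,2]),
   ([0,1,0,2,0,2,0,1,0], 4, [1,0,1]), ([0,1,0,1,0,1,0,2,0,2,0,1,0,1], 2, []),
   ([1,0,1,0,1,0], 4, [2,0,1,0,1]), ([0,2,0,2,0,1,0,2,0,1,0,2,0], 4, [2,0,1,0,1]),
   ([0,2,0,1,0,1,0,2,0,2,0,2,0], 2, [2]), ([2,0,2,0,2,0,1,0,2,0,2], 4, [0,1,0,1]),
   ([0,2,0,2,0,2,0,1,0,2,0,2,0], 4, [1,0,1]), ([2,0,2,0,1,0,2,0,1,0,2], 4, [1,0,1,0,1]),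
   ([2,0,1,0,1,0,2,0,2,0,2], 2, [0,2]), ([0,2,0,2,0,2,0,1,0,2,0,1,0], 2, [1]),
   ([2,0,1,0,2,0,1,0,1,0,1], 2, [1]), ([0,2,0,1,0,2,0,2,0,2,0,1,0,1], 2, [1]),
   ([0,2,0,2,0,1,0,2,0,1,0,1,0], 1, [0,2,0,2,0,1]), ([0,1,0,1,0,1,0,2,0,1,0,1,0,1], 1, [2,0,2,0,2,0,2]),
   ([0,2,0,1,0,1,0,2,0,2,0,1,0], 1, [0,2,0,1,0,1]), ([0,1,0,1,0,2,0,1,0,1,0,1,0], 4, [1,0,1]),
   ([0,1,0,2,0,2,0,1,0,2,0,1,0,2], 4, [2]), ([1,0,1,0,1,0,2,0,1,0,2], 4, [2]),
   ([0,2,0,1,0,2,0,1,0,2], 4, [0,1,0,1]), ([2,0,2,0,1,0,1,0,1,0], 4, []),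
   ([0,2,0,2,0,1,0,1,0,2,0,2,0], 4, [1,0,1,0,1]), ([0,2], 4, [2,0,1,0,1]),
   ([1,0,2,0,1,0,1], 2, [0,2]), ([0,1,0,2,0,1,0,2,0,2], 4, [2,0,1]),
   ([0,1,0,2,0,2], 2, []), ([1,0,2,0,1,0,2,0,1,0,1], 4, [1,0,1,0,1]),
   ([1,0,1], 4, [0,1,0,1]), ([0,2,0,1,0,2,0,2,0,1], 4, [1,0,1]),
   ([0,1,0,1,0,2,0,2,0,2,0,1,0], 4, [2]), ([2,0,1,0,2,0], 2, [2]),
   ([1,0,1,0,1,0,2,0,2,0,1], 4, [0,2]), ([1,0,2,0,2,0,1,0,2,0], 4, [2,0,1,0,1]),
   ([0,1,0,1,0,1,0,2,0], 4, [2,0,1]), ([1,0,2,0,2,0,2,0,1,0], 2, [1]),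
   ([2,0,2,0,2,0,1,0,1,0,1], 1, [2,0,2,0,2]), ([0,1,0,1,0,2,0,1,0], 4, [1]),
   ([0,1,0,1,0,2,0,2,0,1,0,1,0,1], 2, [2]), ([2,0,2,0,1,0], 2, [0,2]),
   ([2,0,1,0,1,0,2,0,1,0,1], 4, []), ([0,2,0,2,0,1,0,2,0], 3, [2]),
   ([0,2,0,1,0,1,0,2,0,1], 4, [0,1,0,1]), ([1,0,1,0,2,0,2,0,1,0,1], 4, [2,0,1,0,1]),
   ([1,0,1,0,2,0,1,0,2,0], 4, [2,0,1]), ([0,1,0,2,0,2,0,2,0,1,0,2,0], 4, [2]),
   ([0,2,0,2,0,2,0,1,0,1], 2, []), ([2,0,1,0,1,0,2], 4, [0,1,0,1]),
   ([2,0,2,0,1,0,2,0,2,0], 4, [2]), ([0,1,0,1,0,2,0,2,0,1], 2, [0,2]),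
   ([0,1,0,2,0,1,0,1,0,2,0,2,0,1], 4, [0,1]), ([1,0,2,0,2,0,1,0,1,0,2], 1, [1,0,2,0,2]),
   ([2,0,2,0,2,0,1], 4, [0,1]), ([0,2,0,2,0,1,0,2,0,2,0,2,0], 4, [1]),
   ([0,2,0,1,0,1,0,1,0], 4, [1]), ([1,0,1,0,2,0,2], 1, [1,0,1]),
   ([0,1,0,2,0,2,0,1,0,1,0,1,0], 2, [0,2]), ([1,0,2,0,1,0,1,0,2,0,2], 4, [2,0,1]),
   ([0,2,0,2,0,2], 4, [2,0,1,0,1]), ([0,1,0,2,0,1,0,1,0,2,0,2,0,2], 1, [2,0,1,0,1,0,1]),
   ([2,0,2,0,2,0,2], 2, [1]), ([1,0,2,0,2,0,1,0,1,0], 4, [1]),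
   ([2,0,2,0,1,0,2,0,2,0,1], 2, []), ([2,0,1,0,1,0], 4, [2]),
   ([0,1,0,1,0,2,0,2,0,2], 4, [0,2]), ([0,2,0,2,0,1,0,2,0,1], 4, [1,0,1,0,1]),
   ([0,2,0,1,0,1,0,2,0,2], 4, [2]), ([1,0,1,0,2,0,2,0,1,0,2], 4, [2,0,1]),
   ([0,1,0,2,0,2,0,2,0,1,0,2,0,1], 1, [1,0,2,0,1,0,1]), ([0,2,0,2,0,2,0,1,0,2], 4, [0,1]),
   ([1,0,1,0,2,0,1,0,2,0,1], 4, [0,1]), ([0,1,0,2,0,1,0,2,0,2,0,2,0], 2, [0,2]),
   ([0,2,0,2,0], 4, [1,0,1]), ([1,0,2,0,1,0,1,0,2,0], 4, [1,0,1,0,1]),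
   ([0,1,0,2,0,2,0,2,0], 4, [2,0,1]), ([0,2,0,2,0,1,0,2,0,2,0,2,0,1], 4, [2]),
   ([1,0,1,0,2,0], 4, []), ([0,1,0,1,0,2,0,1,0,1], 4, [2]),
   ([1,0,2,0,2,0,2,0,1,0,1], 4, [1,0,1]), ([2,0,2,0,2,0,1,0,1,0,2], 4, [2]),
   ([2,0,2,0,1,0,1], 1, [2,0,2]), ([2,0,1,0,1,0,2,0,1,0,2], 4, [1]),
   ([0,2,0,1,0,2,0,1,0,2,0,2,0], 4, [1]), ([0,2,0,1,0,2,0,1,0,1,0,1,0], 4, [1]),
   ([2,0,2,0,2,0,1,0,2,0,1], 3, [1]), ([0,1,0,1,0,2,0,1,0,2,0,1,0,1], 4, [1]),
   ([2,0,1,0,1,0,2,0,2,0,1], 1, [2,0,1,0,1]), ([0,1,0,1,0,2,0,2,0,1,0,2,0,1], 1, [1,0,1,0,1,0,1]),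
   ([2,0,2,0,1,0,2,0,1,0,1], 1, [2,0,2,0,1]), ([1,0,2,0,1,0,2,0,2,0], 4, [2,0,1]),
   ([0,1,0,2,0,1,0,1,0], 2, [2]), ([2,0], 4, [1,0,1,0,1]),
   ([1,0,2,0,2,0], 2, []), ([0,1,0,1,0], 4, [1,0,1]),
   ([0,1,0,2,0,1,0,2,0,1,0,1,0], 4, [2,0,1,0,1]), ([0,1,0,2,0,2,0,2,0,1,0,1,0,1], 4, [2]),
   ([1,0,1,0,2,0,1,0,1,0,1], 4, [0,1,0,1]), ([0,1,0,1,0,1,0,2,0,1,0,2,0], 4, [0,2]),
   ([2,0,2,0,1,0,1,0,2,0,2], 4, [2,0,1,0,1]), ([0,2,0,2,0,1,0,1,0,1], 4, []),
   ([2,0,1,0,2,0,1,0,2,0], 4, [1,0,1]), ([0,1,0,1,0,1,0,2,0,2,0,1,0], 4, [2]),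
   ([0,1,0,2,0,2,0,1,0,2], 4, [1,0,1,0,1]), ([1,0,1,0,1,0,2], 4, [2,0,1]),
   ([1,0,1,0,2,0,2,0,2,0,1], 4, [2]), ([0,2,0,1,0,2], 2, [0,2]),
   ([2,0,1,0,2,0,2,0,1,0], 4, [0,1,0,1]), ([0,1,0,2,0,2,0,2,0,1], 4, [1]),
   ([1,0,1,0,2,0,1], 2, [1]), ([0,2,0,2,0,2,0,1,0,1,0,1,0], 1, [0,2,0,2,0,2]),
   ([0,2,0,2,0,1], 2, [2]), ([0,1,0,2,0,1,0,2,0,2,0,2,0,1], 2, [0,2]),
   ([1,0,2,0,1,0,1,0,2,0,1], 4, []), ([0,2,0,2,0,1,0,2,0,2], 4, [2]),
   ([0,2,0,1,0,1,0,2,0], 4, [1,0,1]), ([1,0,1,0,2,0,2,0,1,0], 2, [2]),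
   ([0,2,0,2,0,2,0,1,0], 4, [1]), ([1,0,1,0,2,0,1,0,2,0,2], 1, [1,0,1,0,2]),
   ([0,1,0,2,0,2,0,2,0,1,0,2,0,2], 4, [1]), ([2,0,2,0,1,0,2], 3, [0,2]),
   ([0,1,0,1,0,2,0,2,0,1,0,1,0], 4, [1,0,1,0,1]), ([2,0,1,0,1,0,2,0,1,0], 4, [1,0,1]),
   ([1,0,2,0,2,0,2,0,1,0,2], 4, [2]), ([0,1,0,1,0,2,0,1,0,2], 4, [2,0,1]),
   ([2,0,2,0,2,0,1,0,1,0], 2, []), ([1,0,2,0,2,0,1,0,1,0,1], 2, [2]),
   ([0,1,0,2,0,1,0,1,0,2,0,2,0], 4, [2,0,1]), ([2,0,2,0,2,0], 4, [1,0,1,0,1]),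
   ([2,0,1,0,1,0,1], 4, [0,1]), ([0,1,0,1,0,2,0,2,0], 1, [0,1,0,1]),
   ([2,0,2,0,1,0,2,0,2,0,2], 4, [0,1]), ([0,1,0,2,0,2,0,1,0,1], 2, [1]),
   ([1,0,1,0,1,0,1], 4, [1]), ([0,1,0,1,0,1,0,2,0,2,0,1,0,2], 1, [0,2,0,1,0,1,0,1]),
   ([2,0,1,0,2,0,2,0,1,0,2], 2, []), ([1,0,1,0,2,0,2,0,2,0], 4, [2]),
   ([0,2,0,1,0,1], 4, [0,2]), ([1,0,2,0,1,0,2,0,2,0,2], 2, [2]),
   ([0,1,0,2,0,1,0,1,0,2], 4, [2,0,1,0,1]), ([2,0,2], 4, [0,1,0,1]),
   ([0,1,0,2,0,1,0,2,0,1,0,1,0,2], 4, [2]), ([1,0,2,0,2,0,2], 4, [2,0,1]),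
   ([0,1,0,1,0,2], 4, []), ([0,1,0,1,0,2,0,2,0,1,0,2,0], 4, [2,0,1]),
   ([2,0,1,0,1,0,2,0,2,0], 4, [0,2]), ([2,0,2,0,1,0,2,0,1,0], 4, [2,0,1,0,1]),
   ([0,2,0,1,0,1,0,2,0,2,0,2,0,1], 1, [0,1,0,2,0,1,0,1]), ([0,1,0,1,0,2,0,1,0,2,0,1,0], 4, [1]),
   ([2,0,2,0,2,0,1,0,2,0], 4, [1]), ([0,2,0,2,0,1,0,1,0], 1, [0,2,0,2]),
   ([2,0,2,0,1,0,1,0,2,0,1], 4, [0,1]), ([2,0,1,0,2,0,1,0,2,0,2], 4, [0,1]),
   ([0,1,0,2,0,2,0,2,0,1,0,1,0], 4, [0,1,0,1]), ([0,2,0,2,0,2,0,1,0,1,0,2,0], 4, [0,2]),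
   ([1,0,1,0,2,0,1,0,1,0], 4, [2])]"

definition base_values :: "nat list \<times> nat \<times> nat list \<Rightarrow> nat \<times> nat"
  where "base_values c = (word (fst c) 1, word (fst c) 19)"

text \<open>Testing the values at 1 and 19 is enough, because \<open>aut_D_eqI\<close> recovers an
  automorphism of D from them.\<close>

lemma certificates_valid: "list_all certified certificates"
  by (simp only: certificates_def list.pred_inject simp_thms)
    (simp add: certified_def target_values_def conj_power_def inv_word_def)

text \<open>The certificates are sorted lexicographically by the images of 1 and 19. One equation of
  lists therefore shows that all 18 * 24 - 1 = 431 pairs occur; \<open>tl\<close> removes the pair
  (1, 19) of the identity.\<close>

lemma certificates_values: "map base_values certificates =
  tl (List.product [1, 2, 3, 4, 5, 6, 7, 8, 9, 10, 11, 12, 13, 14, 15, 16, 17, 18]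
    [19, 20, 21, 22, 23, 24, 25, 26, 27, 28, 29, 30, 31, 32, 33, 34, 35, 36, 37, 38, 39, 40, 41, 42])"
  by (simp only: certificates_def list.map) (simp add: base_values_def)

lemma obtain_certificate:
  assumes "x \<in> {1..18}" and "y \<in> {19..42}" and "(x, y) \<noteq> (1, 19)"
  obtains w k h where "(w, k, h) \<in> set certificates" and "word w 1 = x" and "word w 19 = y"
proof -
  let ?P = "List.product [1..<19] [19..<43]"
  have "?P = (1, 19) # map base_values certificates"
    unfolding certificates_values by (simp add: upt_Cons_num)
  then have P: "set ?P = insert (1, 19) (base_values ` set certificates)"
    by (metis list.set_map list.simps(15))
  have "(x, y) \<in> set ?P"
    unfolding set_product set_upt by (rule SigmaI) (use assms(1,2) in auto)
  then have "(x, y) \<in> base_values ` set certificates"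
    unfolding P using assms(3) by (elim insertE) iprover+
  then obtain c where c: "c \<in> set certificates" "base_values c = (x, y)"
    by (metis imageE)
  obtain w k h where "c = (w, k, h)" by (cases c)
  then show thesis
    using c that[of w k h] unfolding base_values_def by simp
qed

text \<open>The pair (1, 19), absent from the certificates, is supplied by the empty word.\<close>

lemma transitive:
  assumes "x \<in> {1..18}" and "y \<in> {19..42}"
  obtains w where "word w 1 = x" and "word w 19 = y"
  using obtain_certificate[OF assms] word_simps(1) by (metis prod.inject)

section \<open>Invariance of {1..18} under automorphisms of D\<close>

lemma pair_count_commute: "pair_count a b = pair_count b a"
  unfolding pair_count_def covered_def by (simp add: insert_commute conj_commute conj_left_commute)

text \<open>The stabilizer of 19 in G has order 18 = 432 / 24.\<close>

definition stabilizer_words :: "nat list list"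
  where "stabilizer_words =
  [[], [0,1,0,2,0], [2,0,1,0,1], [2,0,2,0,1], [1,0,1,0,1,0,2,0,2], [1,0,1,0,2,0,2,0,2],
   [0,1,0,2,0,2,0,1,0,1], [0,1,0,2,0,2,0,2,0,1], [1,0,2,0,2,0,2,0,1,0], [2,0,2,0,1,0,1,0,2,0],
   [0,2,0,1,0,2,0,1,0,1,0,1,0], [0,2,0,2,0,2,0,1,0,2,0,1,0], [1,0,1,0,1,0,2,0,1,0,1,0,1],
   [1,0,1,0,1,0,2,0,1,0,2,0,1], [1,0,1,0,2,0,2,0,1,0,1,0,1], [1,0,1,0,2,0,2,0,1,0,2,0,1],
   [0,1,0,1,0,2,0,2,0,2,0,1,0,2], [0,1,0,2,0,1,0,1,0,2,0,2,0,2]]"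

lemma stabilizer_words_fix: "list_all (\<lambda>w. word w 19 = 19) stabilizer_words"
  by (simp add: stabilizer_words_def)

text \<open>The points 20, 22 and 25 represent the orbits of the stabilizer of 19 on {20..42}, so
  three pair counts cover all pairs of 19 with a point of this set.\<close>

lemma stabilizer_orbits:
  assumes "z \<in> {20..42}"
  obtains w where "word w 19 = 19" and "z \<in> {word w 20, word w 22, word w 25}"
proof -
  have "list_all (\<lambda>z. list_ex (\<lambda>w. z = word w 20 \<or> z = word w 22 \<or> z = word
    w 25) stabilizer_words)
    [20, 21, 22, 23, 24, 25, 26, 27, 28, 29, 30, 31, 32, 33, 34, 35, 36, 37, 38, 39, 40, 41, 42]"
    by (simp add: stabilizer_words_def)
  moreover have "[20..<43] = [20, 21, 22, 23, 24, 25, 26, 27, 28, 29, 30, 31, 32, 33, 34, 35, 36, 37,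
      38, 39, 40, 41, 42]"
    by (simp add: upt_Cons_num)
  ultimately have "list_all (\<lambda>z. list_ex (\<lambda>w. z = word w 20 \<or> z = word w 22
    \<or> z = word w 25)
      stabilizer_words) [20..<43]"
    by argo
  moreover have "z \<in> set [20..<43]" unfolding set_upt using assms by auto
  ultimately show thesis
    using stabilizer_words_fix that unfolding list_all_iff list_ex_iff by blast
qed

text \<open>Up to automorphisms fixing 19 the second point is 1, 20, 22 or 25, and the counts are 3,
  30, 48 and 36.\<close>

lemma pair_count_19_le:
  assumes "z \<in> {1..42}" and "z \<noteq> 19"
  shows "pair_count 19 z \<noteq> 60"
proof (cases "z \<le> 18")
  case True
  then obtain w where "word w 1 = z" "word w 19 = 19"
    using transitive[of z 19] assms by auto
  then have "pair_count 19 z = pair_count 19 1" by (metis aut_D_word pair_count_aut)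
  then show ?thesis using pair_count_1_19 pair_count_commute[of 19 1] by simp
next
  case False
  then have "z \<in> {20..42}" using assms by auto
  then obtain w where w: "word w 19 = 19" "z \<in> {word w 20, word w 22, word w 25}"
    by (rule stabilizer_orbits)
  have "pair_count 19 (word w x) = pair_count 19 x" for x
    using pair_count_aut[OF aut_D_word, of w 19 x] w(1) by simp
  then show ?thesis
    using w(2) pair_count_19_20 pair_count_19_22 pair_count_19_25 by auto
qed

text \<open>This characterises {1..18} by counts alone, hence invariantly. For a small x the partner
  is the image of 10 under a word taking 1 to x; a point beyond 18 is compared with 19 by
  transitivity.\<close>

lemma small_iff:
  assumes "x \<in> {1..42}"
  shows "x \<le> 18 \<longleftrightarrow> (\<exists>y \<in> {1..42}. y \<noteq> x \<and> pair_count
    x y = 60)"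
proof
  assume "x \<le> 18"
  then obtain w where w: "word w 1 = x" using transitive[of x 19] assms by auto
  have p: "word w permutes {1..42}" using aut_D_word aut_D_permutes by blast
  have "word w 10 \<in> {1..42}" using permutes_in_image[OF p, of 10] by simp
  moreover have "word w 10 \<noteq> x" using w inj_eq[OF permutes_inj[OF p], of 10 1] by auto
  moreover have "pair_count x (word w 10) = 60"
    using pair_count_aut[OF aut_D_word, of w 1 10] w pair_count_1_10 by simp
  ultimately show "\<exists>y \<in> {1..42}. y \<noteq> x \<and> pair_count x y = 60" by blast
next
  assume "\<exists>y \<in> {1..42}. y \<noteq> x \<and> pair_count x y = 60"
  then obtain y where y: "y \<in> {1..42}" "y \<noteq> x" "pair_count x y = 60" by blast
  show "x \<le> 18"
  proof (rule ccontr)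
    assume "\<not> x \<le> 18"
    then obtain w where w: "word w 19 = x" using transitive[of 1 x] assms by auto
    have p: "word w permutes {1..42}" using aut_D_word aut_D_permutes by blast
    obtain z where z: "y = word w z" using permutes_surj[OF p] by (metis surjD)
    have "z \<in> {1..42}" using permutes_in_image[OF p, of z] y(1) z by simp
    moreover have "z \<noteq> 19" using z w y(2) by blast
    moreover have "pair_count 19 z = 60"
      using pair_count_aut[OF aut_D_word, of w 19 z] w z y(3) by simp
    ultimately show False using pair_count_19_le by blast
  qed
qed

lemma aut_D_small:
  assumes "aut_D p"
  shows "p x \<in> {1..18} \<longleftrightarrow> x \<in> {1..18}"
proof -
  have up: "q x \<in> {1..18}" if q: "aut_D q" and x: "x \<in> {1..18}" for q x
  proof -
    have perm: "q permutes {1..42}" using q aut_D_permutes by blast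
    obtain y where y: "y \<in> {1..42}" "y \<noteq> x" "pair_count x y = 60"
      using small_iff[of x] x by auto
    have "q x \<in> {1..42}" "q y \<in> {1..42}"
      using permutes_in_image[OF perm] x y(1) by auto
    moreover have "q y \<noteq> q x" using y(2) inj_eq[OF permutes_inj[OF perm]] by blast
    moreover have "pair_count (q x) (q y) = 60" using pair_count_aut[OF q] y(3) by simp
    ultimately show ?thesis using small_iff[of "q x"] by auto
  qed
  have "inv' p (p x) = x" for x
    using permutes_inverses[OF aut_D_permutes[OF assms]] by simp
  then show ?thesis using up[OF assms] up[OF aut_D_inv[OF assms], of "p x"] by metis
qed

section \<open>An automorphism fixing 1 and 19 is trivial\<close>

definition block_meet :: "nat \<Rightarrow> nat \<Rightarrow> nat set \<Rightarrow> nat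
  \<Rightarrow> nat"
  where "block_meet a b S z = card (S \<inter> \<Union>{K \<in> D. a \<in> K \<and> b \<in> K \<and>
    z \<in> K})"

text \<open>For z outside {a, b} the union in \<open>block_meet\<close> is just the block through a,
  b and z; for z in {a, b} it is the whole star, and all points of S are counted. An automorphism
  fixing a, b and S carries the configuration of z to that of its image.\<close>

lemma block_meet_aut:
  assumes "aut_D p" and "p a = a" and "p b = b" and "p ` S = S"
  shows "block_meet a b S (p z) = block_meet a b S z"
proof -
  have le: "block_meet a b S z \<le> block_meet a b S (q z)"
    if q: "aut_D q" "q a = a" "q b = b" "q ` S = S" for q z
    unfolding block_meet_def
  proof (rule card_inj_on_le)
    show "inj_on q (S \<inter> \<Union>{K \<in> D. a \<in> K \<and> b \<in> K \<and> z \<in> K})"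
      using permutes_inj_on[OF aut_D_permutes[OF q(1)]] .
    show "q ` (S \<inter> \<Union>{K \<in> D. a \<in> K \<and> b \<in> K \<and> z \<in> K}) \<subseteq>
        S \<inter> \<Union>{K \<in> D. a \<in> K \<and> b \<in> K \<and> q z \<in> K}"
    proof
      fix y assume "y \<in> q ` (S \<inter> \<Union>{K \<in> D. a \<in> K \<and> b \<in> K \<and> z
        \<in> K})"
      then obtain x K where x: "y = q x" "x \<in> S" "x \<in> K" and K: "K \<in> D" "a \<in> K" "b
        \<in> K" "z \<in> K"
        by blast
      have "q ` K \<in> D" using K(1) aut_D_image_iff[OF q(1)] by blast
      moreover have "a \<in> q ` K" "b \<in> q ` K" using K(2,3) q(2,3) by (metis imageI)+
      ultimately show "y \<in> S \<inter> \<Union>{K \<in> D. a \<in> K \<and> b \<in> K \<and> q z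
        \<in> K}"
        using x K(4) q(4) by blast
    qed
    have "\<Union>{K \<in> D. a \<in> K \<and> b \<in> K \<and> q z \<in> K} \<subseteq> {1..42}"
      using D_subset by blast
    then show "finite (S \<inter> \<Union>{K \<in> D. a \<in> K \<and> b \<in> K \<and> q z \<in> K})"
      by (meson finite_Int finite_atLeastAtMost finite_subset)
  qed
  note perm = aut_D_permutes[OF assms(1)]
  have inv: "inv' p (p x) = x" for x using permutes_inverses[OF perm] by simp
  have "inv' p ` S = S" using assms(4) image_inv_f_f[OF permutes_inj[OF perm], of S] by argo
  then show ?thesis
    using le[OF assms, of z] le[OF aut_D_inv[OF assms(1)], of "p z"] inv[of a] inv[of b] inv[of z]
      assms(2,3) by simp
qed

definition meet_list :: "nat list list \<Rightarrow> nat list \<Rightarrow> nat \<Rightarrow> nat"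
  where "meet_list Ks S z =
    length (remdups (filter (\<lambda>x. x \<in> set S) (concat (filter (\<lambda>K. z \<in> set K)
      Ks))))"

lemma block_meet_eval:
  assumes "is_star a b Ks"
  shows "block_meet a b (set S) z = meet_list Ks S z"
proof -
  have "{K \<in> D. a \<in> K \<and> b \<in> K \<and> z \<in> K} = {K \<in> set ` set Ks. z \<in> K}"
    using assms unfolding is_star_def by blast
  then have "set S \<inter> \<Union>{K \<in> D. a \<in> K \<and> b \<in> K \<and> z \<in> K} =
      set (filter (\<lambda>x. x \<in> set S) (concat (filter (\<lambda>K. z \<in> set K) Ks)))"
    by auto
  then show ?thesis
    unfolding block_meet_def meet_list_def by (metis length_remdups_card_conv)
qed

text \<open>Level sets of an invariant function are invariant sets and can be used as the set S of a
  further invariant. This is colour refinement with individualised points.\<close>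

definition level_list :: "nat list list \<Rightarrow> nat list \<Rightarrow> nat \<Rightarrow> nat list"
  where "level_list Ks S k = filter (\<lambda>z. meet_list Ks S z = k) points_list"

lemma level_list_invariant:
  assumes "aut_D p" and "p a = a" and "p b = b" and "is_star a b Ks" and "p ` set S = set S"
  shows "p ` set (level_list Ks S k) = set (level_list Ks S k)"
proof -
  note perm = aut_D_permutes[OF assms(1)]
  have "p z \<in> set (level_list Ks S k)" if "z \<in> set (level_list Ks S k)" for z
    using that block_meet_aut[OF assms(1,2,3,5), of z] permutes_in_image[OF perm, of z]
    unfolding level_list_def block_meet_eval[OF assms(4)] by (simp add: set_points_list)
  then show ?thesis
    using endo_inj_surj[of "set (level_list Ks S k)" p] permutes_inj_on[OF perm] by blast
qed

definition small_points :: "nat list"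
  where "small_points = [1, 2, 3, 4, 5, 6, 7, 8, 9, 10, 11, 12, 13, 14, 15, 16, 17, 18]"

lemma set_small_points: "set small_points = {1..18}"
proof -
  have eq: "small_points = [1..<19]" unfolding small_points_def by (simp add: upt_Cons_num)
  show ?thesis unfolding eq set_upt by auto
qed

lemma small_meet_values:
  "map (meet_list star_1_19 small_points) points_list =
   [18, 3, 3, 3, 3, 3, 3, 4, 4, 2, 4, 2, 4, 2, 4, 4, 2, 2, 18, 2, 2, 2, 4, 4, 2, 2, 2, 3, 3,
   2, 2, 2, 2, 2, 3, 2, 2, 2, 3, 3, 3, 2]"
  "map (meet_list star_10_19 small_points) points_list =
   [2, 4, 2, 4, 2, 4, 4, 2, 2, 18, 3, 4, 3, 4, 3, 3, 3, 3, 18, 2, 2, 2, 4, 4, 2, 3, 3, 2, 2,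
   2, 2, 3, 3, 3, 2, 2, 3, 2, 2, 2, 2, 2]"
  by (simp_all add: points_list_def small_points_def meet_list_def star_1_19_eq star_10_19_eq)

lemmas small_meet_simps =
  small_meet_values[unfolded points_list_def, simplified list.map list.inject simp_thms]

lemma level_lists:
  "level_list star_1_19 small_points 2 = [10, 12, 14, 17, 18, 20, 21, 22, 25, 26, 27, 30, 31, 32,
    33, 34, 36, 37, 38, 42]"
  "level_list star_10_19 small_points 2 = [1, 3, 5, 8, 9, 20, 21, 22, 25, 28, 29, 30, 31, 35, 36,
    38, 39, 40, 41, 42]"
  "level_list star_10_19 small_points 4 = [2, 4, 6, 7, 12, 14, 23, 24]"
  by (simp_all add: level_list_def points_list_def small_meet_simps)

text \<open>The three fixed points 1, 10, 19 give three stars; the sets met with them are {1..18}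
  and level sets obtained from it. The seven values separate all points except 22, 25, 30 from one
  another and 23 from 24.\<close>

definition signature :: "nat \<Rightarrow> nat list" where
  "signature z =
   [meet_list star_1_10 small_points z,
    meet_list star_10_19 small_points z,
    meet_list star_1_10 (level_list star_1_19 small_points 2) z,
    meet_list star_10_19 (level_list star_1_19 small_points 2) z,
    meet_list star_1_19 (level_list star_10_19 small_points 2) z,
    meet_list star_1_10 (level_list star_10_19 small_points 4) z,
    meet_list star_1_19 (level_list star_10_19 small_points 4) z]"

lemma signature_aut:
  assumes p: "aut_D p" and fx: "p 1 = 1" "p 10 = 10" "p 19 = 19"
  shows "signature (p z) = signature z"
proof -
  have X: "p ` set small_points = set small_points"
    using aut_D_small[OF p] endo_inj_surj[of "set small_points" p]
      permutes_inj_on[OF aut_D_permutes[OF p]] unfolding set_small_points by blast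
  note L1 = level_list_invariant[OF p fx(1,3) is_star_1_19 X]
  note L2 = level_list_invariant[OF p fx(2,3) is_star_10_19 X]
  have meet: "meet_list Ks S (p z) = meet_list Ks S z"
    if "is_star a b Ks" "p a = a" "p b = b" "p ` set S = set S" for a b Ks S
    using block_meet_aut[OF p that(2-4), of z] unfolding block_meet_eval[OF that(1)] .
  show ?thesis
    unfolding signature_def
    using meet[OF is_star_1_10 fx(1,2)] meet[OF is_star_1_19 fx(1,3)]
      meet[OF is_star_10_19 fx(2,3)] X L1 L2 by simp
qed

lemma signature_values: "map signature points_list =
  [[18,2,20,4,20,8,8], [6,4,2,2,3,2,2], [6,2,2,3,4,2,1], [6,4,1,2,4,2,1], [6,2,3,2,4,1,1],
   [6,4,2,2,4,1,1], [6,4,1,2,3,2,2], [6,2,2,2,2,1,1], [6,2,3,3,2,1,1], [18,18,20,20,4,8,0],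
   [6,3,2,4,2,2,1], [6,4,2,2,2,2,1], [6,3,1,4,2,2,1], [6,4,3,2,3,1,1], [6,3,2,3,2,1,1],
   [6,3,1,3,2,2,1], [6,3,2,4,3,1,0], [6,3,3,4,2,1,0], [2,18,4,20,20,0,8], [2,2,3,3,3,1,1],
   [2,2,3,3,3,1,0], [2,2,4,4,4,0,0], [2,4,3,2,2,1,1], [2,4,3,2,2,1,1], [2,2,4,4,4,0,0],
   [2,3,4,4,3,0,0], [2,3,4,3,2,0,1], [2,2,4,3,4,0,1], [2,2,4,2,3,0,2], [2,2,4,4,4,0,0],
   [2,2,4,3,2,0,0], [2,3,3,3,2,1,0], [2,3,3,4,3,0,1], [2,3,3,4,2,0,1], [2,2,3,2,4,1,1],
   [2,2,4,3,2,0,1], [2,3,3,4,2,1,0], [2,2,4,2,3,0,0], [2,2,3,2,4,0,1], [2,2,3,2,3,1,2],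
   [2,2,3,3,4,0,1], [2,2,4,2,3,0,1]]"
  by (simp only: points_list_def list.map signature_def level_lists)
    (simp add: small_points_def meet_list_def star_1_10_eq star_1_19_eq star_10_19_eq)

lemmas signature_simps =
  signature_values[unfolded points_list_def, simplified list.map list.inject simp_thms]

text \<open>The signature isolates 20, so 20 is fixed as well and the star of 1 and 20 becomes
  available. It resolves the remaining ties: 22, 25, 30 get the values 4, 3, 2, and 23, 24 get 4,
  2.\<close>

lemma last_signature_values: "map (meet_list star_1_20 small_points) points_list =
  [18, 3, 4, 3, 4, 3, 3, 3, 3, 2, 2, 2, 4, 2, 2, 4, 4, 4, 2, 18, 2, 4, 4, 2, 3, 2, 2, 2, 2,
   2, 3, 2, 2, 2, 3, 3, 2, 3, 3, 2, 2, 2]"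
  by (simp add: points_list_def small_points_def meet_list_def star_1_20_eq)

lemmas last_signature_simps =
  last_signature_values[unfolded points_list_def, simplified list.map list.inject simp_thms]

lemma signature_20: "z \<in> {1..42} \<Longrightarrow> signature z = signature 20 \<Longrightarrow>
  z = 20"
proof -
  have "list_all (\<lambda>z. signature z = signature 20 \<longrightarrow> z = 20) points_list"
    by (simp add: points_list_def signature_simps)
  then show "z \<in> {1..42} \<Longrightarrow> signature z = signature 20 \<Longrightarrow> z = 20"
    unfolding list_all_iff set_points_list by blast
qed

lemma signatures_separate:
  assumes "y \<in> {1..42}" and "z \<in> {1..42}" and "signature y = signature z"
    and "meet_list star_1_20 small_points y = meet_list star_1_20 small_points z"
  shows "y = z"
proof -
  have "list_all (\<lambda>z. list_all (\<lambda>y. signature y = signature z \<longrightarrow>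
      meet_list star_1_20 small_points y = meet_list star_1_20 small_points z \<longrightarrow> y = z)
    points_list) points_list"
    by (simp add: points_list_def signature_simps last_signature_simps)
  then show ?thesis
    using assms unfolding list_all_iff set_points_list by blast
qed

lemma blocks_through_1:
  "list_all (\<lambda>B. if list_all (\<lambda>x. x \<le> 18) B then (1 \<in> set B
    \<longrightarrow> 10 \<in> set B) else True) block_list"
  by (simp only: block_list_def list.pred_inject simp_thms) simp

text \<open>Every block inside {1..18} through 1 also passes through 10, and two such blocks meet in
  1 and 10 only. As {1..18} is invariant, p permutes these blocks, so the image of 10 lies on
  both.\<close>

lemma aut_D_fix_10:
  assumes p: "aut_D p" and "p 1 = 1"
  shows "p 10 = 10"
proof -
  have inj: "p x = p y \<longleftrightarrow> x = y" for x y
    using permutes_inj[OF aut_D_permutes[OF p]] by (rule inj_eq)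
  have mem: "set (block_list ! n) \<in> D" if "n < 574" for n
    unfolding D_eq using that length_block_list by (metis imageI nth_mem)
  have ten: "10 \<in> K" if K: "K \<in> D" "K \<subseteq> {1..18}" "1 \<in> K" for K
  proof -
    obtain B where "B \<in> set block_list" "K = set B" using K(1) unfolding D_eq by blast
    moreover from this have "list_all (\<lambda>x. x \<le> 18) B" using K(2) by (auto simp:
      list_all_iff)
    ultimately show ?thesis using blocks_through_1 K(3) unfolding list_all_iff[of _ block_list] by auto
  qed
  have small: "p ` K \<subseteq> {1..18} \<longleftrightarrow> K \<subseteq> {1..18}" for K
    using aut_D_small[OF p] by blast
  have "p 10 \<in> K" if K: "K \<in> D" "K \<subseteq> {1..18}" "1 \<in> K" for K
  proof -
    note perm = aut_D_permutes[OF p]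
    have "p ` inv' p ` K = K" using permutes_surj[OF perm] by (rule image_f_inv_f)
    moreover have "10 \<in> inv' p ` K"
    proof (rule ten)
      show "inv' p ` K \<in> D" using aut_D_image_iff[OF aut_D_inv[OF p]] that(1) by blast
      show "inv' p ` K \<subseteq> {1..18}" using small[of "inv' p ` K"] that(2) calculation by argo
      have "inv' p 1 = 1" using assms(2) permutes_inverses(2)[OF perm, of 1] by simp
      then show "1 \<in> inv' p ` K" using that(3) by (metis imageI)
    qed
    ultimately show ?thesis by (metis imageI)
  qed
  note ten_image = this
  have "{1, 2, 3, 10, 11, 12} \<in> D" "{1, 4, 7, 10, 13, 16} \<in> D"
    using mem[of 0] mem[of 19] by simp_all
  note blocks = this
  have "p 10 \<in> {1, 2, 3, 10, 11, 12}" by (rule ten_image[OF blocks(1)]) simp_all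
  moreover have "p 10 \<in> {1, 4, 7, 10, 13, 16}" by (rule ten_image[OF blocks(2)]) simp_all
  moreover have "p 10 \<noteq> 1" using inj[of 10 1] assms(2) by simp
  ultimately show ?thesis by auto
qed

lemma aut_D_trivial:
  assumes p: "aut_D p" and "p 1 = 1" and "p 19 = 19"
  shows "p = id"
proof
  fix z
  note perm = aut_D_permutes[OF p]
  note sig = signature_aut[OF p assms(2) aut_D_fix_10[OF p assms(2)] assms(3)]
  show "p z = id z"
  proof (cases "z \<in> {1..42}")
    case True
    have pts: "p y \<in> {1..42}" if "y \<in> {1..42}" for y using permutes_in_image[OF perm] that
      by simp
    have fix20: "p 20 = 20" using signature_20[OF pts sig] by simp
    have X: "p ` set small_points = set small_points"
      using aut_D_small[OF p] endo_inj_surj[of "set small_points" p] permutes_inj_on[OF perm]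
      unfolding set_small_points by blast
    have "meet_list star_1_20 small_points (p z) = meet_list star_1_20 small_points z"
      using block_meet_aut[OF p assms(2) fix20 X, of z] unfolding block_meet_eval[OF is_star_1_20] .
    then show ?thesis using signatures_separate[OF pts[OF True] True sig] by simp
  qed (use permutes_not_in[OF perm] in simp)
qed

text \<open>Regularity in the form used from here on: an automorphism is named by its images of 1
  and 19.\<close>

lemma aut_D_eqI:
  assumes "aut_D p" and "aut_D q" and "p 1 = q 1" and "p 19 = q 19"
  shows "p = q"
proof -
  note q = permutes_inverses[OF aut_D_permutes[OF assms(2)]]
  have "inv' q \<circ> p = id"
    using aut_D_trivial[OF aut_D_comp[OF aut_D_inv[OF assms(2)] assms(1)]] assms(3,4) q by simp
  then have "q (inv' q (p x)) = q x" for x by (metis comp_apply id_apply)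
  then show ?thesis using q(1) by auto
qed

section \<open>Extensions of the design\<close>

lemma block_list_in_D: "n < 574 \<Longrightarrow> set (block_list ! n) \<in> D"
  unfolding D_eq using length_block_list by (metis imageI nth_mem)

lemma distinct_block:
  assumes "n < 574"
  shows "distinct (block_list ! n)"
proof -
  have "block_list ! n \<in> set block_list" using assms length_block_list by (metis nth_mem)
  then show ?thesis
    using block_list_sorted unfolding list_all_iff[of _ block_list] strict_sorted_iff by blast
qed

definition hits :: "nat list \<Rightarrow> nat \<Rightarrow> bool"
  where "hits S n \<longleftrightarrow> n < 574 \<and> 4 \<le> length (filter (\<lambda>x. x \<in>
    set S) (block_list ! n))"

locale extension =
  fixes i :: nat and E :: "nat set set"
  assumes i_notin: "i \<notin> {1..42}"
    and steiner: "steiner_system 4 7 43 ({1..42} \<union> {i}, E)"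
    and derived: "derived_design i ({1..42} \<union> {i}, E) = design_D"
begin

lemma block_subset: "B \<in> E \<Longrightarrow> B \<subseteq> {1..42} \<union> {i}"
  and card_block: "B \<in> E \<Longrightarrow> card B = 7"
  using steiner unfolding steiner_system_def by simp_all

lemma finite_block: "B \<in> E \<Longrightarrow> finite B"
  using card_block card.infinite by fastforce

lemma ex_block: "T \<subseteq> {1..42} \<union> {i} \<Longrightarrow> card T = 4 \<Longrightarrow>
  \<exists>B \<in> E. T \<subseteq> B"
  and block_unique: "T \<subseteq> {1..42} \<union> {i} \<Longrightarrow> card T = 4
    \<Longrightarrow> B \<in> E \<Longrightarrow> C \<in> E \<Longrightarrow>
    T \<subseteq> B \<Longrightarrow> T \<subseteq> C \<Longrightarrow> B = C"
  using steiner unfolding steiner_system_def fst_conv snd_conv by metis+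

lemma block_eqI:
  assumes "B \<in> E" and "C \<in> E" and "S \<subseteq> B" and "S \<subseteq> C" and "4 \<le> card S"
  shows "B = C"
proof -
  obtain T where T: "T \<subseteq> S" "card T = 4"
    using obtain_subset_with_card_n[OF assms(5)] by metis
  then have "T \<subseteq> {1..42} \<union> {i}" using assms(1,3) block_subset by blast
  then show ?thesis using block_unique[of T B C] T assms by blast
qed

lemma D_conv: "D = {B - {i} |B. B \<in> E \<and> i \<in> B}"
proof -
  have "blocks (derived_design i ({1..42} \<union> {i}, E)) = D" by (simp only: derived)
  then show ?thesis unfolding derived_design_def snd_conv fst_conv by (rule sym)
qed

lemma insert_D: "K \<in> D \<Longrightarrow> insert i K \<in> E"
  unfolding D_conv by (auto simp: insert_absorb)

lemma remove_D: "B \<in> E \<Longrightarrow> i \<in> B \<Longrightarrow> B - {i} \<in> D"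
  unfolding D_conv by blast

lemma i_notin_D: "K \<in> D \<Longrightarrow> i \<notin> K"
  using D_subset i_notin by blast

text \<open>Four common points would lie in both B and \<open>insert i K\<close>, two blocks of E;
  these would coincide although B misses i.\<close>

lemma meet_D:
  assumes "B \<in> E" and "i \<notin> B" and "K \<in> D" and "S \<subseteq> B" and "S \<subseteq> K"
  shows "card S \<le> 3"
proof (rule ccontr)
  assume "\<not> card S \<le> 3"
  then have "B = insert i K"
    using block_eqI[OF assms(1) insert_D[OF assms(3)] assms(4)] assms(5) by auto
  then show False using assms(2) by blast
qed

lemma no_hit:
  assumes "B \<in> E" and "i \<notin> B" and "set S \<subseteq> B"
  shows "\<not> hits S n"
proof
  assume h: "hits S n"
  then have n: "n < 574" unfolding hits_def by blast
  let ?L = "filter (\<lambda>x. x \<in> set S) (block_list ! n)"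
  have "card (set ?L) = length ?L"
    by (intro distinct_card distinct_filter distinct_block n)
  moreover have "card (set ?L) \<le> 3"
    by (rule meet_D[OF assms(1,2) block_list_in_D[OF n]]) (use assms(3) in auto)
  ultimately show False using h unfolding hits_def by linarith
qed

text \<open>A block of E through i and the three points of S shares four points with
  \<open>insert i K\<close> and equals it, so it cannot contain a point w outside K.\<close>

lemma ex_block_avoiding:
  assumes "K \<in> D" and "S \<subseteq> K" and "card S = 3" and "w \<in> {1..42}" and "w \<notin> K"
  obtains B where "B \<in> E" and "i \<notin> B" and "B \<subseteq> {1..42}" and "insert w S
    \<subseteq> B"
proof -
  have K: "K \<subseteq> {1..42}" using D_subset assms(1) .
  have fin: "finite S" using assms(3) card.infinite by fastforce
  have "card (insert w S) = 4" using assms fin by (subst card_insert_disjoint) auto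
  then obtain B where B: "B \<in> E" "insert w S \<subseteq> B"
    using ex_block[of "insert w S"] assms(2,4) K by blast
  have "i \<notin> B"
  proof
    assume i: "i \<in> B"
    have "i \<notin> S" using K i_notin assms(2) by blast
    then have c: "4 \<le> card (insert i S)" using assms(3) fin by simp
    have "B = insert i K"
      by (rule block_eqI[OF B(1) insert_D[OF assms(1)] _ _ c]) (use assms(2) B i in blast)+
    then show False using B(2) assms(4,5) i_notin by blast
  qed
  moreover have "B \<subseteq> {1..42}" using block_subset[OF B(1)] calculation by blast
  ultimately show thesis using that B by blast
qed

lemma stable_block:
  assumes "(`) p ` E = E" and "B \<in> E" and "S \<subseteq> B" and "S \<subseteq> p ` B" and "4
    \<le> card S"
  shows "p ` B = B"
  by (rule block_eqI[OF _ assms(2,4,3,5)]) (use assms(1,2) in blast)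

end

section \<open>Automorphisms of extensions under powers and conjugation\<close>

definition occurs :: "(nat \<Rightarrow> nat) \<Rightarrow> bool"
  where "occurs p \<longleftrightarrow> (\<exists>i E. extension i E \<and> p permutes {1..42}
    \<and> (`) p ` E = E)"

text \<open>A permutation of {1..42} fixes i, so it permutes the blocks of E through i, and these
  are the blocks of D enlarged by i.\<close>

lemma occurs_aut_D:
  assumes "occurs p"
  shows "aut_D p"
proof -
  obtain i E where ext: "extension i E" and p: "p permutes {1..42}" and E: "(`) p ` E = E"
    using assms unfolding occurs_def by blast
  interpret extension i E by (rule ext)
  have pi: "p i = i" using permutes_not_in[OF p i_notin] .
  show ?thesis
  proof (rule aut_DI[OF p])
    fix K assume K: "K \<in> D"
    have "p ` insert i K \<in> E" using insert_D[OF K] E by blast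
    then have "insert i (p ` K) \<in> E" using pi by simp
    then have "insert i (p ` K) - {i} \<in> D" by (rule remove_D) blast
    moreover have "i \<notin> p ` K"
      using permutes_image[OF p] D_subset[OF K] i_notin by blast
    ultimately show "p ` K \<in> D" by simp
  qed
qed

lemma occurs_power:
  assumes "occurs p"
  shows "occurs (p ^^ k)"
proof -
  obtain i E where ext: "extension i E" and p: "p permutes {1..42}" and E: "(`) p ` E = E"
    using assms unfolding occurs_def by blast
  have "(`) (p ^^ k) ` E = E"
  proof (induction k)
    case (Suc k)
    have "(`) (p ^^ Suc k) ` E = (`) p ` (`) (p ^^ k) ` E"
      by (simp add: image_comp comp_def image_image)
    then show ?case using Suc E by argo
  qed simp
  moreover have "(p ^^ k) permutes {1..42}"
  proof (induction k)
    case 0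
    show ?case unfolding funpow.simps(1) by (rule permutes_id)
  next
    case (Suc k)
    show ?case unfolding funpow.simps(2) by (rule permutes_compose[OF Suc p])
  qed
  ultimately show ?thesis using ext unfolding occurs_def by blast
qed

text \<open>As h fixes i, the derived design of h(E) at i is h(D), which equals D. This is what
  allows an automorphism of an extension to be replaced by a conjugate.\<close>

lemma extension_image:
  assumes ext: "extension i E" and h: "aut_D h"
  shows "extension i ((`) h ` E)"
proof -
  interpret extension i E by (rule ext)
  let ?P = "{1..42} \<union> {i}"
  note perm = aut_D_permutes[OF h]
  note inv = permutes_inverses[OF perm]
  have hi: "h i = i" using permutes_not_in[OF perm i_notin] .
  have P: "h ` S \<subseteq> ?P" if "S \<subseteq> ?P" for S
    using that permutes_image[OF perm] hi by blast
  have permi: "inv' h permutes {1..42}" using permutes_inv[OF perm] .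
  have Pi: "inv' h ` S \<subseteq> ?P" if "S \<subseteq> ?P" for S
    using that permutes_image[OF permi] permutes_not_in[OF permi i_notin] by blast
  have card: "card (h ` S) = card S" "card (inv' h ` S) = card S" for S
    by (rule card_image[OF permutes_inj_on[OF perm]], rule card_image[OF permutes_inj_on[OF permi]])
  have cancel: "inv' h ` h ` S = S" "h ` inv' h ` S = S" for S
    by (rule image_inv_f_f[OF permutes_inj[OF perm]], rule image_f_inv_f[OF permutes_surj[OF perm]])
  show ?thesis
  proof
    show "i \<notin> {1..42}" by (rule i_notin)
    have ex1: "\<exists>!B. B \<in> (`) h ` E \<and> T \<subseteq> B" if T: "T \<subseteq> ?P" "card
      T = 4" for T
    proof -
      note T' = Pi[OF T(1)] card(2)[of T, unfolded T(2)]
      obtain B where B: "B \<in> E" "inv' h ` T \<subseteq> B"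
        using ex_block[OF T'] by (elim bexE)
      have "T \<subseteq> h ` B" using image_mono[OF B(2), of h] unfolding cancel(2) .
      moreover have "C = h ` B" if C: "C \<in> (`) h ` E" "T \<subseteq> C" for C
      proof -
        obtain C' where C': "C' \<in> E" "C = h ` C'" using C(1) by blast
        then have "inv' h ` T \<subseteq> C'" using image_mono[OF C(2), of "inv' h"] cancel(1)[of
          C'] by argo
        then have "C' = B" by (intro block_unique[OF T' C'(1) B(1) _ B(2)])
        then show ?thesis using C'(2) by argo
      qed
      ultimately show ?thesis using B(1) by (intro ex1I[of _ "h ` B"]) auto
    qed
    have blocks: "B \<subseteq> ?P \<and> card B = 7" if B: "B \<in> (`) h ` E" for B
    proof -
      obtain C where "C \<in> E" "B = h ` C" using B by blast
      then show ?thesis using P[OF block_subset] card(1) card_block by simp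
    qed
    show "steiner_system 4 7 43 (?P, (`) h ` E)"
      using steiner ex1 blocks unfolding steiner_system_def fst_conv snd_conv by simp
    have "{B - {i} |B. B \<in> (`) h ` E \<and> i \<in> B} = (`) h ` {B - {i} |B. B \<in> E \<and> i
      \<in> B}"
    proof -
      have diff: "h ` B - {i} = h ` (B - {i})" for B
        using image_set_diff[OF permutes_inj[OF perm], of B "{i}"] hi by simp
      have mem: "i \<in> h ` B \<longleftrightarrow> i \<in> B" for B
        using inj_image_mem_iff[OF permutes_inj[OF perm], of i B] hi by simp
      show ?thesis
      proof (intro equalityI subsetI)
        fix X assume "X \<in> {B - {i} |B. B \<in> (`) h ` E \<and> i \<in> B}"
        then obtain B where "B \<in> E" "X = h ` B - {i}" "i \<in> h ` B" by blast
        then have "B \<in> E" "X = h ` (B - {i})" "i \<in> B" using diff mem by simp_all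
        then show "X \<in> (`) h ` {B - {i} |B. B \<in> E \<and> i \<in> B}" by blast
      next
        fix X assume "X \<in> (`) h ` {B - {i} |B. B \<in> E \<and> i \<in> B}"
        then obtain B where "B \<in> E" "X = h ` (B - {i})" "i \<in> B" by blast
        then have "h ` B \<in> (`) h ` E" "X = h ` B - {i}" "i \<in> h ` B" using diff mem by simp_all
        then show "X \<in> {B - {i} |B. B \<in> (`) h ` E \<and> i \<in> B}" by blast
      qed
    qed
    then have "{B - {i} |B. B \<in> (`) h ` E \<and> i \<in> B} = D"
      using h D_conv unfolding aut_D_def by argo
    then show "derived_design i (?P, (`) h ` E) = design_D"
      using derived D_conv unfolding derived_design_def fst_conv snd_conv by argo
  qed
qed

lemma occurs_conj:
  assumes "occurs p" and h: "aut_D h"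
  shows "occurs (h \<circ> p \<circ> inv' h)"
proof -
  obtain i E where ext: "extension i E" and p: "p permutes {1..42}" and E: "(`) p ` E = E"
    using assms(1) unfolding occurs_def by blast
  note perm = aut_D_permutes[OF h]
  have cancel: "inv' h ` h ` S = S" for S using image_inv_f_f[OF permutes_inj[OF perm]] .
  have img: "(h \<circ> p \<circ> inv' h) ` h ` B = h ` p ` B" for B
    using cancel[of B] by (metis image_comp)
  have "(`) (h \<circ> p \<circ> inv' h) ` (`) h ` E = (`) h ` (`) p ` E"
    by (simp only: image_image[of "(`) (h \<circ> p \<circ> inv' h)"] image_image[of "(`) h"] img)
  then have "(`) (h \<circ> p \<circ> inv' h) ` (`) h ` E = (`) h ` E" using E by argo
  moreover have "h \<circ> p \<circ> inv' h permutes {1..42}"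
    using perm p permutes_inv permutes_compose by metis
  ultimately show ?thesis
    unfolding occurs_def using extension_image[OF ext h] by blast
qed

lemma alpha_cubed: "perm_alpha (perm_alpha (perm_alpha x)) = x"
proof (cases "x \<in> {1..42}")
  case True
  have "list_all (\<lambda>x. perm_alpha (perm_alpha (perm_alpha x)) = x) points_list"
    by (simp only: points_list_def list.pred_inject simp_thms) simp
  then show ?thesis using True unfolding list_all_iff set_points_list by blast
next
  case False
  then show ?thesis using permutes_not_in[OF permutes_alpha] by simp
qed

lemma beta_squared: "perm_beta (perm_beta x) = x"
proof (cases "x \<in> {1..42}")
  case True
  have "list_all (\<lambda>x. perm_beta (perm_beta x) = x) points_list"
    by (simp only: points_list_def list.pred_inject simp_thms) simp
  then show ?thesis using True unfolding list_all_iff set_points_list by blast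
next
  case False
  then show ?thesis using permutes_not_in[OF permutes_beta] by simp
qed

lemma word_inv_word: "word (inv_word w) (word w x) = x"
proof (induction w arbitrary: x)
  case Nil
  then show ?case by (simp add: inv_word_def)
next
  case (Cons k w)
  have "inv_word (k # w) = inv_word w @ [if k = 0 then 0 else if k = 1 then 2 else 1]"
    by (simp add: inv_word_def)
  then have "word (inv_word (k # w)) (word (k # w) x) =
      generator (if k = 0 then 0 else if k = 1 then 2 else 1) (generator k x)"
    using Cons.IH by (simp add: word_append word.simps)
  then show ?case by (simp add: generator_def alpha_cubed beta_squared)
qed

lemma occurs_conj_power:
  assumes "occurs (word w)"
  shows "occurs (conj_power w k h)"
proof -
  note perm = aut_D_permutes[OF aut_D_word[of h]]
  have "word (inv_word h) y = inv' (word h) y" for y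
    using word_inv_word[of h "inv' (word h) y"] permutes_inverses(1)[OF perm, of y] by simp
  then have "conj_power w k h = word h \<circ> (word w ^^ k) \<circ> inv' (word h)"
    unfolding conj_power_def by auto
  then show ?thesis using occurs_conj[OF occurs_power[OF assms] aut_D_word] by simp
qed

section \<open>Elements of order 3\<close>

context extension
begin

lemma card_D: "K \<in> D \<Longrightarrow> card K = 6"
  using card_block[OF insert_D] i_notin_D finite_block[OF insert_D] by fastforce

lemma image_block: "(`) p ` E = E \<Longrightarrow> B \<in> E \<Longrightarrow> p ` B \<in> E"
  by blast

lemma avoids_i: "B \<in> E \<Longrightarrow> i \<notin> B \<Longrightarrow> B \<subseteq> {1..42}"
  using block_subset by blast

lemma image_avoids_i:
  assumes "p permutes {1..42}" and "B \<in> E" and "i \<notin> B"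
  shows "i \<notin> p ` B"
  using image_mono[OF avoids_i[OF assms(2,3)], of p] permutes_image[OF assms(1)] i_notin by blast

text \<open>B shares the invariant 4-set S with its image and is therefore stable. If its other
  three points were all fixed, they and a would be four fixed points.\<close>

lemma order3_block:
  assumes p: "p permutes {1..42}" and E: "(`) p ` E = E"
    and fixed: "card {x \<in> {1..42}. p x = x} \<le> 3"
    and B: "B \<in> E" "i \<notin> B" and S: "S \<subseteq> B" "card S = 4" "p ` S = S"
    and a: "a \<in> S" "p a = a"
  obtains z where "z \<in> {1..42}" and "p z \<noteq> z" and "z \<notin> S" and "{z, p z, p (p z)}
    \<subseteq> B"
proof -
  have BS: "B \<subseteq> {1..42}" using avoids_i[OF B] .
  have stab: "p ` B = B"
    by (rule stable_block[OF E B(1) S(1)]) (use image_mono[OF S(1), of p] S(2,3) in auto)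
  have fin: "finite B" using finite_block[OF B(1)] .
  have "card (B - S) = 3" using S(1, 2) card_block[OF B(1)] fin by (simp add: card_Diff_subset
    finite_subset)
  then have "card (insert a (B - S)) = 4" using a(1) fin by simp
  have "\<exists>z \<in> B - S. p z \<noteq> z"
  proof (rule ccontr)
    assume "\<not> (\<exists>z \<in> B - S. p z \<noteq> z)"
    then have "insert a (B - S) \<subseteq> {x \<in> {1..42}. p x = x}" using BS a S(1) by blast
    then have "card (insert a (B - S)) \<le> card {x \<in> {1..42}. p x = x}"
      by (intro card_mono) simp_all
    then show False using fixed \<open>card (insert a (B - S)) = 4\<close> by linarith
  qed
  then obtain z where z: "z \<in> B" "z \<notin> S" "p z \<noteq> z" by blast
  then have "p z \<in> B" "p (p z) \<in> B" using stab by blast+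
  then show thesis using that[of z] z BS by blast
qed

text \<open>The ten blocks through a 3-cycle \<open>T\<close> partition the other points. Six of them contain a fixed
  point and a second 3-cycle, one comes from the block \<open>K\<close>; hence the block through
    \<open>T\<close> and \<open>u\<close>
  meets every 3-cycle that is not used up in this way, in particular that of \<open>v\<close>.\<close>

lemma order3_transversal:
  assumes p: "p permutes {1..42}" and E: "(`) p ` E = E" and p3: "\<And>x. p (p (p x)) = x"
    and F: "F = {x \<in> {1..42}. p x = x}" "F \<in> D"
    and T: "T = {t, p t, p (p t)}" "T \<subseteq> K" and K: "K \<in> D" "K \<inter> F = {}"
    and u: "u \<in> {1..42}" "u \<notin> K" "u \<notin> F" and v: "v \<in> {1..42}" "v \<notin> K"
      "v \<notin> F"
    and hU: "\<And>B a. B \<in> E \<Longrightarrow> i \<notin> B \<Longrightarrow> a \<in> F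
      \<Longrightarrow> insert a (T \<union> {u, p u, p (p u)}) \<subseteq> B \<Longrightarrow> False"
    and hV: "\<And>B a. B \<in> E \<Longrightarrow> i \<notin> B \<Longrightarrow> a \<in> F
      \<Longrightarrow> insert a (T \<union> {v, p v, p (p v)}) \<subseteq> B \<Longrightarrow> False"
  obtains B y where "B \<in> E" and "i \<notin> B" and "T \<subseteq> B" and "u \<in> B" and "p u
    \<notin> B" and "p (p u) \<notin> B"
    and "y \<in> {v, p v, p (p v)}" and "y \<in> B" and "B \<inter> F = {}" and "B \<inter> K = T"
    and "\<And>x. x \<in> B \<Longrightarrow> x \<notin> T \<Longrightarrow> p x \<notin> B"
proof -
  have inj: "p x = p y \<longleftrightarrow> x = y" for x y using permutes_inj[OF p] by (rule inj_eq)
  have KS: "K \<subseteq> {1..42}" using D_subset[OF K(1)] .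
  have orbit: "x \<noteq> p x \<and> p x \<noteq> p (p x) \<and> x \<noteq> p (p x)" if "x \<in>
    {1..42}" "x \<notin> F" for x
    using that inj p3[of x] F(1) by (metis (mono_tags, lifting) mem_Collect_eq)
  have t: "t \<in> {1..42}" "t \<notin> F" using T K KS by auto
  have cT: "card T = 3" using orbit[OF t] T(1) by simp
  have finT: "finite T" using T(1) by simp
  have pT: "p x \<in> T \<longleftrightarrow> x \<in> T" for x using T(1) p3[of t] inj by auto
  have pTi: "p ` T = T" using T(1) p3[of t] by auto
  have TF: "T \<inter> F = {}" using T(2) K(2) by blast
  \<comment> \<open>T and p x together give four points common to B and its image.\<close>
  have stab: "p ` B = B" if "B \<in> E" "T \<subseteq> B" "x \<in> B" "p x \<in> B" "x \<notin> T"
    for B x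
  proof (rule stable_block[OF E that(1), of "insert (p x) T"])
    show "insert (p x) T \<subseteq> B" using that by blast
    show "insert (p x) T \<subseteq> p ` B" using that(2,3) pTi by blast
    show "4 \<le> card (insert (p x) T)" using cT finT pT[of x] that(5) by simp
  qed
  obtain B where B: "B \<in> E" "i \<notin> B" "B \<subseteq> {1..42}" "insert u T \<subseteq> B"
    using ex_block_avoiding[OF K(1) T(2) cT u(1,2)] by metis
  have TB: "T \<subseteq> B" and uB: "u \<in> B" using B(4) by blast+
  have finB: "finite B" using finite_block[OF B(1)] .
  have uT: "u \<notin> T" using u(2) T(2) by blast
  \<comment> \<open>A fixed point in B makes B stable, so B contains the whole cycle of u, which
    \<open>hU\<close> excludes.\<close>
  have BF: "B \<inter> F = {}"
  proof (rule ccontr)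
    assume "B \<inter> F \<noteq> {}"
    then obtain a where a: "a \<in> B" "a \<in> F" by blast
    have "p a = a" "a \<notin> T" using a F(1) TF by blast+
    then have st: "p ` B = B" using stab[OF B(1) TB, of a] a by simp
    then have "{u, p u, p (p u)} \<subseteq> B" using uB by blast
    then show False using hU[OF B(1,2) a(2)] a TB by blast
  qed
  \<comment> \<open>Otherwise B is stable and contains T and the cycle of u. The one point left over
    would have to be fixed, against \<open>BF\<close>.\<close>
  have step: "p x \<notin> B" if x: "x \<in> B" "x \<notin> T" for x
  proof
    assume "p x \<in> B"
    then have st: "p ` B = B" using stab[OF B(1) TB] x by blast
    let ?U = "{u, p u, p (p u)}"
    have UB: "?U \<subseteq> B" using uB st by blast
    have UT: "?U \<inter> T = {}" using uT pT by auto
    have "card (T \<union> ?U) = 6"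
      using cT finT UT orbit[OF u(1,3)] by (subst card_Un_disjoint) auto
    then have "card (B - (T \<union> ?U)) = 1"
      using TB UB finB card_block[OF B(1)] finT by (subst card_Diff_subset) auto
    then obtain e where e: "B - (T \<union> ?U) = {e}" using card_1_singletonE by blast
    then have eB: "e \<in> B" "e \<notin> T" "e \<notin> ?U" by blast+
    have "p e \<in> B" using eB(1) st by blast
    moreover have "p e \<notin> T" using eB(2) pT by blast
    moreover have "p e \<notin> ?U" using eB(3) inj p3[of u] by (metis insert_iff singletonD)
    ultimately have "p e = e" using e by blast
    then show False using eB(1) B(3) F(1) BF by blast
  qed
  have BK: "B \<inter> K = T"
  proof -
    have "card (B \<inter> K) \<le> 3" by (rule meet_D[OF B(1,2) K(1)]) auto
    then have "T = B \<inter> K"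
      using card_seteq[of "B \<inter> K" T] TB T(2) finB cT by simp
    then show ?thesis by simp
  qed
  have pu: "p u \<notin> B" using step[OF uB uT] .
  have ppu: "p (p u) \<notin> B"
    using step[of "p (p u)"] p3[of u] uB pT uT by auto
  have "\<exists>X. X \<in> E \<and> i \<notin> X \<and> insert a T \<subseteq> X" if "a \<in> F" for a
  proof -
    have "a \<in> {1..42}" "a \<notin> K" using that F(1) K(2) by blast+
    then show ?thesis using ex_block_avoiding[OF K(1) T(2) cT] by metis
  qed
  then obtain X where X: "\<And>a. a \<in> F \<Longrightarrow> X a \<in> E \<and> i \<notin> X a
    \<and> insert a T \<subseteq> X a" by metis
  have Xst: "p ` X a = X a" if "a \<in> F" for a
  proof -
    have "p a = a" "a \<notin> T" using that F(1) TF by blast+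
    then show ?thesis using stab[of "X a" a] X[OF that] by simp
  qed
  \<comment> \<open>At most three fixed points lie in a block missing i, because F is a block of D.
    A block through T with two fixed points thus has a point outside T and F, hence a second
    3-cycle, and 3 + 3 + 2 exceeds 7.\<close>
  have Xinj: "inj_on X F"
  proof (rule inj_onI, rule ccontr)
    fix a b assume ab: "a \<in> F" "b \<in> F" "X a = X b" "a \<noteq> b"
    let ?X = "X a"
    have Xa: "?X \<in> E" "i \<notin> ?X" "T \<subseteq> ?X" "a \<in> ?X" "b \<in> ?X" using X[OF
      ab(1)] X[OF ab(2)] ab(3) by auto
    have fX: "finite ?X" using finite_block[OF Xa(1)] .
    have "card (?X \<inter> F) \<le> 3" by (rule meet_D[OF Xa(1,2) F(2)]) auto
    then have "card (T \<union> ?X \<inter> F) \<le> 6" using card_Un_le[of T "?X \<inter> F"] cT by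
      linarith
    then have "\<not> ?X \<subseteq> T \<union> ?X \<inter> F"
      using card_mono[of "T \<union> ?X \<inter> F" ?X] card_block[OF Xa(1)] fX finT by fastforce
    then obtain z where z: "z \<in> ?X" "z \<notin> T" "z \<notin> F" by blast
    have zz: "z \<in> {1..42}" using avoids_i[OF Xa(1,2)] z(1) by blast
    let ?Z = "{z, p z, p (p z)}"
    have "?Z \<subseteq> ?X" using z(1) Xst[OF ab(1)] by blast
    moreover have "?Z \<inter> T = {}" using z(2) pT by auto
    moreover have "x \<notin> ?Z" if "x \<in> F" for x
    proof
      assume "x \<in> ?Z"
      moreover have "p x = x" using that F(1) by blast
      ultimately have "x = z" using inj by (metis insertE singletonD)
      then show False using that z(3) by blast
    qed
    then have "?Z \<inter> {a, b} = {}" using ab(1,2) by blast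
    moreover have "T \<inter> {a, b} = {}" using TF ab(1,2) by blast
    moreover have "card ?Z = 3" using orbit[OF zz z(3)] by simp
    ultimately have "card (T \<union> ?Z \<union> {a, b}) = 8"
      using cT finT ab(4) by (subst card_Un_disjoint, simp, simp, blast, subst card_Un_disjoint) auto
    moreover have "T \<union> ?Z \<union> {a, b} \<subseteq> ?X" using Xa \<open>?Z \<subseteq>
      ?X\<close> by blast
    ultimately show False using card_mono[OF fX, of "T \<union> ?Z \<union> {a, b}"] card_block[OF
      Xa(1)] by simp
  qed
  have pB: "p ` B \<in> E" "i \<notin> p ` B" and ppB: "p ` p ` B \<in> E" "i \<notin> p ` p ` B"
    using image_block[OF E] image_avoids_i[OF p] B(1,2) by blast+
  have TpB: "T \<subseteq> p ` B" using TB pTi by blast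
  have TppB: "T \<subseteq> p ` p ` B" using image_mono[OF TpB, of p] unfolding pTi .
  have memp: "p x \<in> p ` S \<longleftrightarrow> x \<in> S" for x S using inj by auto
  have u1: "u \<notin> p ` B" using memp[of "p (p u)" B] p3[of u] ppu by simp
  have u2: "u \<notin> p ` p ` B" using memp[of "p (p u)" "p ` B"] memp[of "p u" B] p3[of u] pu by simp
  have u3: "p u \<in> p ` B" "p u \<notin> p ` p ` B" using memp uB u1 by blast+
  have pF: "S \<inter> F = {} \<Longrightarrow> p ` S \<inter> F = {}" for S
    using F(1) inj by (smt (verit) disjoint_iff imageE mem_Collect_eq)
  \<comment> \<open>Any 3-set lies in 40 / 4 = 10 blocks of E. These four and the six blocks
    \<open>X a\<close> are distinct, so they are all the blocks through T, and one of them contains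
    v.\<close>
  define X0 where "X0 = {insert i K, B, p ` B, p ` p ` B}"
  have "insert i K \<noteq> B" "insert i K \<noteq> p ` B" "insert i K \<noteq> p ` p ` B"
    using B(2) pB(2) ppB(2) by blast+
  moreover have "B \<noteq> p ` B" "B \<noteq> p ` p ` B" using uB u1 u2 by blast+
  moreover have "p ` B \<noteq> p ` p ` B" using u3 by blast
  ultimately have "card X0 = 4" unfolding X0_def by (simp del: image_comp image_image)
  moreover have "X0 \<inter> X ` F = {}"
  proof -
    have notin: "a \<notin> insert i K" "a \<notin> B" "a \<notin> p ` B" "a \<notin> p ` p ` B" if
      "a \<in> F" for a
      using that K(2) F(1) i_notin BF pF[OF BF] pF[OF pF[OF BF]] by blast+
    have "X a \<notin> X0" if a: "a \<in> F" for a
      using notin[OF a] X[OF a] unfolding X0_def by (metis emptyE insertE insert_subset)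
    then show ?thesis by blast
  qed
  moreover have "card (X ` F) = 6" using card_image[OF Xinj] card_D[OF F(2)] by simp
  moreover have "finite F" using F(1) by simp
  ultimately have c10: "card (X0 \<union> X ` F) = 10"
    by (subst card_Un_disjoint) (simp_all add: X0_def)
  define C where "C = X0 \<union> X ` F"
  have CE: "Y \<in> E \<and> T \<subseteq> Y" if "Y \<in> C" for Y
    using that insert_D[OF K(1)] T(2) B(1) TB pB(1) TpB ppB(1) TppB X unfolding C_def X0_def by blast
  have disj: "(Y - T) \<inter> (Z - T) = {}" if "Y \<in> C" "Z \<in> C" "Y \<noteq> Z" for Y Z
  proof (rule ccontr)
    assume "(Y - T) \<inter> (Z - T) \<noteq> {}"
    then obtain z where z: "z \<in> Y" "z \<in> Z" "z \<notin> T" by blast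
    have "4 \<le> card (insert z T)" using z(3) cT finT by simp
    then have "Y = Z"
      using block_eqI[of Y Z "insert z T"] CE[OF that(1)] CE[OF that(2)] z by blast
    then show False using that(3) by blast
  qed
  have cY: "card (Y - T) = 4" if "Y \<in> C" for Y
    using CE[OF that] card_block[of Y] cT finT by (simp add: card_Diff_subset)
  have finC: "finite C" unfolding C_def X0_def using \<open>finite F\<close> by simp
  have "card (\<Union>Y \<in> C. Y - T) = (\<Sum>Y \<in> C. card (Y - T))"
    by (rule card_UN_disjoint[OF finC]) (use disj CE finite_block in blast)+
  also have "\<dots> = 40" using cY c10 unfolding C_def[symmetric] by simp
  finally have c40: "card (\<Union>Y \<in> C. Y - T) = 40" .
  have "card (({1..42} \<union> {i}) - T) = 40"
    using T(2) KS cT finT i_notin by (subst card_Diff_subset) auto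
  moreover have "(\<Union>Y \<in> C. Y - T) \<subseteq> ({1..42} \<union> {i}) - T"
    using CE block_subset by blast
  ultimately have "(\<Union>Y \<in> C. Y - T) = ({1..42} \<union> {i}) - T"
    using c40 by (intro card_subset_eq) simp_all
  moreover have "v \<in> ({1..42} \<union> {i}) - T" using v(1,2) T(2) by blast
  ultimately obtain Y where Y: "Y \<in> C" "v \<in> Y" by blast
  have "\<exists>y \<in> {v, p v, p (p v)}. y \<in> B"
  proof -
    consider "Y = insert i K" | "Y = B" | "Y = p ` B" | "Y = p ` p ` B" | a where "a \<in> F" "Y = X a"
      using Y(1) unfolding C_def X0_def by blast
    then show ?thesis
    proof cases
      case 1
      then show ?thesis using Y(2) v(1,2) i_notin by blast
    next
      case 2
      then show ?thesis using Y(2) by blast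
    next
      case 3
      \<comment> \<open>The preimage of v under p is p (p v), and it lies in B.\<close>
      then show ?thesis using Y(2) memp[of "p (p v)" B] p3[of v] by auto
    next
      case 4
      then show ?thesis using Y(2) memp[of "p (p v)" "p ` B"] memp[of "p v" B] p3[of v] by auto
    next
      case 5
      then have "{v, p v, p (p v)} \<subseteq> X a" using Y(2) Xst[OF 5(1)] by blast
      then show ?thesis using hV[of "X a" a] X[OF 5(1)] 5(1) by blast
    qed
  qed
  then obtain y where "y \<in> {v, p v, p (p v)}" "y \<in> B" by blast
  then show thesis using that[of B y] B(1,2) TB uB pu ppu BF BK step by blast
qed

end

lemma list_all2_ex:
  assumes "list_all2 P xs ys" and "x \<in> set xs"
  shows "\<exists>y. P x y"
  using assms by (metis in_set_conv_nth list_all2_nthD)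

lemma cube_id:
  assumes "p permutes {1..42}" and "list_all (\<lambda>x. p (p (p x)) = x) points_list"
  shows "p (p (p x)) = x"
  using assms(2) permutes_not_in[OF assms(1), of x] unfolding list_all_iff set_points_list
  by (cases "x \<in> {1..42}") auto

lemma fixed_points:
  assumes "list_all (\<lambda>x. p x = x \<longleftrightarrow> x \<in> set F) points_list" and "set
    F \<subseteq> {1..42}"
  shows "set F = {x \<in> {1..42}. p x = x}"
  using assms unfolding list_all_iff set_points_list by blast

primrec pairs :: "nat list \<Rightarrow> (nat \<times> nat) list" where
  "pairs [] = []"
| "pairs (x # xs) = map (Pair x) xs @ pairs xs"

lemma in_pairs: "z \<in> set xs \<Longrightarrow> w \<in> set xs \<Longrightarrow> z \<noteq> w
  \<Longrightarrow> (z, w) \<in> set (pairs xs) \<or> (w, z) \<in> set (pairs xs)"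
  by (induction xs) auto

text \<open>\<open>ns\<close> and \<open>ms\<close> are positions of witnesses in D: a dead point
  cannot be added to S, and two live points cannot be added together, since some block of D would
  then be met in four points.\<close>

definition blocked :: "nat list \<Rightarrow> nat list \<Rightarrow> nat list \<Rightarrow> nat list
  \<Rightarrow> nat list \<Rightarrow> bool"
  where "blocked S dead ns live ms \<longleftrightarrow> list_all2 (\<lambda>z n. hits (z # S) n)
    dead ns \<and>
    list_all2 (\<lambda>(z, w) m. hits (z # w # S) m) (pairs live) ms"

context extension
begin

lemma blocked_excludes:
  assumes bl: "blocked S dead ns live ms" and B: "B \<in> E" "i \<notin> B" "set S \<subseteq> B"
    and zw: "z \<in> B" "w \<in> B" "z \<noteq> w"
      "z \<in> set dead \<union> set live" "w \<in> set dead \<union> set live"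
  shows False
proof -
  have "x \<notin> set dead" if "x \<in> B" for x
  proof
    assume "x \<in> set dead"
    then obtain n where "hits (x # S) n"
      using bl unfolding blocked_def by (metis in_set_conv_nth list_all2_nthD)
    then show False using no_hit[OF B(1,2), of "x # S" n] B(3) that by simp
  qed
  then have "z \<in> set live" "w \<in> set live" using zw by blast+
  then obtain q where q: "q \<in> set (pairs live)" "q = (z, w) \<or> q = (w, z)"
    using in_pairs zw(3) by blast
  then obtain m where "hits (fst q # snd q # S) m"
    using bl unfolding blocked_def
    by (metis (mono_tags, lifting) case_prod_beta in_set_conv_nth list_all2_nthD)
  then show False
    using no_hit[OF B(1,2), of "fst q # snd q # S" m] q(2) B(3) zw(1,2) by auto
qed

lemma hits_all_exclude:
  assumes "list_all2 (\<lambda>a n. hits (a # S) n) F ns" and "B \<in> E" and "i \<notin> B" and "a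
    \<in> set F"
    and "insert a (set S) \<subseteq> B"
  shows False
proof -
  obtain n where "hits (a # S) n"
    using assms(1,4) by (metis in_set_conv_nth list_all2_nthD)
  then show False using no_hit[OF assms(2,3), of "a # S" n] assms(5) by simp
qed

text \<open>T, u and y make up at most five of the seven points of B. The others lie in R, since B
  avoids F, meets K in T only, and contains at most one point of each 3-cycle other than T. Two
  points of R are impossible by \<open>bl\<close>.\<close>

lemma order3_excluded:
  assumes p: "p permutes {1..42}" and E: "(`) p ` E = E" and p3: "\<And>x. p (p (p x)) = x"
    and F: "F = {x \<in> {1..42}. p x = x}" "F \<in> D"
    and T: "T = {t, p t, p (p t)}" "T \<subseteq> K" and K: "K \<in> D" "K \<inter> F = {}"
    and u: "u \<in> {1..42}" "u \<notin> K" "u \<notin> F" and v: "v \<in> {1..42}" "v \<notin> K"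
      "v \<notin> F"
    and uv: "u \<notin> {v, p v, p (p v)}"
    and hU: "\<And>B a. B \<in> E \<Longrightarrow> i \<notin> B \<Longrightarrow> a \<in> F
      \<Longrightarrow> insert a (T \<union> {u, p u, p (p u)}) \<subseteq> B \<Longrightarrow> False"
    and hV: "\<And>B a. B \<in> E \<Longrightarrow> i \<notin> B \<Longrightarrow> a \<in> F
      \<Longrightarrow> insert a (T \<union> {v, p v, p (p v)}) \<subseteq> B \<Longrightarrow> False"
    and R: "{1..42} \<subseteq> F \<union> K \<union> {u, p u, p (p u)} \<union> {v, p v, p (p v)}
      \<union> R"
    and bl: "\<And>B y z w. y \<in> {v, p v, p (p v)} \<Longrightarrow> B \<in> E \<Longrightarrow>
      i \<notin> B \<Longrightarrow> insert u (insert y T) \<subseteq> B \<Longrightarrow>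
      z \<in> B \<Longrightarrow> w \<in> B \<Longrightarrow> z \<noteq> w \<Longrightarrow> z \<in>
        R \<Longrightarrow> w \<in> R \<Longrightarrow> False"
  shows False
proof -
  obtain B y where B: "B \<in> E" "i \<notin> B" "T \<subseteq> B" and u': "u \<in> B" "p u \<notin>
    B" "p (p u) \<notin> B"
    and y: "y \<in> {v, p v, p (p v)}" "y \<in> B" and BF: "B \<inter> F = {}" and BK: "B \<inter> K
      = T"
    and step: "\<And>x. x \<in> B \<Longrightarrow> x \<notin> T \<Longrightarrow> p x \<notin> B"
    by (rule order3_transversal[OF p E p3 F T K u v hU hV]) blast+
  have fin: "finite B" using finite_block[OF B(1)] .
  have "card (T \<union> {u, y}) \<le> 5"
    unfolding T(1) by (rule card_insert_le_m1 order_trans[OF card_Un_le] | simp add: card_insert_if)+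
  then have "2 \<le> card (B - (T \<union> {u, y}))"
    using diff_card_le_card_Diff[of "T \<union> {u, y}" B] card_block[OF B(1)] T(1) by simp
  then obtain Z where Z: "Z \<subseteq> B - (T \<union> {u, y})" "card Z = 2"
    by (metis obtain_subset_with_card_n)
  then obtain z w where zw: "z \<noteq> w" "z \<in> B - (T \<union> {u, y})" "w \<in> B - (T
    \<union> {u, y})"
    by (metis card_2_iff insert_subset)
  have "x \<in> R" if x: "x \<in> B" "x \<notin> T" "x \<noteq> u" "x \<noteq> y" for x
  proof -
    have "x \<in> {1..42}" using avoids_i[OF B(1,2)] x(1) by blast
    moreover have "x \<notin> F" "x \<notin> K" using x(1,2) BF BK by blast+
    moreover have "x \<notin> {u, p u, p (p u)}" using x u' by blast
    moreover have "x \<notin> {v, p v, p (p v)}"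
    proof
      assume "x \<in> {v, p v, p (p v)}"
      \<comment> \<open>Two distinct points of a 3-cycle follow one another in one of the two
        orders, which \<open>step\<close> forbids outside T.\<close>
      then have "x = p y \<or> y = p x" using y(1) x(4) p3[of v] by auto
      moreover have "y \<notin> T"
      proof -
        have "p s \<in> T" if "s \<in> T" for s using that T(1) p3[of t] by auto
        then have "v \<in> T" if "y \<in> T" using y(1) that p3[of v] by (metis insertE singletonD)
        then show ?thesis using T(2) v(2) by blast
      qed
      ultimately show False using step x(1,2) y(2) by blast
    qed
    ultimately show ?thesis using R by blast
  qed
  then have "z \<in> R" "w \<in> R" using zw by blast+
  then show False using bl[OF y(1) B(1,2), of z w] B(3) u'(1) y(2) zw by blast
qed

end

text \<open>A block through a fixed point and a 3-cycle contains a second 3-cycle, as only 25, 26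
  and 27 are fixed. For 25 and {24, 33, 41} it must be {1, 2, 4}; for 27 and {1, 2, 4} it must be
  {24, 33, 41}. The two blocks share six points, hence coincide, and contain eight points.\<close>

lemma not_occurs_alpha: "\<not> occurs perm_alpha"
proof
  assume "occurs perm_alpha"
  then obtain i E where ext: "extension i E" and E: "(`) perm_alpha ` E = E"
    unfolding occurs_def by blast
  interpret extension i E by (rule ext)
  have "list_all (\<lambda>x. perm_alpha x = x \<longleftrightarrow> x \<in> set [25, 26, 27])
    points_list"
    by (simp only: points_list_def list.pred_inject simp_thms) simp
  then have "set [25, 26, 27] = {x \<in> {1..42}. perm_alpha x = x}"
    by (rule fixed_points) simp
  then have fixed: "card {x \<in> {1..42}. perm_alpha x = x} \<le> 3"
    by (metis card_length length_Cons list.size(3) numeral_3_eq_3)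
  \<comment> \<open>The 33 listed points fill the eleven 3-cycles other than {1, 2, 4} and {24, 41,
    33}; each of them is excluded below by a block of D.\<close>
  have cover: "z \<in> set [3, 5, 6, 7, 8, 9, 10, 11, 12, 13, 14, 15, 16, 17, 18, 19, 20, 21, 22,
    23, 28, 29, 30, 31,
      32, 34, 35, 36, 37, 38, 39, 40, 42] \<union> {1, 2, 4} \<union> {24, 41, 33}" if "z \<in>
        {1..42}" "perm_alpha z \<noteq> z" for z
  proof -
    have "list_all (\<lambda>z. perm_alpha z \<noteq> z \<longrightarrow> z \<in> set [3, 5, 6, 7,
      8, 9, 10, 11, 12, 13, 14, 15, 16, 17, 18, 19, 20, 21, 22, 23, 28, 29, 30, 31,
      32, 34, 35, 36, 37, 38, 39, 40, 42] \<union> {1, 2, 4} \<union> {24, 41, 33}) points_list"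
      by (simp only: points_list_def list.pred_inject simp_thms) simp
    then show ?thesis using that unfolding list_all_iff set_points_list by blast
  qed
  obtain B where B: "B \<in> E" "i \<notin> B" "B \<subseteq> {1..42}" "insert 25 {24, 33, 41}
    \<subseteq> B"
    by (rule ex_block_avoiding[of "set (block_list ! 524)" "{24, 33, 41}" 25])
      (use block_list_in_D[of 524] in simp_all)
  have cB: "card (insert 25 {24, 33, 41 :: nat}) = 4" by simp
  obtain z where z: "z \<in> {1..42}" "perm_alpha z \<noteq> z" "z \<notin> insert 25 {24, 33, 41}"
      "{z, perm_alpha z, perm_alpha (perm_alpha z)} \<subseteq> B"
    by (rule order3_block[OF permutes_alpha E fixed B(1,2,4) cB, of 25]) auto
  have "z \<notin> set [3, 5, 6, 7, 8, 9, 10, 11, 12, 13, 14, 15, 16, 17, 18, 19, 20, 21, 22, 23,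
    28, 29, 30, 31,
      32, 34, 35, 36, 37, 38, 39, 40, 42]"
  proof
    assume r: "z \<in> set [3, 5, 6, 7, 8, 9, 10, 11, 12, 13, 14, 15, 16, 17, 18, 19, 20, 21, 22,
      23, 28, 29, 30, 31,
      32, 34, 35, 36, 37, 38, 39, 40, 42]"
    have "list_all2 (\<lambda>z n. hits [z, perm_alpha z, perm_alpha (perm_alpha z), 24, 25, 33, 41] n)
      [3, 5, 6, 7, 8, 9, 10, 11, 12, 13, 14, 15, 16, 17, 18, 19, 20, 21, 22, 23, 28, 29, 30, 31,
      32, 34, 35, 36, 37, 38, 39, 40, 42] [414, 262, 262, 414, 262, 414, 463, 463, 262, 463, 524,
        524, 262, 524, 262, 132, 70, 129,
      262, 512, 48, 48, 48, 512, 262, 132, 129, 70, 129, 132, 70, 512, 262]"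
      by (simp add: hits_def)
    from list_all2_ex[OF this r] obtain n
      where "hits [z, perm_alpha z, perm_alpha (perm_alpha z), 24, 25, 33, 41] n" by (elim exE)
    then show False using no_hit[OF B(1,2)] B(4) z(4) by simp
  qed
  then have "z \<in> {1, 2, 4}" using cover[OF z(1,2)] z(3) by auto
  then have sub: "{1, 2, 4} \<subseteq> B" using z(4) by auto
  obtain C where C: "C \<in> E" "i \<notin> C" "C \<subseteq> {1..42}" "insert 27 {1, 2, 4}
    \<subseteq> C"
    by (rule ex_block_avoiding[of "set (block_list ! 1)" "{1, 2, 4}" 27])
      (use block_list_in_D[of 1] in simp_all)
  have cC: "card (insert 27 {1, 2, 4 :: nat}) = 4" by simp
  obtain w where w: "w \<in> {1..42}" "perm_alpha w \<noteq> w" "w \<notin> insert 27 {1, 2, 4}"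
      "{w, perm_alpha w, perm_alpha (perm_alpha w)} \<subseteq> C"
    by (rule order3_block[OF permutes_alpha E fixed C(1,2,4) cC, of 27]) auto
  have "w \<notin> set [3, 5, 6, 7, 8, 9, 10, 11, 12, 13, 14, 15, 16, 17, 18, 19, 20, 21, 22, 23,
    28, 29, 30, 31,
      32, 34, 35, 36, 37, 38, 39, 40, 42]"
  proof
    assume r: "w \<in> set [3, 5, 6, 7, 8, 9, 10, 11, 12, 13, 14, 15, 16, 17, 18, 19, 20, 21, 22,
      23, 28, 29, 30, 31,
      32, 34, 35, 36, 37, 38, 39, 40, 42]"
    have "list_all2 (\<lambda>w n. hits [w, perm_alpha w, perm_alpha (perm_alpha w), 1, 2, 4, 27] n)
      [3, 5, 6, 7, 8, 9, 10, 11, 12, 13, 14, 15, 16, 17, 18, 19, 20, 21, 22, 23, 28, 29, 30, 31,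
      32, 34, 35, 36, 37, 38, 39, 40, 42] [35, 175, 175, 35, 175, 35, 0, 0, 83, 0, 230, 230, 83,
        230, 83, 437, 1, 175, 418, 175, 48,
      48, 48, 175, 418, 437, 175, 1, 175, 437, 1, 175, 418]"
      by (simp add: hits_def)
    from list_all2_ex[OF this r] obtain n
      where "hits [w, perm_alpha w, perm_alpha (perm_alpha w), 1, 2, 4, 27] n" by (elim exE)
    then show False using no_hit[OF C(1,2)] C(4) w(4) by simp
  qed
  then have "w \<in> {24, 41, 33}" using cover[OF w(1,2)] w(3) by auto
  then have "{24, 33, 41} \<subseteq> C" using w(4) by auto
  then have "{1, 2, 4, 24, 33, 41} \<subseteq> B" "{1, 2, 4, 24, 33, 41} \<subseteq> C" using sub
    B(4) C(4) by auto
  then have "B = C" by (rule block_eqI[OF B(1) C(1)]) simp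
  then have "{1, 2, 4, 24, 25, 27, 33, 41} \<subseteq> B" using sub B(4) C(4) by auto
  then have "card {1, 2, 4, 24, 25, 27, 33, 41 :: nat} \<le> card B"
    by (rule card_mono[OF finite_block[OF B(1)]])
  then show False using card_block[OF B(1)] by simp
qed

section \<open>Translations and transvections\<close>

definition translation3 :: "nat \<Rightarrow> nat" where
  "translation3 = word [0, 1, 0, 2, 0, 2, 0, 1, 0, 2, 0, 2]"

lemma translation3_simps [simp]:
    "translation3 1 = 2" "translation3 2 = 3" "translation3 3 = 1"
    "translation3 4 = 5" "translation3 5 = 6" "translation3 6 = 4"
    "translation3 7 = 8" "translation3 8 = 9" "translation3 9 = 7"
    "translation3 10 = 11" "translation3 11 = 12" "translation3 12 = 10"
    "translation3 13 = 14" "translation3 14 = 15" "translation3 15 = 13"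
    "translation3 16 = 17" "translation3 17 = 18" "translation3 18 = 16"
    "translation3 19 = 20" "translation3 20 = 21" "translation3 21 = 19"
    "translation3 22 = 23" "translation3 23 = 24" "translation3 24 = 22"
    "translation3 25 = 26" "translation3 26 = 27" "translation3 27 = 25"
    "translation3 28 = 29" "translation3 29 = 30" "translation3 30 = 28"
    "translation3 31 = 32" "translation3 32 = 33" "translation3 33 = 31"
    "translation3 34 = 35" "translation3 35 = 36" "translation3 36 = 34"
    "translation3 37 = 37" "translation3 38 = 38" "translation3 39 = 39"
    "translation3 40 = 40" "translation3 41 = 41" "translation3 42 = 42"
  by (simp_all add: translation3_def)

lemma aut_D_translation3: "aut_D translation3"
  unfolding translation3_def by (rule aut_D_word)

text \<open>The fixed points form the block {37..42}. The transversal argument is applied to T = {1,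
  2, 3} inside the block {1, 2, 3, 10, 11, 12}, with u = 4 and v = 7; the three cases for y are the
  points 7, 8, 9 of the cycle of v.\<close>

lemma not_occurs_translation3: "\<not> occurs translation3"
proof
  let ?F = "[37, 38, 39, 40, 41, 42] :: nat list"
  assume "occurs translation3"
  then obtain i E where ext: "extension i E" and E: "(`) translation3 ` E = E"
    unfolding occurs_def by blast
  interpret extension i E by (rule ext)
  note p = aut_D_permutes[OF aut_D_translation3]
  have "list_all (\<lambda>x. translation3 (translation3 (translation3 x)) = x) points_list"
    by (simp only: points_list_def list.pred_inject simp_thms) simp
  note p3 = cube_id[OF p this]
  have "list_all (\<lambda>x. translation3 x = x \<longleftrightarrow> x \<in> set ?F) points_list"
    by (simp only: points_list_def list.pred_inject simp_thms) simp
  then have F: "set ?F = {x \<in> {1..42}. translation3 x = x}"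
    by (rule fixed_points) simp
  have FD: "set ?F \<in> D" using block_list_in_D[of 15] by simp
  have KD: "set [1,2,3,10,11,12] \<in> D" using block_list_in_D[of 0] by simp
  have hU: False if "B \<in> E" "i \<notin> B" "a \<in> set ?F" "insert a (set [1, 2, 3] \<union>
    {4, translation3 4, translation3 (translation3 4)}) \<subseteq> B" for B a
  proof (rule hits_all_exclude[OF _ that(1-3)])
    show "list_all2 (\<lambda>a n. hits (a # [1,2,3,4,5,6]) n) ?F [175, 279, 1, 225, 228, 134]"
      by (simp add: hits_def)
    show "insert a (set [1,2,3,4,5,6]) \<subseteq> B" using that(4) by simp
  qed
  have hV: False if "B \<in> E" "i \<notin> B" "a \<in> set ?F" "insert a (set [1, 2, 3] \<union>
    {7, translation3 7, translation3 (translation3 7)}) \<subseteq> B" for B a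
  proof (rule hits_all_exclude[OF _ that(1-3)])
    show "list_all2 (\<lambda>a n. hits (a # [1,2,3,7,8,9]) n) ?F [227, 361, 77, 78, 414, 35]"
      by (simp add: hits_def)
    show "insert a (set [1,2,3,7,8,9]) \<subseteq> B" using that(4) by simp
  qed
  \<comment> \<open>Of the 24 points of R sixteen cannot be added at all; the other eight are
    excluded in all their 28 pairs.\<close>
  have blocked7: "blocked [4,7,1,2,3]
    [13, 16, 19, 20, 21, 22, 23, 24, 26, 27, 28, 29, 31, 32, 35, 36]
    [19, 19, 532, 1, 421, 476, 364, 477, 421, 35, 563, 364, 477, 421, 364, 1]
    [14, 15, 17, 18, 25, 30, 33, 34]
    [57, 290, 240, 234, 290, 146, 57, 81, 283, 283, 487, 148, 57, 380, 330, 290, 380, 2, 283,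
     149, 37, 37, 330, 528, 517, 279, 482, 37]"
    by (simp add: blocked_def hits_def)
  have blocked8: "blocked [4,8,1,2,3]
    [13, 17, 20, 21, 22, 24, 25, 26, 27, 28, 29, 30, 31, 32, 34, 36]
    [34, 34, 1, 275, 476, 325, 517, 476, 275, 563, 325, 78, 275, 527, 325, 1]
    [14, 15, 16, 18, 19, 23, 33, 35]
    [285, 289, 374, 10, 10, 146, 374, 148, 236, 81, 285, 148, 431, 56, 22, 22, 148, 184, 56,
     85, 380, 374, 10, 229, 413, 414, 364, 380]"
    by (simp add: blocked_def hits_def)
  have blocked9: "blocked [4,9,1,2,3]
    [13, 18, 20, 21, 22, 23, 26, 27, 28, 30, 31, 32, 33, 34, 35, 36]
    [7, 7, 1, 412, 476, 414, 476, 54, 412, 482, 563, 54, 414, 482, 530, 1]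
    [14, 15, 16, 17, 19, 24, 25, 29]
    [230, 289, 109, 10, 289, 234, 230, 148, 81, 81, 145, 283, 230, 330, 56, 56, 330, 84, 81,
     189, 330, 535, 56, 407, 532, 560, 325, 234]"
    by (simp add: blocked_def hits_def)
  let ?R = "set [13, 14, 15, 16, 17, 18, 19, 20, 21, 22, 23, 24, 25, 26, 27, 28, 29, 30, 31, 32, 33, 34,
      35, 36]"
  have bl: False if y: "y \<in> {7, translation3 7, translation3 (translation3 7)}" and B: "B \<in>
    E" "i \<notin> B" "insert 4 (insert y (set [1, 2, 3])) \<subseteq> B"
      and zw: "z \<in> B" "w \<in> B" "z \<noteq> w" and R: "z \<in> ?R" "w \<in> ?R" for B y z w
  proof -
    consider "y = 7" | "y = 8" | "y = 9" using y by auto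
    then show False
    proof cases
      case 1
      then show ?thesis
        using R B(3) by (intro blocked_excludes[OF blocked7 B(1,2) _ zw]) auto
    next
      case 2
      then show ?thesis
        using R B(3) by (intro blocked_excludes[OF blocked8 B(1,2) _ zw]) auto
    next
      case 3
      then show ?thesis
        using R B(3) by (intro blocked_excludes[OF blocked9 B(1,2) _ zw]) auto
    qed
  qed
  have "list_all (\<lambda>x. x \<in> set ?F \<union> set [1, 2, 3, 10, 11, 12] \<union> {4,
    translation3 4, translation3 (translation3 4)} \<union> {7, translation3 7, translation3
    (translation3 7)} \<union> ?R) points_list"
    by (simp only: points_list_def list.pred_inject simp_thms) simp
  then have R: "{1..42} \<subseteq> set ?F \<union> set [1, 2, 3, 10, 11, 12] \<union> {4,
    translation3 4, translation3 (translation3 4)} \<union> {7, translation3 7, translation3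
    (translation3 7)} \<union> ?R"
    unfolding list_all_iff set_points_list by blast
  show False
    by (rule order3_excluded[OF p E p3 F FD _ _ KD _ _ _ _ _ _ _ _ _ _ R, where t = 1 and T = "set
      [1, 2, 3]"])
      ((simp; fail)+, (erule (3) hU)[1], (erule (3) hV)[1], (erule (8) bl)[1])
qed

definition transvection3 :: "nat \<Rightarrow> nat" where
  "transvection3 = word [2, 0, 1, 0, 2, 0, 1, 0]"

lemma transvection3_simps [simp]:
    "transvection3 1 = 1" "transvection3 2 = 2" "transvection3 3 = 3"
    "transvection3 4 = 5" "transvection3 5 = 6" "transvection3 6 = 4"
    "transvection3 7 = 9" "transvection3 8 = 7" "transvection3 9 = 8"
    "transvection3 10 = 10" "transvection3 11 = 11" "transvection3 12 = 12"
    "transvection3 13 = 14" "transvection3 14 = 15" "transvection3 15 = 13"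
    "transvection3 16 = 18" "transvection3 17 = 16" "transvection3 18 = 17"
    "transvection3 19 = 26" "transvection3 20 = 27" "transvection3 21 = 25"
    "transvection3 22 = 29" "transvection3 23 = 30" "transvection3 24 = 28"
    "transvection3 25 = 31" "transvection3 26 = 32" "transvection3 27 = 33"
    "transvection3 28 = 34" "transvection3 29 = 35" "transvection3 30 = 36"
    "transvection3 31 = 21" "transvection3 32 = 19" "transvection3 33 = 20"
    "transvection3 34 = 24" "transvection3 35 = 22" "transvection3 36 = 23"
    "transvection3 37 = 38" "transvection3 38 = 39" "transvection3 39 = 37"
    "transvection3 40 = 42" "transvection3 41 = 40" "transvection3 42 = 41"
  by (simp_all add: transvection3_def)

lemma aut_D_transvection3: "aut_D transvection3"
  unfolding transvection3_def by (rule aut_D_word)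

text \<open>Here the fixed points form the block {1, 2, 3, 10, 11, 12}, while T = {37, 38, 39} lies
  in the block {37..42}; the other cycles are those of u = 7 and v = 13.\<close>

lemma not_occurs_transvection3: "\<not> occurs transvection3"
proof
  let ?F = "[1, 2, 3, 10, 11, 12] :: nat list"
  assume "occurs transvection3"
  then obtain i E where ext: "extension i E" and E: "(`) transvection3 ` E = E"
    unfolding occurs_def by blast
  interpret extension i E by (rule ext)
  note p = aut_D_permutes[OF aut_D_transvection3]
  have "list_all (\<lambda>x. transvection3 (transvection3 (transvection3 x)) = x) points_list"
    by (simp only: points_list_def list.pred_inject simp_thms) simp
  note p3 = cube_id[OF p this]
  have "list_all (\<lambda>x. transvection3 x = x \<longleftrightarrow> x \<in> set ?F) points_list"
    by (simp only: points_list_def list.pred_inject simp_thms) simp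
  then have F: "set ?F = {x \<in> {1..42}. transvection3 x = x}"
    by (rule fixed_points) simp
  have FD: "set ?F \<in> D" using block_list_in_D[of 0] by simp
  have KD: "set [37,38,39,40,41,42] \<in> D" using block_list_in_D[of 15] by simp
  have hU: False if "B \<in> E" "i \<notin> B" "a \<in> set ?F" "insert a (set [37, 38, 39] \<union>
    {7, transvection3 7, transvection3 (transvection3 7)}) \<subseteq> B" for B a
  proof (rule hits_all_exclude[OF _ that(1-3)])
    show "list_all2 (\<lambda>a n. hits (a # [37,38,39,7,9,8]) n) ?F [77, 226, 227, 167, 28, 254]"
      by (simp add: hits_def)
    show "insert a (set [37,38,39,7,9,8]) \<subseteq> B" using that(4) by simp
  qed
  have hV: False if "B \<in> E" "i \<notin> B" "a \<in> set ?F" "insert a (set [37, 38, 39] \<union>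
    {13, transvection3 13, transvection3 (transvection3 13)}) \<subseteq> B" for B a
  proof (rule hits_all_exclude[OF _ that(1-3)])
    show "list_all2 (\<lambda>a n. hits (a # [37,38,39,13,14,15]) n) ?F [213, 14, 299, 103, 176, 277]"
      by (simp add: hits_def)
    show "insert a (set [37,38,39,13,14,15]) \<subseteq> B" using that(4) by simp
  qed
  have blocked13: "blocked [7,13,37,38,39]
    [6, 18, 19, 21, 22, 23, 25, 26, 27, 28, 29, 31, 33, 34, 35, 36]
    [142, 142, 14, 499, 445, 28, 213, 167, 491, 14, 438, 491, 28, 438, 167, 213]
    [4, 5, 16, 17, 20, 24, 30, 32]
    [408, 19, 259, 245, 245, 198, 259, 209, 231, 408, 215, 209, 471, 466, 195, 195, 209, 155,
     266, 466, 415, 259, 195, 386, 351, 397, 339, 415]"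
    by (simp add: blocked_def hits_def)
  have blocked14: "blocked [7,14,37,38,39]
    [4, 18, 19, 20, 21, 23, 24, 26, 27, 28, 29, 30, 31, 33, 34, 35]
    [240, 240, 513, 299, 499, 28, 397, 167, 513, 499, 299, 397, 568, 28, 203, 167]
    [5, 6, 16, 17, 22, 25, 32, 36]
    [471, 52, 454, 200, 454, 243, 243, 441, 266, 441, 465, 471, 302, 372, 441, 61, 155, 155,
     369, 369, 259, 372, 369, 509, 166, 357, 213, 155]"
    by (simp add: blocked_def hits_def)
  have blocked15: "blocked [7,15,37,38,39]
    [5, 18, 19, 21, 22, 23, 24, 26, 27, 28, 30, 31, 32, 33, 35, 36]
    [286, 286, 161, 456, 166, 28, 166, 167, 553, 499, 456, 161, 339, 28, 167, 166]
    [4, 6, 16, 17, 20, 25, 29, 34]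
    [465, 490, 242, 408, 465, 495, 408, 18, 266, 266, 249, 249, 119, 138, 195, 61, 61, 490,
     266, 454, 138, 326, 398, 299, 326, 61, 566, 438]"
    by (simp add: blocked_def hits_def)
  let ?R = "set [4, 5, 6, 16, 17, 18, 19, 20, 21, 22, 23, 24, 25, 26, 27, 28, 29, 30, 31, 32, 33,
    34, 35,
      36]"
  have bl: False if y: "y \<in> {13, transvection3 13, transvection3 (transvection3 13)}" and B: "B
    \<in> E" "i \<notin> B" "insert 7 (insert y (set [37, 38, 39])) \<subseteq> B"
      and zw: "z \<in> B" "w \<in> B" "z \<noteq> w" and R: "z \<in> ?R" "w \<in> ?R" for B y z w
  proof -
    consider "y = 13" | "y = 14" | "y = 15" using y by auto
    then show False
    proof cases
      case 1
      then show ?thesis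
        using R B(3) by (intro blocked_excludes[OF blocked13 B(1,2) _ zw]) auto
    next
      case 2
      then show ?thesis
        using R B(3) by (intro blocked_excludes[OF blocked14 B(1,2) _ zw]) auto
    next
      case 3
      then show ?thesis
        using R B(3) by (intro blocked_excludes[OF blocked15 B(1,2) _ zw]) auto
    qed
  qed
  have "list_all (\<lambda>x. x \<in> set ?F \<union> set [37, 38, 39, 40, 41, 42] \<union> {7,
    transvection3 7, transvection3 (transvection3 7)} \<union> {13, transvection3 13, transvection3
    (transvection3 13)} \<union> ?R) points_list"
    by (simp only: points_list_def list.pred_inject simp_thms) simp
  then have R: "{1..42} \<subseteq> set ?F \<union> set [37, 38, 39, 40, 41, 42] \<union> {7,
    transvection3 7, transvection3 (transvection3 7)} \<union> {13, transvection3 13, transvection3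
    (transvection3 13)} \<union> ?R"
    unfolding list_all_iff set_points_list by blast
  show False
    by (rule order3_excluded[OF p E p3 F FD _ _ KD _ _ _ _ _ _ _ _ _ _ R, where t = 37 and T = "set
      [37, 38, 39]"])
      ((simp; fail)+, (erule (3) hU)[1], (erule (3) hV)[1], (erule (8) bl)[1])
qed

section \<open>Involutions\<close>

text \<open>If p has two fixed points, an invariant block of E missing infinity that contains the
  2-cycles of x and y consists of these, a third 2-cycle and one fixed point. \<open>zs\<close>
  supplies representatives of the 2-cycles, \<open>fs\<close> the fixed points.\<close>

primrec candidates :: "(nat \<Rightarrow> nat) \<Rightarrow> nat list \<Rightarrow> nat list
  \<Rightarrow> nat \<Rightarrow> nat \<Rightarrow> nat list list" where
  "candidates p [] fs x y = []"
| "candidates p (z # zs) fs x y =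
    (if z = x \<or> z = y then [] else map (\<lambda>e. [x, p x, y, p y, z, p z, e]) fs) @
      candidates p zs fs x y"

lemma in_candidates:
  "z \<in> set zs \<Longrightarrow> z \<noteq> x \<Longrightarrow> z \<noteq> y \<Longrightarrow> e
    \<in> set fs \<Longrightarrow>
    [x, p x, y, p y, z, p z, e] \<in> set (candidates p zs fs x y)"
  by (induction zs) auto

text \<open>An item consists of two points \<open>x\<close> and \<open>y\<close>, the index of a block of the design containing
  \<open>x\<close>, \<open>p x\<close>, \<open>y\<close> but not \<open>p y\<close>, and for each
    candidate the index of a block meeting it in four
  points, or 574 if there is none.\<close>

fun item_ok :: "(nat \<Rightarrow> nat) \<Rightarrow> nat list \<Rightarrow> nat list \<Rightarrow>
  nat \<times> nat \<times> nat \<times> nat list \<Rightarrow> bool" where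
  "item_ok p zs fs (x, y, n, ms) \<longleftrightarrow>
    n < 574 \<and> x \<in> set (block_list ! n) \<and> p x \<in> set (block_list ! n) \<and> y \<in>
      set (block_list ! n) \<and>
    p y \<notin> set (block_list ! n) \<and> x \<noteq> p x \<and> y \<noteq> x \<and> y \<noteq> p
      x \<and>
    list_all2 (\<lambda>S m. 574 \<le> m \<or> hits S m) (candidates p zs fs x y) ms"

text \<open>A witness of at least 574 is accepted by \<open>item_ok\<close> without any check. This
  is safe, since it merely keeps one more candidate for the search to refute.\<close>

fun survivors :: "(nat \<Rightarrow> nat) \<Rightarrow> nat list \<Rightarrow> nat list
  \<Rightarrow> nat \<times> nat \<times> nat \<times> nat list \<Rightarrow> nat list list" where
  "survivors p zs fs (x, y, n, ms) =
    map fst (filter (\<lambda>q. 574 \<le> snd q) (zip (candidates p zs fs x y) ms))"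

lemma square_id:
  assumes "p permutes {1..42}" and "list_all (\<lambda>x. p (p x) = x) points_list"
  shows "p (p x) = x"
  using assms(2) permutes_not_in[OF assms(1), of x] unfolding list_all_iff set_points_list
  by (cases "x \<in> {1..42}") auto

text \<open>The block through x, p x, y, p y misses infinity because x, p x, y lie on a block of D
  without p y, and it is stable. Its other three points cannot all be among the two fixed points; so
  they contain a 2-cycle, and the last point is fixed.\<close>

lemma (in extension) involution_item:
  assumes p: "p permutes {1..42}" and E: "(`) p ` E = E" and p2: "\<And>x. p (p x) = x"
    and fixed: "set fs = {x \<in> {1..42}. p x = x}" "length fs = 2"
    and reps: "list_all (\<lambda>z. p z = z \<or> z \<in> set zs \<or> p z \<in> set zs) points_list"
    and ok: "item_ok p zs fs it"
  shows "\<exists>S \<in> set (survivors p zs fs it). set S \<in> E"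
proof -
  obtain x y n ms where it: "it = (x, y, n, ms)" by (cases it)
  define K where "K = set (block_list ! n)"
  have n: "n < 574" and KD: "K \<in> D" and xK: "x \<in> K" "p x \<in> K" "y \<in> K" "p y \<notin> K"
    and ne: "x \<noteq> p x" "y \<noteq> x" "y \<noteq> p x"
    and hits: "list_all2 (\<lambda>S m. 574 \<le> m \<or> hits S m) (candidates p zs fs x y) ms"
    using ok block_list_in_D unfolding it K_def by simp_all
  have KS: "K \<subseteq> {1..42}" using D_subset[OF KD] .
  have inj: "p a = p b \<longleftrightarrow> a = b" for a b using permutes_inj[OF p] by (rule inj_eq)
  have py: "p y \<in> {1..42}" using permutes_in_image[OF p, of y] xK(3) KS by blast
  let ?S = "{x, p x, y}"
  have cS: "card ?S = 3" using ne by simp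
  obtain B where B: "B \<in> E" "i \<notin> B" "B \<subseteq> {1..42}" "insert (p y) ?S \<subseteq> B"
    using ex_block_avoiding[OF KD _ cS py xK(4)] xK by (metis empty_subsetI insert_subset)
  let ?Q = "insert (p y) ?S"
  have pQ: "p ` ?Q = ?Q" using p2 by auto
  have pyS: "p y \<notin> ?S" using xK by auto
  have cQ: "card ?Q = 4" using cS pyS by simp
  have QpB: "?Q \<subseteq> p ` B" using image_mono[OF B(4), of p] unfolding pQ .
  have stab: "p ` B = B" by (rule stable_block[OF E B(1,4) QpB]) (simp only: cQ)
  have fB: "finite B" using finite_block[OF B(1)] .
  have c3: "card (B - ?Q) = 3"
    using B(4) cQ card_block[OF B(1)] fB by (subst card_Diff_subset) simp_all
  have mem_image: "p a \<in> p ` A \<longleftrightarrow> a \<in> A" for a A using inj by auto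
  have memQ: "p a \<in> ?Q \<longleftrightarrow> a \<in> ?Q" for a using mem_image[of a ?Q] by (simp
    only: pQ)
  have memB: "p a \<in> B \<longleftrightarrow> a \<in> B" for a using mem_image[of a B] by (simp
    only: stab)
  have "card (set fs) \<le> 2" using fixed(2) card_length[of fs] by simp
  then have "\<not> B - ?Q \<subseteq> set fs"
    using card_mono[of "set fs" "B - ?Q"] c3 by fastforce
  then obtain z where z: "z \<in> B" "z \<notin> ?Q" "z \<notin> set fs" by blast
  then have pz: "p z \<noteq> z" using fixed(1) B(3) by blast
  have "p z \<in> B - ?Q" using z memB memQ by blast
  then have "card (B - ?Q - {z, p z}) = 1"
    using c3 z pz fB by (subst card_Diff_subset) auto
  then obtain e where e: "B - ?Q - {z, p z} = {e}" using card_1_singletonE by blast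
  have eB: "e \<in> B" "e \<notin> ?Q" "e \<noteq> z" "e \<noteq> p z" using e by blast+
  have "p e \<in> B" "p e \<notin> ?Q" using eB(1,2) memB memQ by blast+
  moreover have "p e \<noteq> z" using eB(4) p2[of e] by metis
  moreover have "p e \<noteq> p z" using eB(3) inj by blast
  ultimately have "p e \<in> B - ?Q - {z, p z}" by blast
  then have "p e = e" using e by blast
  moreover have "e \<in> {1..42}" using e B(3) by blast
  ultimately have efs: "e \<in> set fs" using fixed(1) by blast
  have B7: "B = {x, p x, y, p y, z, p z, e}"
    using e B(4) z(1) \<open>p z \<in> B - ?Q\<close> by blast
  have zr: "z \<in> set zs \<or> p z \<in> set zs"
    using reps pz z(1) B(3) unfolding list_all_iff set_points_list by blast
  \<comment> \<open>The point z found in B need not be the chosen representative of its 2-cycle;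
    either choice describes the same block.\<close>
  obtain z' where z': "z' \<in> set zs" "z' \<in> {z, p z}" using zr by blast
  have Bz': "B = {x, p x, y, p y, z', p z', e}"
    using B7 z'(2) p2[of z] by auto
  have "z' \<noteq> x" "z' \<noteq> y" using z'(2) z(2) \<open>p z \<in> B - ?Q\<close> by auto
  then have mem: "[x, p x, y, p y, z', p z', e] \<in> set (candidates p zs fs x y)"
    using z'(1) efs by (intro in_candidates)
  let ?C = "[x, p x, y, p y, z', p z', e]"
  have CB: "set ?C = B" using Bz' by simp
  obtain m where m: "(?C, m) \<in> set (zip (candidates p zs fs x y) ms)" "574 \<le> m \<or> hits ?C m"
  proof -
    obtain j where j: "j < length (candidates p zs fs x y)" "candidates p zs fs x y ! j = ?C"
      using mem by (metis in_set_conv_nth)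
    have "574 \<le> ms ! j \<or> hits ?C (ms ! j)" using list_all2_nthD[OF hits j(1)] j(2) by simp
    moreover have "(?C, ms ! j) \<in> set (zip (candidates p zs fs x y) ms)"
      using j list_all2_lengthD[OF hits] by (metis in_set_zip fst_conv snd_conv)
    ultimately show thesis using that by blast
  qed
  have "\<not> hits ?C m" by (rule no_hit[OF B(1,2)]) (simp only: CB order_refl)
  then have "?C \<in> set (survivors p zs fs it)"
    using m unfolding it by force
  then show ?thesis using CB B(1) by metis
qed

text \<open>Exhaustive search: a node names an item; its children correspond to those members of the
  item that do not clash with the blocks chosen so far.\<close>

datatype search = Search nat "search list"

text \<open>Distinct blocks of E share at most three points. Seven common points are no clash: an
  item may ask again for a block already chosen.\<close>

definition clashes :: "nat list \<Rightarrow> nat list list \<Rightarrow> bool"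
  where "clashes S Cs \<longleftrightarrow> list_ex (\<lambda>C. length C = 7 \<and>
    length (filter (\<lambda>x. x \<in> set S) C) \<in> {4, 5, 6}) Cs"

fun refutes :: "nat list list list \<Rightarrow> nat list list \<Rightarrow> search \<Rightarrow> bool"
  and refutes_each :: "nat list list list \<Rightarrow> nat list list \<Rightarrow> nat list list
    \<Rightarrow> search list \<Rightarrow> bool" where
  "refutes Is Cs (Search k ts) \<longleftrightarrow> k < length Is \<and> refutes_each Is Cs (Is !
    k) ts"
| "refutes_each Is Cs [] ts \<longleftrightarrow> True"
| "refutes_each Is Cs (S # Ss) ts \<longleftrightarrow> (if clashes S Cs then refutes_each Is Cs Ss ts
     else (case ts of [] \<Rightarrow> False | t # us \<Rightarrow> refutes Is (S # Cs) t \<and>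
       refutes_each Is Cs Ss us))"

lemma (in extension) clashes_sound:
  assumes "clashes S Cs" and "\<forall>C \<in> set Cs. set C \<in> E" and "set S \<in> E"
  shows False
proof -
  obtain C where C: "C \<in> set Cs" "length C = 7"
    and m: "4 \<le> length (filter (\<lambda>x. x \<in> set S) C)" "length (filter (\<lambda>x. x
      \<in> set S) C) < 7"
    using assms(1) unfolding clashes_def list_ex_iff by auto
  have CE: "set C \<in> E" using assms(2) C(1) by blast
  have "distinct C" using card_block[OF CE] C(2) by (simp add: card_distinct)
  then have "4 \<le> card (set (filter (\<lambda>x. x \<in> set S) C))"
    using m(1) distinct_card[of "filter (\<lambda>x. x \<in> set S) C"] by simp
  then have "set C = set S"
    by (intro block_eqI[OF CE assms(3), of "set (filter (\<lambda>x. x \<in> set S) C)"]) auto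
  then have "filter (\<lambda>x. x \<in> set S) C = C" by (intro filter_True) simp
  then show False using m(2) C(2) by simp
qed

text \<open>Each item contains at least one block of E. A node is contradictory once every member of
  its item clashes with the chosen blocks or is refuted after being added to them.\<close>

lemma (in extension) refutes_sound:
  assumes items: "\<forall>Ss \<in> set Is. \<exists>S \<in> set Ss. set S \<in> E"
  shows "refutes Is Cs t \<Longrightarrow> \<forall>C \<in> set Cs. set C \<in> E \<Longrightarrow>
    False"
    and "refutes_each Is Cs Ss ts \<Longrightarrow> \<forall>C \<in> set Cs. set C \<in> E
      \<Longrightarrow> \<forall>S \<in> set Ss. set S \<notin> E"
  using items
proof (induction Is Cs t and Is Cs Ss ts rule: refutes_refutes_each.induct)
  case (1 Is Cs k ts)
  have k: "k < length Is" "refutes_each Is Cs (Is ! k) ts" using 1(2) by simp_all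
  have "\<exists>S \<in> set (Is ! k). set S \<in> E" using 1(4) nth_mem[OF k(1)] by blast
  then show ?case using 1(1)[OF k(2) 1(3,4)] by blast
next
  case (3 Is Cs S Ss ts)
  show ?case
  proof (cases "clashes S Cs")
    case True
    then show ?thesis using 3 clashes_sound[OF True] by auto
  next
    case False
    then obtain t us where ts: "ts = t # us" "refutes Is (S # Cs) t" "refutes_each Is Cs Ss us"
      using 3(4) by (auto split: list.splits)
    have "set S \<notin> E" using 3(2)[OF False ts(1) ts(2)] 3(5,6) by auto
    moreover have "\<forall>S \<in> set Ss. set S \<notin> E" using 3(3)[OF False ts(1) ts(3)] 3(5,
      6) by blast
    ultimately show ?thesis by simp
  qed
qed simp

lemma not_occurs_involution:
  assumes aut: "aut_D p" and sq: "list_all (\<lambda>x. p (p x) = x) points_list"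
    and fixed: "list_all (\<lambda>x. p x = x \<longleftrightarrow> x \<in> set fs) points_list"
      "set fs \<subseteq> {1..42}" "length fs = 2"
    and reps: "list_all (\<lambda>z. p z = z \<or> z \<in> set zs \<or> p z \<in> set zs) points_list"
    and items: "list_all (item_ok p zs fs) its"
    and search: "refutes (map (survivors p zs fs) its) [] t"
  shows "\<not> occurs p"
proof
  assume "occurs p"
  then obtain i E where ext: "extension i E" and E: "(`) p ` E = E"
    unfolding occurs_def by blast
  interpret extension i E by (rule ext)
  note p = aut_D_permutes[OF aut]
  have "\<exists>S \<in> set (survivors p zs fs it). set S \<in> E" if "it \<in> set its" for it
    by (rule involution_item[OF p E square_id[OF p sq] fixed_points[OF fixed(1,2)] fixed(3) reps])
      (use items that in \<open>simp add: list_all_iff\<close>)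
  then have "\<forall>Ss \<in> set (map (survivors p zs fs) its). \<exists>S \<in> set Ss. set S
    \<in> E" by simp
  from refutes_sound(1)[OF this search] show False by simp
qed

section \<open>Certificates for the two classes of involutions\<close>

definition items_beta :: "(nat \<times> nat \<times> nat \<times> nat list) list" where
  "items_beta =
   [(21, 38, 200, [456, 574, 24, 24, 445, 445, 428, 428, 193, 193, 302, 302, 445, 445, 193, 193,
     428, 428,
      5, 5, 5, 5, 358, 358, 302, 131, 490, 33, 445, 445, 358, 131, 456, 33, 15, 15]),
    (19, 38, 154, [568, 568, 14, 574, 383, 383, 209, 490, 209, 231, 118, 118, 14, 231, 568, 568,
      118, 118,
      5, 5, 5, 5, 454, 172, 98, 98, 490, 33, 14, 172, 568, 568, 98, 33, 15, 15]),
    (19, 41, 154, [574, 570, 27, 27, 383, 383, 27, 27, 231, 231, 118, 118, 231, 231, 494, 251, 118,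
      118, 5,
      5, 5, 5, 217, 570, 98, 98, 27, 27, 217, 450, 219, 494, 98, 98, 15, 15]),
    (21, 41, 200, [496, 496, 24, 24, 574, 403, 428, 403, 193, 193, 496, 496, 450, 399, 193, 193,
      265, 265,
      5, 5, 5, 5, 217, 358, 496, 496, 169, 403, 217, 450, 358, 358, 169, 265, 15, 15]),
    (20, 38, 245, [63, 63, 339, 339, 254, 574, 195, 195, 215, 454, 215, 235, 195, 195, 235, 235,
      339, 339,
      5, 5, 5, 5, 454, 172, 302, 131, 72, 72, 72, 72, 254, 131, 339, 339, 15, 15]),
    (20, 41, 245, [63, 63, 574, 305, 212, 212, 195, 195, 212, 212, 235, 235, 195, 195, 235, 235,
      265, 257,
      5, 5, 5, 5, 212, 212, 219, 305, 72, 72, 72, 72, 219, 494, 169, 265, 15, 15]),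
    (28, 38, 135, [292, 292, 14, 574, 86, 86, 135, 135, 215, 197, 135, 135, 14, 445, 135, 135, 341,
      341, 14,
      172, 72, 72, 445, 445, 86, 86, 31, 31, 72, 72, 574, 574, 574, 574, 15, 15]),
    (30, 38, 415, [456, 574, 339, 339, 87, 87, 209, 155, 209, 415, 302, 302, 415, 155, 313, 313,
      265, 265,
      98, 33, 339, 339, 456, 33, 314, 314, 98, 98, 381, 33, 574, 574, 574, 574, 15, 15]),
    (29, 38, 138, [248, 248, 12, 12, 254, 574, 105, 105, 105, 105, 302, 249, 438, 438, 254, 494,
      105, 105,
      568, 568, 254, 131, 358, 131, 358, 249, 248, 131, 73, 73, 574, 574, 574, 574, 15, 15])]"

text \<open>Items 0, 1 and 4 force blocks that join {38, 39} to {1, 10}, {2, 11} and {3, 12}. The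
  2-cycles {28, 33}, {29, 31}, {30, 32} must then be matched among themselves by blocks through {38,
  39}, which is impossible for three of them.\<close>

definition search_beta :: search where
  "search_beta =
   Search 0 [Search 1 [Search 2 [Search 3 [Search 4 [Search 5 [Search 6 [Search 7 [], Search 7 [],
   Search 8 [], Search 8 []]]]]]]]"

lemma survivors_beta: "map (survivors perm_beta [1, 2, 3, 4, 5, 6, 7, 8, 9, 19, 20, 21, 25, 26, 27,
  28, 29, 30, 38, 41] [37, 40]) items_beta =
   [[[21,22,38,39,1,10,40]],
    [[19,23,38,39,2,11,40]],
    [[19,23,41,42,1,10,37]],
    [[21,22,41,42,3,12,37]],
    [[20,24,38,39,3,12,40]],
    [[20,24,41,42,2,11,37]],
    [[28,33,38,39,2,11,40],
     [28,33,38,39,29,31,37],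
     [28,33,38,39,29,31,40],
     [28,33,38,39,30,32,37],
     [28,33,38,39,30,32,40]],
    [[30,32,38,39,1,10,40],
     [30,32,38,39,28,33,37],
     [30,32,38,39,28,33,40],
     [30,32,38,39,29,31,37],
     [30,32,38,39,29,31,40]],
    [[29,31,38,39,3,12,40],
     [29,31,38,39,28,33,37],
     [29,31,38,39,28,33,40],
     [29,31,38,39,30,32,37],
     [29,31,38,39,30,32,40]]]"
  by (simp add: items_beta_def)

lemma not_occurs_beta: "\<not> occurs perm_beta"
proof (rule not_occurs_involution)
  show "refutes (map (survivors perm_beta [1, 2, 3, 4, 5, 6, 7, 8, 9, 19, 20, 21, 25, 26, 27, 28,
    29, 30, 38, 41] [37, 40]) items_beta) [] search_beta"
    unfolding survivors_beta by (simp add: search_beta_def clashes_def)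
  show "list_all (item_ok perm_beta [1, 2, 3, 4, 5, 6, 7, 8, 9, 19, 20, 21, 25, 26, 27, 28, 29, 30,
    38, 41] [37, 40]) items_beta"
    by (simp only: items_beta_def list.pred_inject simp_thms)
      (simp add: hits_def)
qed (simp_all add: points_list_def aut_D_generator[of 0, unfolded generator_def, simplified])

definition involution2 :: "nat \<Rightarrow> nat" where
  "involution2 = word [0, 1, 0, 2, 0, 1, 0, 2, 0, 1, 0, 2]"

lemma involution2_simps [simp]:
    "involution2 1 = 1" "involution2 2 = 3" "involution2 3 = 2"
    "involution2 4 = 7" "involution2 5 = 9" "involution2 6 = 8"
    "involution2 7 = 4" "involution2 8 = 6" "involution2 9 = 5"
    "involution2 10 = 10" "involution2 11 = 12" "involution2 12 = 11"
    "involution2 13 = 16" "involution2 14 = 18" "involution2 15 = 17"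
    "involution2 16 = 13" "involution2 17 = 15" "involution2 18 = 14"
    "involution2 19 = 22" "involution2 20 = 24" "involution2 21 = 23"
    "involution2 22 = 19" "involution2 23 = 21" "involution2 24 = 20"
    "involution2 25 = 30" "involution2 26 = 29" "involution2 27 = 28"
    "involution2 28 = 27" "involution2 29 = 26" "involution2 30 = 25"
    "involution2 31 = 36" "involution2 32 = 35" "involution2 33 = 34"
    "involution2 34 = 33" "involution2 35 = 32" "involution2 36 = 31"
    "involution2 37 = 40" "involution2 38 = 42" "involution2 39 = 41"
    "involution2 40 = 37" "involution2 41 = 39" "involution2 42 = 38"
  by (simp_all add: involution2_def)

lemma aut_D_involution2: "aut_D involution2"
  unfolding involution2_def by (rule aut_D_word)

definition items_involution2 :: "(nat \<times> nat \<times> nat \<times> nat list) list" where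
  "items_involution2 =
   [(5, 38, 280, [468, 574, 109, 109, 280, 280, 80, 108, 80, 192, 53, 53, 109, 109, 6, 6, 280, 280, 108,
      108, 574, 574, 468, 574, 280, 280, 6, 6, 468, 509, 192, 192, 15, 15, 15, 15]),
    (25, 39, 130, [574, 574, 240, 240, 574, 574, 427, 427, 427, 427, 47, 514, 240, 240, 456, 520, 3,
      3, 32,
      32, 16, 16, 16, 16, 32, 32, 130, 130, 47, 314, 130, 130, 15, 15, 15, 15]),
    (2, 27, 35, [35, 35, 175, 574, 21, 21, 0, 0, 21, 21, 283, 374, 81, 81, 81, 13, 72, 13, 175, 344, 48,
      48, 48, 48, 35, 13, 374, 374, 72, 72, 175, 574, 35, 35, 574, 574]),
    (5, 31, 105, [82, 82, 60, 60, 224, 574, 60, 60, 82, 82, 53, 53, 141, 332, 6, 6, 224, 338, 108,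
      68, 224,
      574, 105, 105, 574, 574, 30, 30, 30, 30, 332, 332, 6, 6, 105, 68]),
    (6, 39, 174, [413, 574, 174, 174, 143, 143, 106, 427, 143, 143, 106, 235, 75, 75, 413, 496, 235,
      121,
      16, 16, 427, 427, 16, 16, 174, 121, 574, 574, 413, 574, 174, 174, 15, 15, 15, 15]),
    (27, 32, 269, [374, 374, 242, 242, 574, 574, 574, 574, 310, 324, 45, 426, 374, 324, 242, 242,
      99, 99,
      72, 72, 11, 11, 48, 48, 48, 48, 30, 30, 30, 30, 45, 314, 170, 170, 170, 170]),
    (31, 37, 219, [574, 574, 60, 60, 332, 332, 574, 574, 60, 60, 206, 529, 304, 315, 332, 315, 6, 6,
      63, 63,
      171, 171, 206, 314, 31, 31, 31, 31, 30, 30, 30, 30, 6, 6, 15, 15]),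
    (2, 20, 78, [1, 574, 189, 189, 78, 78, 0, 0, 84, 84, 85, 235, 81, 81, 5, 5, 5, 5, 78, 78, 84,
      84, 72,
      13, 1, 13, 374, 264, 72, 72, 63, 63, 574, 574, 1, 574]),
    (4, 37, 408, [476, 574, 332, 332, 142, 142, 23, 60, 19, 19, 142, 142, 23, 242, 476, 574, 63, 63,
      574,
      574, 314, 66, 476, 167, 242, 66, 60, 60, 314, 167, 408, 66, 15, 15, 15, 15]),
    (21, 38, 51, [574, 574, 574, 574, 108, 108, 288, 288, 108, 108, 288, 103, 542, 365, 94, 103, 5,
      5, 5,
      5, 51, 51, 16, 16, 51, 51, 6, 6, 11, 11, 17, 17, 15, 15, 15, 15]),
    (4, 32, 421, [364, 364, 375, 375, 474, 574, 60, 60, 19, 19, 57, 240, 57, 242, 574, 574, 474,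
      574, 11,
      11, 314, 29, 364, 167, 242, 242, 30, 29, 30, 30, 314, 167, 474, 29, 240, 167]),
    (4, 5, 408, [574, 574, 574, 574, 60, 9, 19, 19, 53, 53, 242, 111, 77, 574, 408, 111, 108, 108, 482,
      574, 105, 9, 77, 9, 60, 60, 375, 375, 192, 192, 332, 332, 109, 109, 77, 105]),
    (6, 26, 531, [84, 84, 110, 110, 359, 574, 110, 110, 83, 84, 83, 235, 75, 75, 416, 416, 235, 235, 16,
      16, 48, 48, 48, 48, 248, 248, 574, 574, 359, 574, 359, 348, 288, 288, 16, 16]),
    (20, 26, 49, [84, 84, 574, 574, 574, 574, 235, 235, 4, 8, 84, 8, 235, 235, 384, 272, 5, 5, 4, 5, 48,
      48, 48, 48, 49, 49, 49, 49, 4, 72, 63, 63, 131, 8, 16, 16]),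
    (19, 33, 217, [81, 81, 574, 574, 192, 192, 574, 574, 301, 136, 192, 36, 91, 36, 81, 81, 5, 5, 5,
      5, 3,
      3, 132, 36, 72, 72, 6, 6, 30, 30, 33, 33, 6, 6, 33, 33]),
    (2, 33, 414, [37, 37, 192, 192, 279, 574, 0, 0, 2, 84, 37, 37, 2, 81, 81, 81, 72, 72, 414, 344, 279,
      264, 84, 84, 72, 72, 2, 30, 30, 30, 574, 574, 279, 574, 292, 292]),
    (2, 4, 563, [574, 574, 574, 574, 0, 0, 19, 19, 240, 10, 81, 81, 81, 10, 1, 574, 364, 10, 330,
      330, 84,
      84, 35, 35, 1, 35, 364, 364, 37, 37, 476, 574, 35, 35, 1, 107]),
    (5, 19, 407, [81, 81, 77, 574, 238, 238, 108, 108, 145, 192, 53, 53, 81, 81, 5, 5, 5, 5, 3, 3, 574,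
      574, 77, 574, 6, 6, 278, 278, 192, 192, 332, 332, 6, 6, 77, 68]),
    (6, 21, 419, [285, 285, 55, 574, 108, 108, 22, 108, 22, 288, 235, 235, 75, 75, 5, 5, 5, 5, 427, 348,
      16, 16, 55, 121, 55, 574, 11, 11, 574, 574, 173, 173, 288, 288, 16, 16]),
    (4, 38, 465, [35, 35, 109, 109, 288, 288, 23, 60, 19, 19, 109, 109, 23, 107, 6, 6, 195, 195,
      574, 574,
      410, 29, 574, 574, 242, 242, 6, 6, 474, 29, 574, 574, 15, 15, 15, 15])]"

text \<open>At a leaf \<open>Search k []\<close> every survivor of item k clashes with a block
  chosen on the way down.\<close>

definition search_involution2 :: search where
  "search_involution2 =
   Search 0 [Search 7 [Search 8 [Search 10 [Search 11 [Search 12 [Search 13 [], Search 14 []]]],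
   Search 9 [], Search 9 []], Search 2 [Search 15 [Search 16 []]]], Search 1 [Search 2 [Search 3
   [Search 4 [Search 5 []]], Search 4 [Search 6 [], Search 6 [], Search 3 [Search 6 [], Search 5
   [], Search 5 []]]], Search 2 [Search 3 [Search 4 [Search 5 []]], Search 4 [Search 6 [], Search
   6 [], Search 3 [Search 6 [], Search 5 [], Search 5 []]]]], Search 1 [Search 2 [Search 3 [Search
   4 [Search 5 []]], Search 4 [Search 6 [], Search 6 [], Search 3 [Search 6 [], Search 5 [],
   Search 5 []]]], Search 2 [Search 3 [Search 4 [Search 5 []]], Search 4 [Search 6 [], Search 6
   [], Search 3 [Search 6 [], Search 5 [], Search 5 []]]]], Search 17 [Search 10 [Search 12
   [Search 14 []], Search 13 []], Search 12 [Search 5 [], Search 5 [], Search 18 [Search 19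
   [Search 14 [], Search 14 []], Search 3 [Search 4 [Search 1 [], Search 5 []]]]]]]"

lemma survivors_involution2: "map (survivors involution2 [2, 4, 5, 6, 11, 13, 14, 15, 19, 20, 21,
  25, 26, 27, 31, 32, 33, 37, 38, 39] [1, 10]) items_involution2 =
   [[[5,9,38,42,2,3,10],
     [5,9,38,42,25,30,1],
     [5,9,38,42,25,30,10],
     [5,9,38,42,26,29,10]],
    [[25,30,39,41,2,3,1],
     [25,30,39,41,2,3,10],
     [25,30,39,41,5,9,1],
     [25,30,39,41,5,9,10]],
    [[2,3,27,28,5,9,10],
     [2,3,27,28,37,40,10],
     [2,3,27,28,39,41,1],
     [2,3,27,28,39,41,10]],
    [[5,9,31,36,6,8,10],
     [5,9,31,36,25,30,10],
     [5,9,31,36,27,28,1],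
     [5,9,31,36,27,28,10]],
    [[6,8,39,41,2,3,10],
     [6,8,39,41,31,36,1],
     [6,8,39,41,31,36,10],
     [6,8,39,41,32,35,10]],
    [[27,28,32,35,5,9,1],
     [27,28,32,35,5,9,10],
     [27,28,32,35,6,8,1],
     [27,28,32,35,6,8,10]],
    [[31,36,37,40,2,3,1],
     [31,36,37,40,2,3,10],
     [31,36,37,40,6,8,1],
     [31,36,37,40,6,8,10]],
    [[2,3,20,24,4,7,10],
     [2,3,20,24,38,42,1],
     [2,3,20,24,38,42,10],
     [2,3,20,24,39,41,10]],
    [[4,7,37,40,2,3,10],
     [4,7,37,40,19,22,10],
     [4,7,37,40,21,23,1],
     [4,7,37,40,21,23,10]],
    [[21,23,38,42,2,3,1],
     [21,23,38,42,2,3,10],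
     [21,23,38,42,4,7,1],
     [21,23,38,42,4,7,10]],
    [[4,7,32,35,6,8,10],
     [4,7,32,35,19,22,1],
     [4,7,32,35,19,22,10],
     [4,7,32,35,20,24,10]],
    [[4,7,5,9,2,3,1],
     [4,7,5,9,2,3,10],
     [4,7,5,9,6,8,1],
     [4,7,5,9,6,8,10],
     [4,7,5,9,19,22,10],
     [4,7,5,9,25,30,10]],
    [[6,8,26,29,5,9,10],
     [6,8,26,29,32,35,1],
     [6,8,26,29,32,35,10],
     [6,8,26,29,33,34,10]],
    [[20,24,26,29,4,7,1],
     [20,24,26,29,4,7,10],
     [20,24,26,29,5,9,1],
     [20,24,26,29,5,9,10]],
    [[19,22,33,34,4,7,1],
     [19,22,33,34,4,7,10],
     [19,22,33,34,6,8,1],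
     [19,22,33,34,6,8,10]],
    [[2,3,33,34,6,8,10],
     [2,3,33,34,37,40,1],
     [2,3,33,34,37,40,10],
     [2,3,33,34,38,42,10]],
    [[2,3,4,7,5,9,1],
     [2,3,4,7,5,9,10],
     [2,3,4,7,6,8,1],
     [2,3,4,7,6,8,10],
     [2,3,4,7,20,24,10],
     [2,3,4,7,37,40,10]],
    [[5,9,19,22,4,7,10],
     [5,9,19,22,26,29,1],
     [5,9,19,22,26,29,10],
     [5,9,19,22,27,28,10]],
    [[6,8,21,23,4,7,10],
     [6,8,21,23,31,36,10],
     [6,8,21,23,33,34,1],
     [6,8,21,23,33,34,10]],
    [[4,7,38,42,21,23,1],
     [4,7,38,42,21,23,10],
     [4,7,38,42,26,29,1],
     [4,7,38,42,26,29,10],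
     [4,7,38,42,33,34,1],
     [4,7,38,42,33,34,10]]]"
  by (simp add: items_involution2_def)

lemma not_occurs_involution2: "\<not> occurs involution2"
proof (rule not_occurs_involution)
  show "refutes (map (survivors involution2 [2, 4, 5, 6, 11, 13, 14, 15, 19, 20, 21, 25, 26, 27, 31,
    32, 33, 37, 38, 39] [1, 10]) items_involution2) [] search_involution2"
    unfolding survivors_involution2 by (simp add: search_involution2_def clashes_def)
  show "list_all (item_ok involution2 [2, 4, 5, 6, 11, 13, 14, 15, 19, 20, 21, 25, 26, 27, 31, 32,
    33, 37, 38, 39] [1, 10]) items_involution2"
    by (simp only: items_involution2_def list.pred_inject simp_thms)
      (simp add: hits_def)
qed (simp_all add: points_list_def aut_D_involution2)
text \<open>Regularity is used twice: it identifies p with the word of a certificate, and then the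
  conjugated power with one of the five excluded elements, each time through the values at 1 and
  19.\<close>

lemma occurs_trivial:
  assumes "occurs p"
  shows "p = id"
proof (rule ccontr)
  assume "p \<noteq> id"
  note aut = occurs_aut_D[OF assms]
  note perm = aut_D_permutes[OF aut]
  have "p 1 \<in> {1..18}" using aut_D_small[OF aut, of 1] by simp
  moreover have "p 19 \<in> {19..42}"
    using aut_D_small[OF aut, of 19] permutes_in_image[OF perm, of 19] by auto
  moreover have "(p 1, p 19) \<noteq> (1, 19)" using aut_D_trivial[OF aut] \<open>p \<noteq>
    id\<close> by auto
  ultimately obtain w k h where c: "(w, k, h) \<in> set certificates" "word w 1 = p 1" "word w 19 =
    p 19"
    by (rule obtain_certificate)
  have "word w = p" by (rule aut_D_eqI[OF aut_D_word aut c(2,3)])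
  then have q: "occurs (conj_power w k h)" using occurs_conj_power assms by simp
  have "certified (w, k, h)" using certificates_valid c(1) unfolding list_all_iff by blast
  then have "(conj_power w k h 1, conj_power w k h 19) \<in> set target_values"
    unfolding certified_def by simp
  moreover have "(conj_power w k h 1, conj_power w k h 19) \<noteq> (r 1, r 19)"
    if "aut_D r" "\<not> occurs r" for r
    using aut_D_eqI[OF occurs_aut_D[OF q] that(1)] q that(2) by (metis prod.inject)
  note differ = this
  have "aut_D perm_alpha" "aut_D perm_beta"
    using aut_D_generator[of 1] aut_D_generator[of 0] by (simp_all add: generator_def)
  then show False
    using calculation differ[OF _ not_occurs_alpha] differ[OF _ not_occurs_beta]
      differ[OF aut_D_involution2 not_occurs_involution2]
      differ[OF aut_D_translation3 not_occurs_translation3]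
      differ[OF aut_D_transvection3 not_occurs_transvection3]
    by (auto simp: target_values_def)
qed

theorem theorem7:
  fixes infty :: nat and E :: "nat incidence"
  assumes "infty \<notin> {1..42}"
    and "points E = {1..42} \<union> {infty}"
    and "steiner_system 4 7 43 E"
    and "derived_design infty E = design_D"
  shows "stabilizer (aut_group E) (\<lambda>p x. p x) infty = {id}"
proof -
  have E: "E = ({1..42} \<union> {infty}, blocks E)" using assms(2) by (metis prod.collapse)
  have ext: "extension infty (blocks E)"
    using assms(1,3,4) E by unfold_locales metis+
  have "p = id" if "p permutes points E" "(\<lambda>B. p ` B) ` blocks E = blocks E" "p infty =
    infty" for p
  proof -
    \<comment> \<open>Since p fixes the added point, it moves only points of D, as
      \<open>occurs\<close> demands.\<close>
    have "p permutes {1..42}"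
      by (rule permutes_superset[OF that(1)]) (use assms(2) that(3) in auto)
    then show ?thesis using occurs_trivial ext that(2) unfolding occurs_def by blast
  qed
  moreover have "id permutes points E" by (rule permutes_id)
  ultimately show ?thesis unfolding stabilizer_def aut_group_def by auto
qed

end
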